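(* Assume the standing assumption (A) described in the context. Let $\tilde\epsilon,\gamma_1,\sigma_1,\rho>0$ and $\beta_1\in\mathcal{KL}$ be such that property (P) of the context holds, and let $\epsilon\in(0,\tilde\epsilon]$. Let $L>0$ be the Lipschitz constant of the regularized dual gradient, $\alpha\in(0,1/L)$, and consider $\ell\in\mathbb N$ with $\ell>\frac{2}{\sqrt{\alpha\epsilon}}-1$. Then there exists a finite $\ell^*>0$ such that, if $\ell\ge\ell^*$, the closed-loop system $$x_{t+1}=Ax_t+B\,q(\lambda_t,x_t)+d_t,\qquad \lambda_{t+1}=\mathcal T^\ell(\lambda_{t},x_{t+1}),\qquad t\ge0,$$ is locally input-to-state stable (LISS) with respect to the disturbance $d$, in the following sense: there exist $\bar\rho>0$, $\beta\in\mathcal{KL}$ and $\gamma\in\mathcal K$ such that for all $x_0\in\mathbb R^n$, $\lambda_0\in\mathbb R^{Np}$, and $(d_t)_{t\ge0}\subset\mathbb R^n$ with $\|x_0\|\le\bar\rho$, $\|\lambda_0-S^d_\epsilon(x_0)\|\le\bar\rho$, $\|d\|_\infty\le\bar\rho$, the closed-loop trajectory satisfies $x_t\in\Gamma_N$ for all $t\ge0$ and, with $e_t=\lambda_t-S^d_\epsilon(x_t)$, $$\|(x_t,e_t)\|\le\beta(\|(x_0,e_0)\|,t)+\gamma(\|d\|_\infty)\quad\text{for all }t\ge0.$$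
   Context: Notation: $\|\cdot\|$ Euclidean norm; $\|s\|_\infty=\sup_t\|s_t\|$ for sequences. Class $\mathcal K$: continuous, strictly increasing $\gamma:\mathbb R_{\ge0}\to\mathbb R_{\ge0}$ with $\gamma(0)=0$; class $\mathcal L$: continuous, strictly decreasing, tending to $0$; class $\mathcal{KL}$: $\beta(\cdot,s)\in\mathcal K$ for each $s$, $\beta(r,\cdot)\in\mathcal L$ for each $r>0$. Setting. $M$ agents $i$ with $A^i\in\mathbb R^{n^i\times n^i}$, $B^i\in\mathbb R^{n^i\times m^i}$; $n=\sum_in^i$, $m=\sum_im^i$, $x=(x^1,\dots,x^M)$, $A=\mathrm{blkdiag}(A^i)$, $B=\mathrm{blkdiag}(B^i)$. Polyhedra $\mathcal U^i=\{\nu:C_u^i\nu\le c_u^i\}$, $\mathcal X^i=\{\xi:C_x^i\xi\le c_x^i\}$, $\mathcal X_f^i=\{\xi:C_N^i\xi\le c_N^i\}$; matrices $E_u^i\in\mathbb R^{p\times m^i}$, $E_x^i\in\mathbb R^{p\times n^i}$; $\bar b\in\mathbb R^p$; horizon $N\ge1$; symmetric weights $Q^i,R^i,P^i$. Standing assumption (A): for each $i$, (i) $(A^i,B^i)$ stabilizable; (ii) $\mathcal X^i,\mathcal U^i$ contain the origin in their interior; (iii) $Q^i,R^i$ positive definite; (iv) there is $K^i$ with $\mathcal X_f^i$ invariant under $\xi\mapsto(A^i-B^iK^i)\xi$, $\mathcal X_f^i\subseteq\mathcal X^i$, $-K^i\mathcal X_f^i\subseteq\mathcal U^i$, and $P^i\succ0$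 with $\|(A^i-B^iK^i)\xi\|_{P^i}^2-\|\xi\|_{P^i}^2\le-\|\xi\|^2_{Q^i+(K^i)^\top R^iK^i}$ for all $\xi$. Optimal control problem. For $u^i=(\nu^i_0,\dots,\nu^i_{N-1})$, $\xi^i_0=x^i$, $\xi^i_{k+1}=A^i\xi^i_k+B^i\nu^i_k$; $f^i(u^i,x^i)=\tfrac12(\|\xi^i_N\|^2_{P^i}+\sum_{k=0}^{N-1}(\|\xi^i_k\|^2_{Q^i}+\|\nu^i_k\|^2_{R^i}))$; $\mathcal Z^i(x^i)=\{u^i:\nu^i_k\in\mathcal U^i,\xi^i_k\in\mathcal X^i\ (k<N),\ \xi^i_N\in\mathcal X_f^i\}$; $E^i,F^i$ defined by $E^iu^i+F^ix^i=(E_u^i\nu^i_k+E_x^i\xi^i_k)_{k=0}^{N-1}$; $b=\mathbf 1_N\otimes\bar b$; $f=\sum_if^i$, $\mathcal Z(x)=\prod_i\mathcal Z^i(x^i)$, $Eu+Fx=\sum_i(E^iu^i+F^ix^i)$. Problem: $\min\{f(u,x):u\in\mathcal Z(x),Eu+Fx\le b\}$; $\Gamma_N$ = set of $x$ where feasible. $\Xi$ extracts $(\nu^1_0,\dots,\nu^M_0)\in\mathbb R^m$ from $u$. Regularized dual. $u(\lambda,x)$ = unique minimizer of $f(u,x)+\lambda^\top Eu$ over $\mathcal Z(x)$; $q(\lambda,x)=\Xi u(\lambda,x)$. $\varphi_\epsilon(\lambda,x)=-\min_{u\in\mathcal Z(x)}[f(u,x)+\lambda^\top Eu]+\tfrac\epsilon2\|\lambda\|^2$;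 $L$ is a constant such that $\nabla_\lambda\varphi_\epsilon(\cdot,x)$ is $L$-Lipschitz for all $x\in\Gamma_N$. $\psi_\epsilon(\lambda,x)=\varphi_\epsilon(\lambda,x)+\lambda^\top(b-Fx)$ for $\lambda\ge0$, $+\infty$ otherwise; $S^d_\epsilon(x)$ its unique minimizer; $\kappa_\epsilon(x)=q(S^d_\epsilon(x),x)$. Algorithm. $\mathcal T^\ell(\lambda,x)$ is the output $\lambda_\ell$ of: $\lambda_0=\mu_0=\lambda$, $\theta_0=1$; for $j=0,\dots,\ell-1$: $u_j=u(\lambda_j,x)$; $\mu_{j+1}=\Pi_{\mathbb R^{Np}_{\ge0}}[\lambda_j+\alpha(Eu_j+Fx-b-\epsilon\lambda_j)]$; $\theta_{j+1}=\tfrac12(1+\sqrt{1+4\theta_j^2})$; $\lambda_{j+1}=\mu_{j+1}+\frac{\theta_j-1}{\theta_{j+1}}(\mu_{j+1}-\mu_j)$. Property (P) (for constants $\tilde\epsilon,\gamma_1,\sigma_1,\rho,\beta_1$): for every $\epsilon'\in(0,\tilde\epsilon]$, every $x_0$ with $\|x_0\|\le\rho$ and all sequences $(\delta u_t)\subset\mathbb R^m$, $(d_t)\subset\mathbb R^n$ with $\|\delta u\|_\infty,\|d\|_\infty\le\rho$, the recursion $x_{t+1}=Ax_t+B(\kappa_{\epsilon'}(x_t)+\delta u_t)+d_t$ stays in $\Gamma_N$ and satisfies $\|x_t\|\le\beta_1(\|x_0\|,t)+\gamma_1\|\delta u\|_\infty+\sigma_1\|d\|_\infty$ for all $t$. 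*)

theory Defs
  imports Complex_Main "HOL-Library.Extended_Real" "Jordan_Normal_Form.Matrix" "Jordan_Normal_Form.Char_Poly"
begin

definition class_K :: "(real \<Rightarrow> real) \<Rightarrow> bool" where
  "class_K g \<longleftrightarrow> continuous_on {0..} g \<and> strict_mono_on {0..} g \<and> g 0 = 0"

definition class_L :: "(real \<Rightarrow> real) \<Rightarrow> bool" where
  "class_L g \<longleftrightarrow> continuous_on {0..} g \<and>
     (\<forall>s\<ge>0. \<forall>t. s < t \<longrightarrow> g t < g s) \<and> (g \<longlongrightarrow> 0) at_top"

definition class_KL :: "(real \<Rightarrow> real \<Rightarrow> real) \<Rightarrow> bool" where
  "class_KL b \<longleftrightarrow> (\<forall>s\<ge>0. class_K (\<lambda>r. b r s)) \<and> (\<forall>r>0. class_L (\<lambda>s. b r s))"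

definition vnorm :: "real vec \<Rightarrow> real" where
  "vnorm v = sqrt (v \<bullet> v)"

definition quad :: "real mat \<Rightarrow> real vec \<Rightarrow> real" where
  "quad W v = v \<bullet> (W *\<^sub>v v)"

text \<open>Euclidean norm of a stacked vector given by its list of blocks.\<close>
definition lnorm :: "real vec list \<Rightarrow> real" where
  "lnorm xs = sqrt (\<Sum>i<length xs. (vnorm (xs ! i))\<^sup>2)"

definition pnorm :: "real vec list \<Rightarrow> real vec \<Rightarrow> real" where
  "pnorm x e = sqrt ((lnorm x)\<^sup>2 + (vnorm e)\<^sup>2)"

definition supnorm :: "(nat \<Rightarrow> real vec list) \<Rightarrow> real" where
  "supnorm s = (SUP t. lnorm (s t))"

definition proj_nn :: "real vec \<Rightarrow> real vec" where
  "proj_nn v = vec (dim_vec v) (\<lambda>i. max 0 (v $ i))"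

definition pos_def :: "nat \<Rightarrow> real mat \<Rightarrow> bool" where
  "pos_def n W \<longleftrightarrow> W \<in> carrier_mat n n \<and>
     (\<forall>v. dim_vec v = n \<and> v \<noteq> 0\<^sub>v n \<longrightarrow> quad W v > 0)"

definition symmetric :: "real mat \<Rightarrow> bool" where
  "symmetric W \<longleftrightarrow> transpose_mat W = W"

definition schur_stable :: "real mat \<Rightarrow> bool" where
  "schur_stable F \<longleftrightarrow> (\<forall>z::complex. poly (char_poly (map_mat complex_of_real F)) z = 0 \<longrightarrow> cmod z < 1)"

definition stabilizable :: "nat \<Rightarrow> nat \<Rightarrow> real mat \<Rightarrow> real mat \<Rightarrow> bool" where
  "stabilizable n m A B \<longleftrightarrow> (\<exists>K \<in> carrier_mat m n. schur_stable (A - B * K))"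

definition polyh :: "nat \<Rightarrow> real mat \<Rightarrow> real vec \<Rightarrow> real vec set" where
  "polyh n C c = {\<xi>. dim_vec \<xi> = n \<and> C *\<^sub>v \<xi> \<le> c}"

definition zero_interior :: "nat \<Rightarrow> real vec set \<Rightarrow> bool" where
  "zero_interior n S \<longleftrightarrow> (\<exists>r>0. \<forall>\<xi>. dim_vec \<xi> = n \<and> vnorm \<xi> < r \<longrightarrow> \<xi> \<in> S)"

definition has_grad :: "nat \<Rightarrow> (real vec \<Rightarrow> real) \<Rightarrow> real vec \<Rightarrow> real vec \<Rightarrow> bool" where
  "has_grad n f g lam \<longleftrightarrow> dim_vec g = n \<and>
     (\<forall>e>0. \<exists>d>0. \<forall>h. dim_vec h = n \<and> vnorm h < d \<longrightarrow>
        \<bar>f (lam + h) - f lam - g \<bullet> h\<bar> \<le> e * vnorm h)"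

record mpc_data =
  nag  :: nat
  ndim :: "nat \<Rightarrow> nat"
  mdim :: "nat \<Rightarrow> nat"
  pdim :: nat
  hor  :: nat
  Am   :: "nat \<Rightarrow> real mat"
  Bm   :: "nat \<Rightarrow> real mat"
  Cu   :: "nat \<Rightarrow> real mat"
  cu   :: "nat \<Rightarrow> real vec"
  Cx   :: "nat \<Rightarrow> real mat"
  cx   :: "nat \<Rightarrow> real vec"
  CN   :: "nat \<Rightarrow> real mat"
  cN   :: "nat \<Rightarrow> real vec"
  Eu   :: "nat \<Rightarrow> real mat"
  Ex   :: "nat \<Rightarrow> real mat"
  bbar :: "real vec"
  Qw   :: "nat \<Rightarrow> real mat"
  Rw   :: "nat \<Rightarrow> real mat"
  Pw   :: "nat \<Rightarrow> real mat"

definition wf_data :: "mpc_data \<Rightarrow> bool" where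
  "wf_data D \<longleftrightarrow> hor D \<ge> 1 \<and> dim_vec (bbar D) = pdim D \<and>
    (\<forall>i < nag D. Am D i \<in> carrier_mat (ndim D i) (ndim D i)
       \<and> Bm D i \<in> carrier_mat (ndim D i) (mdim D i)
       \<and> dim_col (Cu D i) = mdim D i \<and> dim_vec (cu D i) = dim_row (Cu D i)
       \<and> dim_col (Cx D i) = ndim D i \<and> dim_vec (cx D i) = dim_row (Cx D i)
       \<and> dim_col (CN D i) = ndim D i \<and> dim_vec (cN D i) = dim_row (CN D i)
       \<and> Eu D i \<in> carrier_mat (pdim D) (mdim D i)
       \<and> Ex D i \<in> carrier_mat (pdim D) (ndim D i)
       \<and> Qw D i \<in> carrier_mat (ndim D i) (ndim D i) \<and> symmetric (Qw D i)
       \<and> Rw D i \<in> carrier_mat (mdim D i) (mdim D i) \<and> symmetric (Rw D i)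
       \<and> Pw D i \<in> carrier_mat (ndim D i) (ndim D i) \<and> symmetric (Pw D i))"

abbreviation Uset where "Uset D i \<equiv> polyh (mdim D i) (Cu D i) (cu D i)"
abbreviation Xset where "Xset D i \<equiv> polyh (ndim D i) (Cx D i) (cx D i)"
abbreviation Xfset where "Xfset D i \<equiv> polyh (ndim D i) (CN D i) (cN D i)"

definition standing_A :: "mpc_data \<Rightarrow> bool" where
  "standing_A D \<longleftrightarrow> (\<forall>i < nag D.
     stabilizable (ndim D i) (mdim D i) (Am D i) (Bm D i)
   \<and> zero_interior (ndim D i) (Xset D i) \<and> zero_interior (mdim D i) (Uset D i)
   \<and> pos_def (ndim D i) (Qw D i) \<and> pos_def (mdim D i) (Rw D i)
   \<and> (\<exists>K \<in> carrier_mat (mdim D i) (ndim D i).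
        (\<forall>\<xi> \<in> Xfset D i. (Am D i - Bm D i * K) *\<^sub>v \<xi> \<in> Xfset D i)
      \<and> Xfset D i \<subseteq> Xset D i
      \<and> (\<forall>\<xi> \<in> Xfset D i. - (K *\<^sub>v \<xi>) \<in> Uset D i)
      \<and> pos_def (ndim D i) (Pw D i)
      \<and> (\<forall>\<xi>. dim_vec \<xi> = ndim D i \<longrightarrow>
           quad (Pw D i) ((Am D i - Bm D i * K) *\<^sub>v \<xi>) - quad (Pw D i) \<xi>
             \<le> - quad (Qw D i + transpose_mat K * Rw D i * K) \<xi>)))"

text \<open>States x = (x^1,...,x^M) are lists of blocks; an input sequence u = (u^1,...,u^M) is a list
  (over agents) of lists (over k < N) of inputs nu^i_k.\<close>

definition valid_state :: "mpc_data \<Rightarrow> real vec list \<Rightarrow> bool" where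
  "valid_state D x \<longleftrightarrow> length x = nag D \<and> (\<forall>i < nag D. dim_vec (x ! i) = ndim D i)"

definition valid_input :: "mpc_data \<Rightarrow> real vec list \<Rightarrow> bool" where
  "valid_input D v \<longleftrightarrow> length v = nag D \<and> (\<forall>i < nag D. dim_vec (v ! i) = mdim D i)"

fun traj :: "mpc_data \<Rightarrow> nat \<Rightarrow> real vec \<Rightarrow> real vec list \<Rightarrow> nat \<Rightarrow> real vec" where
  "traj D i x us 0 = x"
| "traj D i x us (Suc k) = Am D i *\<^sub>v traj D i x us k + Bm D i *\<^sub>v (us ! k)"

definition cost_i :: "mpc_data \<Rightarrow> nat \<Rightarrow> real vec list \<Rightarrow> real vec \<Rightarrow> real" where
  "cost_i D i us x = (1/2) * (quad (Pw D i) (traj D i x us (hor D))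
     + (\<Sum>k<hor D. quad (Qw D i) (traj D i x us k) + quad (Rw D i) (us ! k)))"

definition cost :: "mpc_data \<Rightarrow> real vec list list \<Rightarrow> real vec list \<Rightarrow> real" where
  "cost D u x = (\<Sum>i<nag D. cost_i D i (u ! i) (x ! i))"

definition Zset_i :: "mpc_data \<Rightarrow> nat \<Rightarrow> real vec \<Rightarrow> real vec list set" where
  "Zset_i D i x = {us. length us = hor D
     \<and> (\<forall>k < hor D. us ! k \<in> Uset D i \<and> traj D i x us k \<in> Xset D i)
     \<and> traj D i x us (hor D) \<in> Xfset D i}"

definition Zset :: "mpc_data \<Rightarrow> real vec list \<Rightarrow> real vec list list set" where
  "Zset D x = {u. length u = nag D \<and> (\<forall>i < nag D. u ! i \<in> Zset_i D i (x ! i))}"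

text \<open>Coupling map G(u,x) = E u + F x in R^{Np}: block k (entries k*p .. k*p+p-1) equals
  sum_i (E_u^i nu^i_k + E_x^i xi^i_k).\<close>
definition coupling :: "mpc_data \<Rightarrow> real vec list list \<Rightarrow> real vec list \<Rightarrow> real vec" where
  "coupling D u x = vec (hor D * pdim D) (\<lambda>j.
     \<Sum>i<nag D. (Eu D i *\<^sub>v (u ! i ! (j div pdim D))
                 + Ex D i *\<^sub>v traj D i (x ! i) (u ! i) (j div pdim D)) $ (j mod pdim D))"

definition zero_state :: "mpc_data \<Rightarrow> real vec list" where
  "zero_state D = map (\<lambda>i. 0\<^sub>v (ndim D i)) [0..<nag D]"

definition zero_inputs :: "mpc_data \<Rightarrow> real vec list list" where
  "zero_inputs D = map (\<lambda>i. replicate (hor D) (0\<^sub>v (mdim D i))) [0..<nag D]"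

definition Emap :: "mpc_data \<Rightarrow> real vec list list \<Rightarrow> real vec" where
  "Emap D u = coupling D u (zero_state D)"

definition Fmap :: "mpc_data \<Rightarrow> real vec list \<Rightarrow> real vec" where
  "Fmap D x = coupling D (zero_inputs D) x"

definition bvec :: "mpc_data \<Rightarrow> real vec" where
  "bvec D = vec (hor D * pdim D) (\<lambda>j. bbar D $ (j mod pdim D))"

definition GammaN :: "mpc_data \<Rightarrow> real vec list set" where
  "GammaN D = {x. valid_state D x \<and> (\<exists>u \<in> Zset D x. Emap D u + Fmap D x \<le> bvec D)}"

definition Xi :: "real vec list list \<Rightarrow> real vec list" where
  "Xi u = map (\<lambda>us. us ! 0) u"

definition Lagr :: "mpc_data \<Rightarrow> real vec \<Rightarrow> real vec list \<Rightarrow> real vec list list \<Rightarrow> real" where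
  "Lagr D lam x u = cost D u x + lam \<bullet> Emap D u"

definition uopt :: "mpc_data \<Rightarrow> real vec \<Rightarrow> real vec list \<Rightarrow> real vec list list" where
  "uopt D lam x = (THE u. u \<in> Zset D x \<and> (\<forall>v \<in> Zset D x. Lagr D lam x u \<le> Lagr D lam x v))"

definition qfb :: "mpc_data \<Rightarrow> real vec \<Rightarrow> real vec list \<Rightarrow> real vec list" where
  "qfb D lam x = Xi (uopt D lam x)"

definition phi :: "mpc_data \<Rightarrow> real \<Rightarrow> real vec \<Rightarrow> real vec list \<Rightarrow> real" where
  "phi D eps lam x = - (INF u \<in> Zset D x. Lagr D lam x u) + eps / 2 * (vnorm lam)\<^sup>2"

definition psi :: "mpc_data \<Rightarrow> real \<Rightarrow> real vec \<Rightarrow> real vec list \<Rightarrow> ereal" where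
  "psi D eps lam x = (if 0\<^sub>v (dim_vec lam) \<le> lam
       then ereal (phi D eps lam x + lam \<bullet> (bvec D - Fmap D x)) else \<infinity>)"

definition Sd :: "mpc_data \<Rightarrow> real \<Rightarrow> real vec list \<Rightarrow> real vec" where
  "Sd D eps x = (THE lam. dim_vec lam = hor D * pdim D \<and>
      (\<forall>mu. dim_vec mu = hor D * pdim D \<longrightarrow> psi D eps lam x \<le> psi D eps mu x))"

definition kappa :: "mpc_data \<Rightarrow> real \<Rightarrow> real vec list \<Rightarrow> real vec list" where
  "kappa D eps x = qfb D (Sd D eps x) x"

definition dual_grad_lipschitz :: "mpc_data \<Rightarrow> real \<Rightarrow> real \<Rightarrow> bool" where
  "dual_grad_lipschitz D eps L \<longleftrightarrow> (\<forall>x \<in> GammaN D. \<exists>G.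
     (\<forall>lam. dim_vec lam = hor D * pdim D \<longrightarrow>
        has_grad (hor D * pdim D) (\<lambda>l. phi D eps l x) (G lam) lam)
   \<and> (\<forall>l1 l2. dim_vec l1 = hor D * pdim D \<and> dim_vec l2 = hor D * pdim D \<longrightarrow>
        vnorm (G l1 - G l2) \<le> L * vnorm (l1 - l2)))"

definition alg_step :: "mpc_data \<Rightarrow> real \<Rightarrow> real \<Rightarrow> real vec list
    \<Rightarrow> real vec \<times> real vec \<times> real \<Rightarrow> real vec \<times> real vec \<times> real" where
  "alg_step D eps alpha x s = (case s of (lam, mu, th) \<Rightarrow>
     let u = uopt D lam x;
         mu' = proj_nn (lam + alpha \<cdot>\<^sub>v (Emap D u + Fmap D x - bvec D - eps \<cdot>\<^sub>v lam));
         th' = (1 + sqrt (1 + 4 * th\<^sup>2)) / 2;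
         lam' = mu' + ((th - 1) / th') \<cdot>\<^sub>v (mu' - mu)
     in (lam', mu', th'))"

definition Talg :: "mpc_data \<Rightarrow> real \<Rightarrow> real \<Rightarrow> nat \<Rightarrow> real vec \<Rightarrow> real vec list \<Rightarrow> real vec" where
  "Talg D eps alpha l lam x = fst ((alg_step D eps alpha x ^^ l) (lam, lam, 1))"

definition sys_step :: "mpc_data \<Rightarrow> real vec list \<Rightarrow> real vec list \<Rightarrow> real vec list \<Rightarrow> real vec list" where
  "sys_step D x v w = map (\<lambda>i. Am D i *\<^sub>v (x ! i) + Bm D i *\<^sub>v (v ! i) + w ! i) [0..<nag D]"

fun ideal_cl :: "mpc_data \<Rightarrow> real \<Rightarrow> real vec list \<Rightarrow> (nat \<Rightarrow> real vec list)
    \<Rightarrow> (nat \<Rightarrow> real vec list) \<Rightarrow> nat \<Rightarrow> real vec list" where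
  "ideal_cl D eps x0 du d 0 = x0"
| "ideal_cl D eps x0 du d (Suc t) =
     (let x = ideal_cl D eps x0 du d t in
      sys_step D x (map2 (+) (kappa D eps x) (du t)) (d t))"

definition property_P :: "mpc_data \<Rightarrow> real \<Rightarrow> real \<Rightarrow> real \<Rightarrow> real \<Rightarrow> (real \<Rightarrow> real \<Rightarrow> real) \<Rightarrow> bool" where
  "property_P D et g1 s1 rho b1 \<longleftrightarrow>
    (\<forall>eps'. 0 < eps' \<and> eps' \<le> et \<longrightarrow>
      (\<forall>x0 du d. valid_state D x0 \<and> lnorm x0 \<le> rho
         \<and> (\<forall>t. valid_input D (du t) \<and> lnorm (du t) \<le> rho)
         \<and> (\<forall>t. valid_state D (d t) \<and> lnorm (d t) \<le> rho) \<longrightarrow>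
         (\<forall>t. ideal_cl D eps' x0 du d t \<in> GammaN D
             \<and> lnorm (ideal_cl D eps' x0 du d t)
                 \<le> b1 (lnorm x0) (real t) + g1 * supnorm du + s1 * supnorm d)))"

fun alg_cl :: "mpc_data \<Rightarrow> real \<Rightarrow> real \<Rightarrow> nat \<Rightarrow> real vec list \<Rightarrow> real vec
    \<Rightarrow> (nat \<Rightarrow> real vec list) \<Rightarrow> nat \<Rightarrow> real vec list \<times> real vec" where
  "alg_cl D eps alpha l x0 lam0 d 0 = (x0, lam0)"
| "alg_cl D eps alpha l x0 lam0 d (Suc t) =
     (case alg_cl D eps alpha l x0 lam0 d t of (x, lam) \<Rightarrow>
        let x' = sys_step D x (qfb D lam x) (d t) in (x', Talg D eps alpha l lam x'))"

definition LISS :: "mpc_data \<Rightarrow> real \<Rightarrow> real \<Rightarrow> nat \<Rightarrow> bool" where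
  "LISS D eps alpha l \<longleftrightarrow> (\<exists>rb > 0. \<exists>b g. class_KL b \<and> class_K g \<and>
     (\<forall>x0 lam0 d. valid_state D x0 \<and> dim_vec lam0 = hor D * pdim D
        \<and> (\<forall>t. valid_state D (d t))
        \<and> lnorm x0 \<le> rb \<and> vnorm (lam0 - Sd D eps x0) \<le> rb
        \<and> (\<forall>t. lnorm (d t) \<le> rb) \<longrightarrow>
        (\<forall>t. let (x, lam) = alg_cl D eps alpha l x0 lam0 d t in
             x \<in> GammaN D
           \<and> pnorm x (lam - Sd D eps x)
               \<le> b (pnorm x0 (lam0 - Sd D eps x0)) (real t) + g (supnorm d))))"

end

theory Submission
  imports Defs "HOL-Analysis.Inner_Product" "HOL-Analysis.Product_Vector"
begin

text \<open>Write \<open>\<lambda>*(x)\<close> for the regularized dual solution and \<open>e\<close> for the distance of the running multiplier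
  to it. Accelerated projected gradient on the strongly convex dual contracts the distance to
  \<open>\<lambda>*(x)\<close> by the factor \<open>\<eta> = 6 / (l sqrt(\<alpha> \<epsilon>))\<close>. The map \<open>\<lambda>*\<close> is calm at \<open>0\<close>: it is Lipschitz
  along parameters with a common active set, Hoelder continuous at \<open>0\<close> by convexity of the feasible
  set in input and state jointly, and there are only finitely many active sets. Hence
  \<open>e(t+1) \<le> \<eta> (e(t) + C (|x(t)| + |x(t+1)|))\<close>, whereas property (P) bounds \<open>x\<close> by linear gains of the input
  perturbation \<open>q(\<lambda>(t), x(t)) - \<kappa>(x(t)) = O(e(t))\<close> and of the disturbance. For large \<open>l\<close> the factor \<open>\<eta>\<close> is
  small enough for a small-gain argument. On a ball of initial data it yields a stability bound
  \<open>\<sigma>(r)\<close> and a uniform decay bound \<open>\<tau>(t)\<close>, and \<open>min \<sigma> \<tau> \<le> sqrt(\<sigma> \<tau>)\<close> is of class KL.\<close>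

text \<open>State and multiplier error bound each other in a circle: property (P) bounds the state
  only while the error is small, and the optimizer bounds the error only while the state is small.
  The circle is cut in time: the state at the end of a window depends on errors strictly before that
  end, and the error at the end depends on the state bounded just before. (P) speaks of the loop
  with the exact controller and of perturbations bounded for all times. A run of the algorithm is
  turned into such a loop by declaring the deviation of its input from the exact one to be the
  perturbation inside the window, and zero after it. Calmness at 0 can replace Lipschitz continuity
  of the dual solution because the solutions at successive states are compared through the one at
  the origin; the price is a sum of norms in place of the norm of a difference, which a small factor
  absorbs. The regularization makes the dual strongly convex, so its solution is unique without a
  constraint qualification.\<close>

section \<open>Finitely supported real vectors\<close>

text \<open>The dimensions of the problem are terms, so no Euclidean space type fits; finitely supported
  functions form one inner product space containing all spaces that occur.\<close>

typedef 'i fsv = "{f :: 'i \<Rightarrow> real. finite {i. f i \<noteq> 0}}"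
  morphisms coord Abs_fsv
  by (rule exI[of _ "\<lambda>_. 0"]) simp

setup_lifting type_definition_fsv

lemma finite_support [simp]: "finite {i. coord v i \<noteq> 0}"
  using coord[of v] by simp

lemma fsv_eqI: "(\<And>i. coord v i = coord w i) \<Longrightarrow> v = w"
  by (simp add: coord_inject[symmetric] fun_eq_iff)

instantiation fsv :: (type) real_vector
begin

lift_definition zero_fsv :: "'a fsv" is "\<lambda>_. 0" by simp
lift_definition plus_fsv :: "'a fsv \<Rightarrow> 'a fsv \<Rightarrow> 'a fsv" is "\<lambda>f g i. f i + g i"
proof -
  fix f g :: "'a \<Rightarrow> real"
  assume "finite {i. f i \<noteq> 0}" "finite {i. g i \<noteq> 0}"
  then have "finite ({i. f i \<noteq> 0} \<union> {i. g i \<noteq> 0})" by simp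
  then show "finite {i. f i + g i \<noteq> 0}"
    by (rule rev_finite_subset) auto
qed
lift_definition minus_fsv :: "'a fsv \<Rightarrow> 'a fsv \<Rightarrow> 'a fsv" is "\<lambda>f g i. f i - g i"
proof -
  fix f g :: "'a \<Rightarrow> real"
  assume "finite {i. f i \<noteq> 0}" "finite {i. g i \<noteq> 0}"
  then have "finite ({i. f i \<noteq> 0} \<union> {i. g i \<noteq> 0})" by simp
  then show "finite {i. f i - g i \<noteq> 0}"
    by (rule rev_finite_subset) auto
qed
lift_definition uminus_fsv :: "'a fsv \<Rightarrow> 'a fsv" is "\<lambda>f i. - f i" by simp
lift_definition scaleR_fsv :: "real \<Rightarrow> 'a fsv \<Rightarrow> 'a fsv" is "\<lambda>c f i. c * f i"
  by (auto elim: rev_finite_subset)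

instance
proof
  fix a b c :: "'a fsv" and r s :: real
  show "a + b + c = a + (b + c)" by transfer (simp add: add.assoc)
  show "a + b = b + a" by transfer (simp add: add.commute)
  show "0 + a = a" by transfer simp
  show "- a + a = 0" by transfer simp
  show "a - b = a + - b" by transfer simp
  show "r *\<^sub>R (a + b) = r *\<^sub>R a + r *\<^sub>R b" by transfer (simp add: distrib_left)
  show "(r + s) *\<^sub>R a = r *\<^sub>R a + s *\<^sub>R a" by transfer (simp add: distrib_right)
  show "r *\<^sub>R s *\<^sub>R a = (r * s) *\<^sub>R a" by transfer (simp add: mult.assoc)
  show "1 *\<^sub>R a = a" by transfer simp
qed

end

lemma coord_simps [simp]:
  "coord 0 i = 0" "coord (v + w) i = coord v i + coord w i"
  "coord (v - w) i = coord v i - coord w i" "coord (- v) i = - coord v i"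
  "coord (c *\<^sub>R v) i = c * coord v i"
  by (transfer; simp)+

lemma sum_support:
  assumes "finite S" "\<And>i. i \<notin> S \<Longrightarrow> coord u i = 0 \<or> coord v i = 0"
  shows "(\<Sum>i\<in>{i. coord u i \<noteq> 0}. coord u i * coord v i) = (\<Sum>i\<in>S. coord u i * coord v i)"
  using assms by (intro sum.mono_neutral_cong) auto

instantiation fsv :: (type) real_inner
begin

definition inner_fsv :: "'a fsv \<Rightarrow> 'a fsv \<Rightarrow> real"
  where "inner_fsv u v = (\<Sum>i\<in>{i. coord u i \<noteq> 0}. coord u i * coord v i)"
definition norm_fsv :: "'a fsv \<Rightarrow> real" where "norm_fsv u = sqrt (inner u u)"
definition dist_fsv :: "'a fsv \<Rightarrow> 'a fsv \<Rightarrow> real" where "dist_fsv u v = norm (u - v)"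
definition sgn_fsv :: "'a fsv \<Rightarrow> 'a fsv" where "sgn_fsv u = u /\<^sub>R norm u"
definition "(uniformity :: ('a fsv \<times> 'a fsv) filter)
  = (INF e\<in>{0<..}. principal {(x, y). dist x y < e})"
definition "open (U :: 'a fsv set)
  = (\<forall>x\<in>U. eventually (\<lambda>(x', y). x' = x \<longrightarrow> y \<in> U) uniformity)"

instance
proof
  fix x y z :: "'a fsv" and r :: real
  have supp: "inner x y = (\<Sum>i\<in>S. coord x i * coord y i)"
    if "finite S" "{i. coord x i \<noteq> 0} \<subseteq> S \<or> {i. coord y i \<noteq> 0} \<subseteq> S" for x y :: "'a fsv" and S
    unfolding inner_fsv_def using that by (intro sum_support) auto
  show "inner x y = inner y x"
    using supp[of "{i. coord x i \<noteq> 0}" x y] supp[of "{i. coord x i \<noteq> 0}" y x]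
    by (simp add: mult.commute)
  let ?S = "{i. coord x i \<noteq> 0} \<union> {i. coord y i \<noteq> 0}"
  have "inner (x + y) z = (\<Sum>i\<in>?S. coord (x + y) i * coord z i)"
    by (rule supp) auto
  also have "\<dots> = (\<Sum>i\<in>?S. coord x i * coord z i) + (\<Sum>i\<in>?S. coord y i * coord z i)"
    by (simp add: algebra_simps sum.distrib)
  also have "\<dots> = inner x z + inner y z"
    using supp[of ?S x z] supp[of ?S y z] by simp
  finally show "inner (x + y) z = inner x z + inner y z" .
  have "inner (r *\<^sub>R x) y = (\<Sum>i\<in>{i. coord x i \<noteq> 0}. coord (r *\<^sub>R x) i * coord y i)"
    by (rule supp) auto
  then show "inner (r *\<^sub>R x) y = r * inner x y"
    by (simp add: inner_fsv_def sum_distrib_left mult.assoc)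
  show "0 \<le> inner x x"
    unfolding inner_fsv_def by (simp add: sum_nonneg)
  show "(inner x x = 0) = (x = 0)"
  proof
    assume "inner x x = 0"
    then have "\<forall>i\<in>{i. coord x i \<noteq> 0}. coord x i * coord x i = 0"
      unfolding inner_fsv_def by (subst (asm) sum_nonneg_eq_0_iff) simp_all
    then have "coord x i = coord 0 i" for i by auto
    then show "x = 0" by (rule fsv_eqI)
  qed (simp add: inner_fsv_def)
qed (fact norm_fsv_def dist_fsv_def sgn_fsv_def uniformity_fsv_def open_fsv_def)+

end

lemma inner_fsv_sum:
  assumes "finite S" "\<And>i. i \<notin> S \<Longrightarrow> coord u i = 0 \<or> coord v i = 0"
  shows "inner u v = (\<Sum>i\<in>S. coord u i * coord v i)"
  unfolding inner_fsv_def using assms by (rule sum_support)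

lemma norm_fsv_sum:
  assumes "finite S" "\<And>i. i \<notin> S \<Longrightarrow> coord u i = 0"
  shows "norm u = sqrt (\<Sum>i\<in>S. (coord u i)\<^sup>2)"
  unfolding norm_eq_sqrt_inner power2_eq_square
  by (rule arg_cong[where f = sqrt], rule inner_fsv_sum) (use assms in blast)+

lemma abs_coord_le_norm: "\<bar>coord v i\<bar> \<le> norm v"
proof -
  let ?S = "insert i {i. coord v i \<noteq> 0}"
  have "(coord v i)\<^sup>2 \<le> (\<Sum>i\<in>?S. (coord v i)\<^sup>2)"
    by (rule member_le_sum) auto
  then have "sqrt ((coord v i)\<^sup>2) \<le> sqrt (\<Sum>i\<in>?S. (coord v i)\<^sup>2)"
    by (rule real_sqrt_le_mono)
  also have "sqrt (\<Sum>i\<in>?S. (coord v i)\<^sup>2) = norm v"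
    by (rule norm_fsv_sum[symmetric]) auto
  finally show ?thesis by simp
qed

lemma bounded_linear_coord: "bounded_linear (\<lambda>v. coord v i)"
  by (rule bounded_linear_intro[where K = 1]) (auto simp: abs_coord_le_norm)

definition fsv_on :: "'i set \<Rightarrow> 'i fsv set" where
  "fsv_on S = {v. \<forall>i. i \<notin> S \<longrightarrow> coord v i = 0}"

lift_definition restrict_fsv :: "'i set \<Rightarrow> ('i \<Rightarrow> real) \<Rightarrow> 'i fsv"
  is "\<lambda>S f i. if finite S \<and> i \<in> S then f i else 0"
  by (auto elim: rev_finite_subset)

lemma coord_restrict_fsv [simp]: "finite S \<Longrightarrow> coord (restrict_fsv S f) i = (if i \<in> S then f i else 0)"
  by transfer simp

lemma restrict_fsv_mem: "finite S \<Longrightarrow> restrict_fsv S f \<in> fsv_on S"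
  by (simp add: fsv_on_def)

lemma fsv_on_subspace: "subspace (fsv_on S)"
  by (auto simp: subspace_def fsv_on_def)

text \<open>The space of all finitely supported functions is not complete over an infinite index
  type. A finite coordinate subspace is, because convergence there is coordinatewise; existence of
  minimizers rests on this.\<close>

lemma fsv_on_Cauchy_convergent:
  assumes S: "finite S" and X: "\<And>n. X n \<in> fsv_on S" and "Cauchy X"
  shows "\<exists>l\<in>fsv_on S. X \<longlonglongrightarrow> l"
proof -
  have "Cauchy (\<lambda>n. coord (X n) i)" for i
    using bounded_linear.Cauchy[OF bounded_linear_coord \<open>Cauchy X\<close>] .
  then have "\<exists>a. (\<lambda>n. coord (X n) i) \<longlonglongrightarrow> a" for i
    by (simp add: Cauchy_convergent_iff convergent_def)
  then obtain a where a: "\<And>i. (\<lambda>n. coord (X n) i) \<longlonglongrightarrow> a i" by metis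
  define l where "l = restrict_fsv S a"
  have l: "l \<in> fsv_on S" unfolding l_def by (rule restrict_fsv_mem[OF S])
  have n: "norm (X n - l) = sqrt (\<Sum>i\<in>S. (coord (X n) i - a i)\<^sup>2)" for n
  proof -
    have "norm (X n - l) = sqrt (\<Sum>i\<in>S. (coord (X n - l) i)\<^sup>2)"
      using X l by (intro norm_fsv_sum[OF S]) (simp add: fsv_on_def)
    then show ?thesis using S by (simp add: l_def)
  qed
  have "(\<lambda>n. sqrt (\<Sum>i\<in>S. (coord (X n) i - a i)\<^sup>2)) \<longlonglongrightarrow> sqrt (\<Sum>i\<in>S. (a i - a i)\<^sup>2)"
    by (intro tendsto_intros a)
  then have "(\<lambda>n. norm (X n - l)) \<longlonglongrightarrow> 0" by (simp add: n)
  then have "X \<longlonglongrightarrow> l" by (simp add: LIM_zero_iff tendsto_norm_zero_iff)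
  with l show ?thesis by blast
qed

section \<open>Minimizers of strongly convex functions\<close>

text \<open>Dividing by \<open>t\<close> and letting \<open>t\<close> tend to 0 gives the claim. It
  extracts variational inequalities from minimality along a segment.\<close>

lemma nonneg_if_quadratic_nonneg:
  fixes a b :: real
  assumes "\<And>t. 0 < t \<Longrightarrow> t \<le> 1 \<Longrightarrow> 0 \<le> t * a + t\<^sup>2 * b"
  shows "0 \<le> a"
proof (rule ccontr)
  assume "\<not> 0 \<le> a"
  then have a: "a < 0" by simp
  \<comment> \<open>With this \<open>t\<close> the term \<open>t * b\<close> amounts to at most half
    of \<open>- a\<close>, so \<open>a + t * b\<close> stays negative.\<close>
  define t where "t = min 1 (- a / (2 * (\<bar>b\<bar> + 1)))"
  have t: "0 < t" "t \<le> 1" "t \<le> - a / (2 * (\<bar>b\<bar> + 1))"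
    using a by (auto simp: t_def intro!: divide_neg_pos)
  have "t * (2 * (\<bar>b\<bar> + 1)) \<le> - a"
    using t(3) by (subst (asm) pos_le_divide_eq) auto
  moreover have "t * b \<le> t * (\<bar>b\<bar> + 1)"
    using t(1) by (intro mult_left_mono) auto
  ultimately have "a + t * b < 0"
    using a by (simp add: algebra_simps)
  then have "t * (a + t * b) < 0"
    using t(1) by (intro mult_pos_neg) auto
  moreover have "0 \<le> t * (a + t * b)"
    using assms[OF t(1,2)] by (simp add: algebra_simps power2_eq_square)
  ultimately show False by simp
qed

text \<open>The endpoints lie symmetrically about \<open>p\<close>, so the linear terms of the two
  subgradient inequalities cancel; each quadratic term contributes a quarter of \<open>k\<close>
  times the squared distance.\<close>

lemma strongly_convex_midpoint:
  fixes F :: "'a::real_normed_vector \<Rightarrow> real"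
  assumes g: "bounded_linear g"
    and sub: "\<And>v. v \<in> {x, y} \<Longrightarrow> F p + g (v - p) + k * (norm (v - p))\<^sup>2 \<le> F v"
    and p: "p = (1/2) *\<^sub>R (x + y)"
  shows "2 * F p + k / 2 * (norm (x - y))\<^sup>2 \<le> F x + F y"
proof -
  interpret g: bounded_linear g by (rule g)
  have x: "x - p = (1/2) *\<^sub>R (x - y)" and y: "y - p = (- (1/2)) *\<^sub>R (x - y)"
    unfolding p by (simp_all add: algebra_simps flip: scaleR_add_left)
  have "F p + g (x - p) + k * (norm (x - p))\<^sup>2 \<le> F x"
    and "F p + g (y - p) + k * (norm (y - p))\<^sup>2 \<le> F y"
    using sub by auto
  then show ?thesis
    unfolding x y g.scaleR by (simp add: power_mult_distrib power2_eq_square)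
qed

text \<open>No compactness is involved. The midpoint inequality makes a minimizing sequence Cauchy,
  and the affine minorant at its limit shows that the limit attains the infimum. Completeness is
  asked of \<open>C\<close> only, since the ambient space may lack it.\<close>

lemma strongly_convex_ex1_minimizer:
  fixes F :: "'a::real_normed_vector \<Rightarrow> real"
  assumes ne: "C \<noteq> {}" and mid: "\<And>x y. x \<in> C \<Longrightarrow> y \<in> C \<Longrightarrow> (1/2) *\<^sub>R (x + y) \<in> C"
    and complete: "\<And>X. (\<And>n. X n \<in> C) \<Longrightarrow> Cauchy X \<Longrightarrow> \<exists>l\<in>C. X \<longlonglongrightarrow> l"
    and k: "k > 0"
    and sub: "\<And>p. p \<in> C \<Longrightarrow>
      \<exists>g. bounded_linear g \<and> (\<forall>v\<in>C. F p + g (v - p) + k * (norm (v - p))\<^sup>2 \<le> F v)"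
  shows "\<exists>!p. p \<in> C \<and> (\<forall>v\<in>C. F p \<le> F v)"
proof -
  have two: "2 * F ((1/2) *\<^sub>R (x + y)) + k / 2 * (norm (x - y))\<^sup>2 \<le> F x + F y"
    if "x \<in> C" "y \<in> C" for x y
  proof -
    have m: "(1/2) *\<^sub>R (x + y) \<in> C" by (rule mid[OF that])
    obtain g where "bounded_linear g"
      "\<forall>v\<in>C. F ((1/2) *\<^sub>R (x + y)) + g (v - (1/2) *\<^sub>R (x + y))
        + k * (norm (v - (1/2) *\<^sub>R (x + y)))\<^sup>2 \<le> F v"
      using sub[OF m] by blast
    then show ?thesis using that by (intro strongly_convex_midpoint[where g = g]) auto
  qed
  obtain p0 where p0: "p0 \<in> C" using ne by blast
  obtain g where g: "bounded_linear g"
    and g_sub: "\<And>v. v \<in> C \<Longrightarrow> F p0 + g (v - p0) + k * (norm (v - p0))\<^sup>2 \<le> F v"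
    using sub[OF p0] by blast
  obtain B where B: "\<And>v. norm (g v) \<le> norm v * B"
    using bounded_linear.bounded[OF g] by blast
  have bdd: "F p0 - B\<^sup>2 / (4 * k) \<le> F v" if "v \<in> C" for v
  proof -
    define n where "n = norm (v - p0)"
    have "- (n * B) \<le> g (v - p0)" using B[of "v - p0"] by (simp add: n_def)
    then have "F p0 - n * B + k * n\<^sup>2 \<le> F v" using g_sub[OF that] by (simp add: n_def)
    \<comment> \<open>Completing the square in \<open>n\<close> bounds the affine minorant plus
      quadratic term from below.\<close>
    moreover have "0 \<le> (2 * k * n - B)\<^sup>2 / (4 * k)" using k by simp
    moreover have "(2 * k * n - B)\<^sup>2 / (4 * k) = k * n\<^sup>2 - n * B + B\<^sup>2 / (4 * k)"
      using k by (simp add: field_simps power2_eq_square)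
    ultimately show ?thesis by linarith
  qed
  define m where "m = Inf (F ` C)"
  have bb: "bdd_below (F ` C)" using bdd by (intro bdd_belowI2)
  have m: "m \<le> F v" if "v \<in> C" for v
    unfolding m_def using that by (intro cInf_lower bb) auto
  have "\<exists>v\<in>C. F v < m + 1 / real (Suc n)" for n
  proof -
    have "m < m + 1 / real (Suc n)" by simp
    then show ?thesis unfolding m_def using ne by (subst (asm) cInf_less_iff[OF _ bb]) auto
  qed
  then obtain X where X: "\<And>n. X n \<in> C" and FX: "\<And>n. F (X n) < m + 1 / real (Suc n)"
    by metis
  have "Cauchy X"
  proof (rule CauchyI)
    fix e :: real assume e: "0 < e"
    then have "0 < k * e\<^sup>2 / 4" using k by simp
    \<comment> \<open>Two values within this threshold of the infimum leave less than
      \<open>k / 2 * e^2\<close> for the midpoint inequality.\<close>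
    then obtain N where N: "1 / real (Suc N) < k * e\<^sup>2 / 4"
      by (rule nat_approx_posE)
    have "norm (X i - X j) < e" if "i \<ge> N" "j \<ge> N" for i j
    proof -
      have "1 / real (Suc i) \<le> 1 / real (Suc N)" "1 / real (Suc j) \<le> 1 / real (Suc N)"
        using that by (simp_all add: frac_le)
      moreover have "k / 2 * (norm (X i - X j))\<^sup>2 \<le> F (X i) + F (X j) - 2 * m"
        using two[OF X X, of i j] m[OF mid[OF X X], of i j] by linarith
      ultimately have "k / 2 * (norm (X i - X j))\<^sup>2 < k / 2 * e\<^sup>2"
        using FX[of i] FX[of j] N by linarith
      then have "(norm (X i - X j))\<^sup>2 < e\<^sup>2" using k by (simp add: mult_less_cancel_left)
      then show ?thesis using e power_less_imp_less_base by fastforce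
    qed
    then show "\<exists>M. \<forall>i\<ge>M. \<forall>j\<ge>M. norm (X i - X j) < e" by blast
  qed
  from complete[OF X this] obtain l where l: "l \<in> C" "X \<longlonglongrightarrow> l" by blast
  obtain h where h: "bounded_linear h"
    and h_sub: "\<And>v. v \<in> C \<Longrightarrow> F l + h (v - l) + k * (norm (v - l))\<^sup>2 \<le> F v"
    using sub[OF l(1)] by blast
  have "F l \<le> m"
  proof (rule LIMSEQ_le)
    have "(\<lambda>n. F l + h (X n - l)) \<longlonglongrightarrow> F l + h (l - l)"
      by (intro tendsto_intros bounded_linear.tendsto[OF h] l(2))
    then show "(\<lambda>n. F l + h (X n - l)) \<longlonglongrightarrow> F l"
      using linear_0[OF bounded_linear.linear[OF h]] by simp
    show "(\<lambda>n. m + 1 / real (Suc n)) \<longlonglongrightarrow> m"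
      using tendsto_add[OF tendsto_const LIMSEQ_Suc[OF lim_1_over_n]] by simp
    have "F l + h (X n - l) \<le> m + 1 / real (Suc n)" for n
    proof -
      have "0 \<le> k * (norm (X n - l))\<^sup>2" using k by simp
      then show ?thesis using h_sub[OF X, of n] FX[of n] by linarith
    qed
    then show "\<exists>N. \<forall>n\<ge>N. F l + h (X n - l) \<le> m + 1 / real (Suc n)" by blast
  qed
  then have lmin: "\<forall>v\<in>C. F l \<le> F v" using m by fastforce
  show ?thesis
  proof (rule ex1I[of _ l])
    show "l \<in> C \<and> (\<forall>v\<in>C. F l \<le> F v)" using l(1) lmin by simp
    fix q assume q: "q \<in> C \<and> (\<forall>v\<in>C. F q \<le> F v)"
    then have "F q + F l \<le> 2 * F ((1/2) *\<^sub>R (q + l))"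
      using mid[of q l] l(1) lmin by fastforce
    then have "k / 2 * (norm (q - l))\<^sup>2 \<le> 0" using two[of q l] q l(1) by linarith
    then show "q = l" using k by (simp add: mult_le_0_iff)
  qed
qed

section \<open>Accelerated projected gradient\<close>

text \<open>The three-point inequality of projected gradient descent. The two bounds on
  \<open>f\<close> combine to a term \<open>inner g (z - p)\<close>, which the obtuse angle at the
  projected point bounds from below by purely geometric quantities.\<close>

lemma prox_grad_step:
  fixes y g p z :: "'l::real_inner"
  assumes lower: "f y + inner g (z - y) \<le> f z"
    and upper: "f p \<le> f y + inner g (p - y) + 1 / (2 * \<alpha>) * (norm (p - y))\<^sup>2"
    and proj: "inner (y - \<alpha> *\<^sub>R g - p) (z - p) \<le> 0" and \<alpha>: "\<alpha> > 0"
  shows "2 * inner (y - p) (z - p) - (norm (p - y))\<^sup>2 \<le> 2 * \<alpha> * (f z - f p)"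
proof -
  have "inner (y - p) (z - p) \<le> \<alpha> * inner g (z - p)"
    using proj by (simp add: inner_simps algebra_simps)
  moreover have "inner g (z - p) - 1 / (2 * \<alpha>) * (norm (p - y))\<^sup>2 \<le> f z - f p"
    using lower upper by (simp add: inner_simps algebra_simps)
  then have "2 * \<alpha> * (inner g (z - p) - 1 / (2 * \<alpha>) * (norm (p - y))\<^sup>2) \<le> 2 * \<alpha> * (f z - f p)"
    using \<alpha> by (intro mult_left_mono) auto
  then have "2 * (\<alpha> * inner g (z - p)) - (norm (p - y))\<^sup>2 \<le> 2 * \<alpha> * (f z - f p)"
    using \<alpha> by (simp add: algebra_simps)
  ultimately show ?thesis by linarith
qed

text \<open>\<open>x\<close> are the projected iterates, \<open>y\<close> the extrapolated ones.
  Extrapolation can leave the feasible set \<open>K\<close>, hence the bounds on \<open>f\<close>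
  are required on the whole subspace \<Lambda>. The projection enters only through membership in
  \<open>K\<close> and the obtuse-angle inequality.\<close>

locale fista =
  fixes f :: "'l::real_inner \<Rightarrow> real" and grad proj :: "'l \<Rightarrow> 'l" and \<Lambda> K :: "'l set"
    and \<alpha> \<epsilon> :: real and opt :: 'l
    and x y :: "nat \<Rightarrow> 'l" and t :: "nat \<Rightarrow> real"
  assumes subspace: "subspace \<Lambda>" and K: "K \<subseteq> \<Lambda>" and opt: "opt \<in> K"
    and pos: "\<alpha> > 0" "\<epsilon> > 0"
    and grad: "\<And>v. v \<in> \<Lambda> \<Longrightarrow> grad v \<in> \<Lambda>"
    and lower: "\<And>v w. v \<in> \<Lambda> \<Longrightarrow> w \<in> \<Lambda> \<Longrightarrow> f v + inner (grad v) (w - v) \<le> f w"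
    and upper: "\<And>v w. v \<in> \<Lambda> \<Longrightarrow> w \<in> \<Lambda> \<Longrightarrow>
      f w \<le> f v + inner (grad v) (w - v) + 1 / (2 * \<alpha>) * (norm (w - v))\<^sup>2"
    and growth: "\<And>w. w \<in> K \<Longrightarrow> f opt + \<epsilon> / 2 * (norm (w - opt))\<^sup>2 \<le> f w"
    and proj_mem: "\<And>v. v \<in> \<Lambda> \<Longrightarrow> proj v \<in> K"
    and proj: "\<And>v z. v \<in> \<Lambda> \<Longrightarrow> z \<in> K \<Longrightarrow> inner (v - proj v) (z - proj v) \<le> 0"
    and start: "x 0 = y 0" "y 0 \<in> \<Lambda>" "t 0 = 1"
    and x_Suc: "\<And>j. x (Suc j) = proj (y j - \<alpha> *\<^sub>R grad (y j))"
    and t_Suc: "\<And>j. t (Suc j) = (1 + sqrt (1 + 4 * (t j)\<^sup>2)) / 2"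
    and y_Suc: "\<And>j. y (Suc j) = x (Suc j) + ((t j - 1) / t (Suc j)) *\<^sub>R (x (Suc j) - x j)"
begin

lemma mem: "x j \<in> \<Lambda>" "y j \<in> \<Lambda>"
proof -
  have "x j \<in> \<Lambda> \<and> y j \<in> \<Lambda>"
  proof (induction j)
    case (Suc j)
    then have "x (Suc j) \<in> \<Lambda>"
      unfolding x_Suc using K proj_mem subspace grad
      by (meson subsetD subspace_diff subspace_scale)
    with Suc show ?case
      unfolding y_Suc using subspace by (simp add: subspace_add subspace_diff subspace_scale)
  qed (simp add: start)
  then show "x j \<in> \<Lambda>" "y j \<in> \<Lambda>" by auto
qed

lemma x_Suc_mem: "x (Suc j) \<in> K"
  unfolding x_Suc using mem(2)[of j] grad subspace
  by (intro proj_mem) (simp add: subspace_diff subspace_scale)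

lemma t_ge: "t j \<ge> (real j + 2) / 2"
proof (induction j)
  case (Suc j)
  have "2 * t j = sqrt ((2 * t j)\<^sup>2)" using Suc by (intro real_sqrt_unique[symmetric]) simp_all
  also have "\<dots> \<le> sqrt (1 + 4 * (t j)\<^sup>2)" by (simp add: power_mult_distrib)
  finally show ?case using Suc by (simp add: t_Suc)
qed (simp add: start)

lemma t_ge_1: "t j \<ge> 1"
  using t_ge[of j] by simp

text \<open>The update of \<open>t\<close> is the positive root of this equation; it is chosen so
  that the weights of the objective gap match from one step to the next.\<close>

lemma t_recurrence: "(t (Suc j))\<^sup>2 - t (Suc j) = (t j)\<^sup>2"
proof -
  have "(sqrt (1 + 4 * (t j)\<^sup>2))\<^sup>2 = 1 + 4 * (t j)\<^sup>2" by simp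
  then show ?thesis unfolding t_Suc by (simp add: field_simps power2_eq_square)
qed

lemma momentum_le_1: "0 \<le> (t j - 1) / t (Suc j)" "(t j - 1) / t (Suc j) \<le> 1"
proof -
  have "t j \<le> t (Suc j)"
    using t_ge_1[of "Suc j"] t_recurrence[of j] power2_le_imp_le[of "t j" "t (Suc j)"]
    by (metis diff_ge_0_iff_ge diff_le_eq le_add_same_cancel1 order_trans zero_le_one)
  then show "0 \<le> (t j - 1) / t (Suc j)" "(t j - 1) / t (Suc j) \<le> 1"
    using t_ge_1[of j] t_ge_1[of "Suc j"] by simp_all
qed

text \<open>The coefficient of the first term vanishes for \<open>j = 0\<close>, so that the starting point
  need not be feasible.\<close>

definition energy :: "nat \<Rightarrow> real" where
  "energy j = 2 * \<alpha> * ((t j)\<^sup>2 - t j) * (f (x j) - f opt)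
    + (norm (t j *\<^sub>R y j - (t j - 1) *\<^sub>R x j - opt))\<^sup>2"

text \<open>The three-point inequality is taken at the previous iterate with weight
  \<open>t j - 1\<close> and at the optimum with weight 1. Multiplied by \<open>t j\<close>, the
  geometric sides add up to the difference of two squared norms.\<close>

lemma energy_Suc_le: "energy (Suc j) \<le> energy j"
proof -
  define p where "p = x (Suc j)"
  define T where "T = t j"
  have T: "T \<ge> 1" unfolding T_def by (rule t_ge_1)
  have step: "2 * inner (y j - p) (z - p) - (norm (p - y j))\<^sup>2 \<le> 2 * \<alpha> * (f z - f p)"
    if "z \<in> K" for z
  proof (rule prox_grad_step[OF _ _ _ pos(1)])
    have v: "y j - \<alpha> *\<^sub>R grad (y j) \<in> \<Lambda>"
      using mem(2)[of j] grad subspace by (simp add: subspace_diff subspace_scale)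
    show "f (y j) + inner (grad (y j)) (z - y j) \<le> f z"
      using that K mem by (intro lower) auto
    show "f p \<le> f (y j) + inner (grad (y j)) (p - y j) + 1 / (2 * \<alpha>) * (norm (p - y j))\<^sup>2"
      unfolding p_def by (intro upper mem)
    show "inner (y j - \<alpha> *\<^sub>R grad (y j) - p) (z - p) \<le> 0"
      unfolding p_def x_Suc by (rule proj[OF v that])
  qed
  have 1: "(T - 1) * (2 * inner (y j - p) (x j - p) - (norm (p - y j))\<^sup>2)
    \<le> (T - 1) * (2 * \<alpha> * (f (x j) - f p))"
  proof (cases j)
    case 0
    then show ?thesis by (simp add: T_def start)
  next
    case (Suc i)
    then have "x j \<in> K" by (simp add: x_Suc_mem)
    then show ?thesis using T by (intro mult_left_mono step) auto
  qed
  have 2: "2 * inner (y j - p) (opt - p) - (norm (p - y j))\<^sup>2 \<le> 2 * \<alpha> * (f opt - f p)"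
    by (rule step[OF opt])
  have eq: "(norm (T *\<^sub>R p - (T - 1) *\<^sub>R x j - opt))\<^sup>2 - (norm (T *\<^sub>R y j - (T - 1) *\<^sub>R x j - opt))\<^sup>2
    = T * ((T - 1) * (2 * inner (y j - p) (x j - p) - (norm (p - y j))\<^sup>2)
      + (2 * inner (y j - p) (opt - p) - (norm (p - y j))\<^sup>2))"
    unfolding power2_norm_eq_inner by (simp add: inner_simps inner_commute algebra_simps)
  have "T * ((T - 1) * (2 * inner (y j - p) (x j - p) - (norm (p - y j))\<^sup>2)
      + (2 * inner (y j - p) (opt - p) - (norm (p - y j))\<^sup>2))
    \<le> T * ((T - 1) * (2 * \<alpha> * (f (x j) - f p)) + 2 * \<alpha> * (f opt - f p))"
    using T 1 2 by (intro mult_left_mono) auto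
  then have main: "2 * \<alpha> * T\<^sup>2 * (f p - f opt) + (norm (T *\<^sub>R p - (T - 1) *\<^sub>R x j - opt))\<^sup>2 \<le> energy j"
    using eq by (simp add: energy_def T_def power2_eq_square algebra_simps)
  \<comment> \<open>The momentum coefficient is the one for which the point inside the norm of the
    next energy is this combination of \<open>p\<close> and \<open>x j\<close>.\<close>
  have "t (Suc j) *\<^sub>R y (Suc j) - (t (Suc j) - 1) *\<^sub>R x (Suc j) - opt
    = T *\<^sub>R p - (T - 1) *\<^sub>R x j - opt"
    using t_ge_1[of "Suc j"]
    by (simp add: y_Suc p_def T_def scaleR_add_right scaleR_diff_right scaleR_diff_left)
  then have "energy (Suc j) = 2 * \<alpha> * T\<^sup>2 * (f p - f opt) + (norm (T *\<^sub>R p - (T - 1) *\<^sub>R x j - opt))\<^sup>2"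
    unfolding energy_def t_recurrence by (simp add: p_def T_def)
  with main show ?thesis by simp
qed

lemma energy_le: "energy j \<le> (norm (y 0 - opt))\<^sup>2"
proof (induction j)
  case 0
  show ?case by (simp add: energy_def start)
next
  case (Suc j)
  then show ?case using energy_Suc_le[of j] by linarith
qed

text \<open>The energy bound makes the objective gap decay like \<open>1 / t^2\<close>; quadratic
  growth at the optimum turns this into decay of the distance like \<open>1 / t\<close>, and
  \<open>t\<close> grows at least linearly.\<close>

lemma iterate_error:
  "norm (x (Suc j) - opt) \<le> 2 / (sqrt (\<alpha> * \<epsilon>) * (real j + 2)) * norm (y 0 - opt)"
proof -
  have "2 * \<alpha> * (t j)\<^sup>2 * (\<epsilon> / 2 * (norm (x (Suc j) - opt))\<^sup>2)
    \<le> 2 * \<alpha> * (t j)\<^sup>2 * (f (x (Suc j)) - f opt)"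
    using growth[OF x_Suc_mem[of j]] pos by (intro mult_left_mono) auto
  also have "\<dots> \<le> energy (Suc j)"
    unfolding energy_def t_recurrence by simp
  also have "\<dots> \<le> (norm (y 0 - opt))\<^sup>2" by (rule energy_le)
  also have "2 * \<alpha> * (t j)\<^sup>2 * (\<epsilon> / 2 * (norm (x (Suc j) - opt))\<^sup>2)
    = (sqrt (\<alpha> * \<epsilon>) * t j * norm (x (Suc j) - opt))\<^sup>2"
    using pos by (simp add: power_mult_distrib)
  finally have "sqrt (\<alpha> * \<epsilon>) * t j * norm (x (Suc j) - opt) \<le> norm (y 0 - opt)"
    by (rule power2_le_imp_le) simp
  moreover have "sqrt (\<alpha> * \<epsilon>) * ((real j + 2) / 2) * norm (x (Suc j) - opt)
    \<le> sqrt (\<alpha> * \<epsilon>) * t j * norm (x (Suc j) - opt)"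
    using pos t_ge[of j] by (intro mult_right_mono mult_left_mono) auto
  ultimately have "sqrt (\<alpha> * \<epsilon>) * ((real j + 2) / 2) * norm (x (Suc j) - opt) \<le> norm (y 0 - opt)"
    by linarith
  moreover have "0 < sqrt (\<alpha> * \<epsilon>) * ((real j + 2) / 2)" using pos by simp
  ultimately have "norm (x (Suc j) - opt) \<le> norm (y 0 - opt) / (sqrt (\<alpha> * \<epsilon>) * ((real j + 2) / 2))"
    by (simp only: pos_le_divide_eq mult.commute)
  then show ?thesis by (simp add: mult.commute)
qed

text \<open>The algorithm returns the extrapolated point, which combines the last two iterates with
  coefficients \<open>1 + c\<close> and \<open>- c\<close>. As \<open>c\<close> is at most 1, the
  iterate bound with constant 2 is used three times, hence 6. For \<open>l >= 2\<close> both
  iterates come from a projection.\<close>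

lemma momentum_error:
  assumes "l \<ge> 2"
  shows "norm (y l - opt) \<le> 6 / (sqrt (\<alpha> * \<epsilon>) * real l) * norm (y 0 - opt)"
proof -
  obtain j where j: "l = Suc (Suc j)"
    using assms that[of "l - 2"] by simp
  define c where "c = (t (Suc j) - 1) / t (Suc (Suc j))"
  have c: "0 \<le> c" "c \<le> 1" unfolding c_def by (rule momentum_le_1)+
  define s where "s = sqrt (\<alpha> * \<epsilon>)"
  have s: "s > 0" using pos by (simp add: s_def)
  define d where "d = norm (y 0 - opt)"
  have d: "d \<ge> 0" by (simp add: d_def)
  have bound: "norm (x (Suc i) - opt) \<le> 2 / (s * real l) * d" if "i \<ge> j" for i
  proof -
    have "2 / (s * (real i + 2)) * d \<le> 2 / (s * real l) * d"
      using s d that j by (intro mult_right_mono divide_left_mono mult_left_mono mult_pos_pos) auto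
    then show ?thesis using iterate_error[of i] by (simp add: s_def d_def)
  qed
  have "y l - opt = (1 + c) *\<^sub>R (x (Suc (Suc j)) - opt) - c *\<^sub>R (x (Suc j) - opt)"
    unfolding j y_Suc c_def[symmetric] by (simp add: algebra_simps)
  then have "norm (y l - opt) \<le> (1 + c) * norm (x (Suc (Suc j)) - opt) + c * norm (x (Suc j) - opt)"
    using norm_triangle_ineq4[of "(1 + c) *\<^sub>R (x (Suc (Suc j)) - opt)" "c *\<^sub>R (x (Suc j) - opt)"] c
    by simp
  also have "\<dots> \<le> 2 * (2 / (s * real l) * d) + 1 * (2 / (s * real l) * d)"
    using c bound[of j] bound[of "Suc j"] by (intro add_mono mult_mono) auto
  also have "\<dots> = 6 / (s * real l) * d" by simp
  finally show ?thesis by (simp add: s_def d_def)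
qed

end

section \<open>Parametric quadratic programs with a regularized dual\<close>

text \<open>A bounded right inverse for finitely many functionals. A new functional either is
  nonzero on a common zero \<open>z\<close> of the others, and then a multiple of \<open>z\<close>
  corrects its value, or it is determined by the others on \<open>U\<close>, and the old solution
  already fits.\<close>

lemma bounded_linear_system_solution:
  fixes h :: "'j \<Rightarrow> 'u::real_normed_vector \<Rightarrow> real"
  assumes "finite I" and "\<And>j. j \<in> I \<Longrightarrow> bounded_linear (h j)" and U: "subspace U"
  shows "\<exists>C\<ge>0. \<forall>u\<in>U. \<exists>w\<in>U. (\<forall>j\<in>I. h j w = h j u) \<and> norm w \<le> C * (\<Sum>j\<in>I. \<bar>h j u\<bar>)"
  using assms(1,2)
proof (induction I)
  case empty
  show ?case using subspace_0[OF U] by (intro exI[of _ 0]) auto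
next
  case (insert i I)
  obtain C where C: "C \<ge> 0" and
    w: "\<And>u. u \<in> U \<Longrightarrow> \<exists>w\<in>U. (\<forall>j\<in>I. h j w = h j u) \<and> norm w \<le> C * (\<Sum>j\<in>I. \<bar>h j u\<bar>)"
    using insert by auto
  interpret hi: bounded_linear "h i" using insert.prems by simp
  have lin: "linear (h j)" if "j \<in> I" for j
    using insert.prems that by (simp add: bounded_linear.linear)
  show ?case
  proof (cases "\<exists>z\<in>U. (\<forall>j\<in>I. h j z = 0) \<and> h i z \<noteq> 0")
    case True
    then obtain z0 where z0: "z0 \<in> U" "\<And>j. j \<in> I \<Longrightarrow> h j z0 = 0" "h i z0 \<noteq> 0" by blast
    define z where "z = z0 /\<^sub>R h i z0"
    have z: "z \<in> U" "\<And>j. j \<in> I \<Longrightarrow> h j z = 0" "h i z = 1"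
      using z0 lin U by (simp_all add: z_def subspace_scale linear_scale hi.scaleR)
    obtain M where M: "M > 0" "\<And>v. norm (h i v) \<le> norm v * M"
      using hi.pos_bounded by blast
    let ?C = "C + norm z + M * C * norm z"
    have "\<exists>w\<in>U. (\<forall>j\<in>insert i I. h j w = h j u) \<and> norm w \<le> ?C * (\<Sum>j\<in>insert i I. \<bar>h j u\<bar>)"
      if u: "u \<in> U" for u
    proof -
      obtain w where w: "w \<in> U" "\<And>j. j \<in> I \<Longrightarrow> h j w = h j u" "norm w \<le> C * (\<Sum>j\<in>I. \<bar>h j u\<bar>)"
        using w[OF u] by blast
      define s where "s = (\<Sum>j\<in>I. \<bar>h j u\<bar>)"
      have s: "s \<ge> 0" by (simp add: s_def sum_nonneg)
      define w' where "w' = w + (h i u - h i w) *\<^sub>R z"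
      have "norm w' \<le> norm w + \<bar>h i u - h i w\<bar> * norm z"
        unfolding w'_def by (rule norm_triangle_le) simp
      also have "\<bar>h i u - h i w\<bar> \<le> \<bar>h i u\<bar> + norm w * M"
        using M(2)[of w] by simp
      also have "norm w * M \<le> C * s * M"
        using w(3) M(1) by (simp add: s_def)
      finally have "norm w' \<le> C * s + (\<bar>h i u\<bar> + C * s * M) * norm z"
        using w(3) by (simp add: s_def mult_right_mono)
      also have "\<dots> \<le> ?C * (\<bar>h i u\<bar> + s)"
      proof -
        have "0 \<le> C * \<bar>h i u\<bar>" "0 \<le> norm z * s" "0 \<le> M * C * norm z * \<bar>h i u\<bar>"
          using C M(1) s by simp_all
        then show ?thesis by (simp add: algebra_simps)
      qed
      also have "\<bar>h i u\<bar> + s = (\<Sum>j\<in>insert i I. \<bar>h j u\<bar>)"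
        using insert.hyps by (simp add: s_def)
      finally have "norm w' \<le> ?C * (\<Sum>j\<in>insert i I. \<bar>h j u\<bar>)" .
      moreover have "w' \<in> U"
        unfolding w'_def using w(1) z(1) U by (simp add: subspace_add subspace_scale)
      moreover have "\<forall>j\<in>insert i I. h j w' = h j u"
      proof
        fix j assume "j \<in> insert i I"
        then consider "j = i" | "j \<in> I" by blast
        then show "h j w' = h j u"
        proof cases
          case 1
          then show ?thesis by (simp add: w'_def hi.add hi.scaleR z(3))
        next
          case 2
          then show ?thesis
            using lin[OF 2] by (simp add: w'_def linear_add linear_scale z(2) w(2))
        qed
      qed
      ultimately show ?thesis by blast
    qed
    moreover have "?C \<ge> 0" using C M(1) by simp
    ultimately show ?thesis by blast
  next
    case False
    have "\<exists>w\<in>U. (\<forall>j\<in>insert i I. h j w = h j u) \<and> norm w \<le> C * (\<Sum>j\<in>insert i I. \<bar>h j u\<bar>)"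
      if u: "u \<in> U" for u
    proof -
      obtain w where w: "w \<in> U" "\<And>j. j \<in> I \<Longrightarrow> h j w = h j u" "norm w \<le> C * (\<Sum>j\<in>I. \<bar>h j u\<bar>)"
        using w[OF u] by blast
      have "u - w \<in> U" using u w(1) U by (simp add: subspace_diff)
      moreover have "h j (u - w) = 0" if "j \<in> I" for j
        using lin[OF that] w(2)[OF that] by (simp add: linear_diff)
      ultimately have "h i w = h i u" using False by (force simp: hi.diff)
      moreover have "C * (\<Sum>j\<in>I. \<bar>h j u\<bar>) \<le> C * (\<Sum>j\<in>insert i I. \<bar>h j u\<bar>)"
        using C insert.hyps by (intro mult_left_mono) auto
      ultimately show ?thesis using w by (intro bexI[of _ w]) auto
    qed
    with C show ?thesis by blast
  qed
qed

lemma midpoint_eq: "u + (1 / 2) *\<^sub>R (v - u) = (1 / 2) *\<^sub>R (u + v)"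
  for u v :: "'a::real_vector"
proof -
  have "u = (1 / 2 + 1 / 2) *\<^sub>R u" by simp
  also have "\<dots> = (1 / 2) *\<^sub>R u + (1 / 2) *\<^sub>R u" by (rule scaleR_add_left)
  finally show ?thesis by (simp add: algebra_simps)
qed

text \<open>If \<open>s\<close> exceeds \<open>d\<close>, then \<open>d^2\<close> is at most
  \<open>d * s\<close> and a factor \<open>s\<close> can be cancelled.\<close>

lemma le_of_square_le:
  fixes s d :: real
  assumes "\<mu> * s\<^sup>2 \<le> Q * d * s + R * d\<^sup>2" and "\<mu> > 0" "Q \<ge> 0" "R \<ge> 0" "s \<ge> 0" "d \<ge> 0"
  shows "s \<le> (1 + (Q + R) / \<mu>) * d"
proof (cases "s \<le> d")
  case True
  have "0 \<le> (Q + R) / \<mu> * d" using assms by simp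
  with True show ?thesis by (simp add: distrib_right)
next
  case False
  then have s: "s > 0" "d \<le> s" using assms by auto
  have "R * d\<^sup>2 \<le> R * (d * s)"
    unfolding power2_eq_square using s assms by (intro mult_left_mono) auto
  then have "s * (\<mu> * s) \<le> s * ((Q + R) * d)"
    using assms(1) by (simp add: algebra_simps power2_eq_square)
  then have "\<mu> * s \<le> (Q + R) * d" using s by simp
  then have "s \<le> (Q + R) / \<mu> * d" using \<open>\<mu> > 0\<close> by (simp add: field_simps)
  then show ?thesis using \<open>d \<ge> 0\<close> by (simp add: distrib_right)
qed

lemma finite_uniform_bound:
  fixes g h :: "'a \<Rightarrow> real"
  assumes "finite S" and "\<And>I. I \<in> S \<Longrightarrow> \<exists>C. \<forall>x. P I x \<longrightarrow> g x \<le> C * h x"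
    and h: "\<And>I x. I \<in> S \<Longrightarrow> P I x \<Longrightarrow> h x \<ge> 0"
  shows "\<exists>C\<ge>0. \<forall>I\<in>S. \<forall>x. P I x \<longrightarrow> g x \<le> C * h x"
proof -
  obtain C where C: "\<And>I x. I \<in> S \<Longrightarrow> P I x \<Longrightarrow> g x \<le> C I * h x"
    using assms(2) by metis
  have "g x \<le> (\<Sum>I\<in>S. \<bar>C I\<bar>) * h x" if I: "I \<in> S" and P: "P I x" for I x
  proof -
    have "C I \<le> (\<Sum>I\<in>S. \<bar>C I\<bar>)"
      using member_le_sum[OF I, of "\<lambda>I. \<bar>C I\<bar>"] \<open>finite S\<close> by simp
    then have "C I * h x \<le> (\<Sum>I\<in>S. \<bar>C I\<bar>) * h x"
      using h[OF I P] by (rule mult_right_mono)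
    with C[OF I P] show ?thesis by simp
  qed
  moreover have "(\<Sum>I\<in>S. \<bar>C I\<bar>) \<ge> 0" by (simp add: sum_nonneg)
  ultimately show ?thesis by blast
qed

text \<open>Half of the quadratic form \<open>B\<close> on the pair of decision and parameter plus a
  linear term is minimized over a polyhedron given by functionals of the pair. This joint linearity
  makes feasible sets at different parameters comparable. Completeness is required along
  \<open>U\<close> and \<open>K\<close> only, as the ambient spaces may be incomplete.\<close>

locale parametric_qp =
  fixes U :: "'u::real_normed_vector set" and X :: "'x::real_normed_vector set"
    and J :: "'j set" and a :: "'j \<Rightarrow> 'u \<times> 'x \<Rightarrow> real" and c :: "'j \<Rightarrow> real"
    and B :: "'u \<times> 'x \<Rightarrow> 'u \<times> 'x \<Rightarrow> real" and m \<epsilon> :: real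
    and E :: "'u \<Rightarrow> 'l::real_inner" and F :: "'x \<Rightarrow> 'l" and b :: 'l and K :: "'l set"
  assumes U: "subspace U" and X: "subspace X" and J: "finite J"
    and U_complete: "\<And>V. (\<And>n::nat. V n \<in> U) \<Longrightarrow> Cauchy V \<Longrightarrow> \<exists>l\<in>U. V \<longlonglongrightarrow> l"
    and a: "\<And>j. j \<in> J \<Longrightarrow> bounded_linear (a j)"
    and B: "bounded_bilinear B" and B_sym: "\<And>z w. B z w = B w z"
    and coercive: "\<And>u. u \<in> U \<Longrightarrow> m * (norm u)\<^sup>2 \<le> B (u, 0) (u, 0)"
    and m: "m > 0" and \<epsilon>: "\<epsilon> > 0"
    and E: "bounded_linear E" and F: "bounded_linear F"
    and K_0: "0 \<in> K"
    and K_convex: "\<And>v w t. v \<in> K \<Longrightarrow> w \<in> K \<Longrightarrow> 0 \<le> t \<Longrightarrow> t \<le> 1 \<Longrightarrow> v + t *\<^sub>R (w - v) \<in> K"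
    and K_complete: "\<And>V. (\<And>n::nat. V n \<in> K) \<Longrightarrow> Cauchy V \<Longrightarrow> \<exists>l\<in>K. V \<longlonglongrightarrow> l"
begin

interpretation B: bounded_bilinear B by (rule B)
interpretation E: bounded_linear E by (rule E)
interpretation F: bounded_linear F by (rule F)

section \<open>The primal solution for a given multiplier and parameter\<close>

definition feas :: "'x \<Rightarrow> 'u set" where
  "feas x = {u \<in> U. \<forall>j\<in>J. a j (u, x) \<le> c j}"

definition lag :: "'l \<Rightarrow> 'x \<Rightarrow> 'u \<Rightarrow> real" where
  "lag l x u = B (u, x) (u, x) / 2 + inner l (E u)"

text \<open>The derivative of \<open>lag l x\<close> at \<open>u\<close> in direction
  \<open>h\<close>; the factor 1/2 disappears by symmetry of \<open>B\<close>.\<close>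

definition lag' :: "'l \<Rightarrow> 'x \<Rightarrow> 'u \<Rightarrow> 'u \<Rightarrow> real" where
  "lag' l x u h = B (u, x) (h, 0) + inner l (E h)"

definition is_sol :: "'l \<Rightarrow> 'x \<Rightarrow> 'u \<Rightarrow> bool" where
  "is_sol l x u \<longleftrightarrow> u \<in> feas x \<and> (\<forall>v\<in>feas x. lag l x u \<le> lag l x v)"

definition sol :: "'l \<Rightarrow> 'x \<Rightarrow> 'u" where
  "sol l x = (THE u. is_sol l x u)"

lemma B_fst_scaleR: "B z (t *\<^sub>R v, 0) = t * B z (v, 0)"
  using B.scaleR_right[of z t "(v, 0)"] by simp

lemma B_fst_add_right: "B z (u + v, 0) = B z (u, 0) + B z (v, 0)"
  using B.add_right[of z "(u, 0)" "(v, 0)"] by simp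

lemma B_fst_diff_right: "B z (u - v, 0) = B z (u, 0) - B z (v, 0)"
  using B.diff_right[of z "(u, 0)" "(v, 0)"] by simp

lemma B_pair_diff: "B (u - v, x - y) w = B (u, x) w - B (v, y) w"
  using B.diff_left[of "(u, x)" "(v, y)" w] by simp

lemma B_pair_split: "B (u, x) w = B (u, 0) w + B (0, x) w"
  using B.add_left[of "(u, 0)" "(0, x)" w] by simp

lemma feas_convex:
  assumes "u \<in> feas x" "v \<in> feas y" "0 \<le> t" "t \<le> 1"
  shows "u + t *\<^sub>R (v - u) \<in> feas (x + t *\<^sub>R (y - x))"
proof -
  have "u + t *\<^sub>R (v - u) \<in> U"
    using assms U by (simp add: feas_def subspace_add subspace_scale subspace_diff)
  moreover have "a j (u + t *\<^sub>R (v - u), x + t *\<^sub>R (y - x)) \<le> c j" if j: "j \<in> J" for j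
  proof -
    interpret aj: bounded_linear "a j" by (rule a[OF j])
    have "(u + t *\<^sub>R (v - u), x + t *\<^sub>R (y - x)) = (u, x) + t *\<^sub>R ((v, y) - (u, x))" by simp
    then have "a j (u + t *\<^sub>R (v - u), x + t *\<^sub>R (y - x)) = (1 - t) * a j (u, x) + t * a j (v, y)"
      by (simp only: aj.add aj.scaleR aj.diff) (simp add: algebra_simps)
    also have "\<dots> \<le> (1 - t) * c j + t * c j"
      using assms j by (intro add_mono mult_left_mono) (auto simp: feas_def)
    finally show ?thesis by (simp add: algebra_simps)
  qed
  ultimately show ?thesis by (simp add: feas_def)
qed

lemma feas_convex_same:
  assumes "u \<in> feas x" "v \<in> feas x" "0 \<le> t" "t \<le> 1"
  shows "u + t *\<^sub>R (v - u) \<in> feas x"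
  using feas_convex[OF assms] by simp

lemma feas_complete:
  assumes V: "\<And>n::nat. V n \<in> feas x" and "Cauchy V"
  shows "\<exists>l\<in>feas x. V \<longlonglongrightarrow> l"
proof -
  obtain l where l: "l \<in> U" "V \<longlonglongrightarrow> l"
    using U_complete[of V] assms by (auto simp: feas_def)
  have "a j (l, x) \<le> c j" if j: "j \<in> J" for j
  proof (rule LIMSEQ_le_const2)
    show "(\<lambda>n. a j (V n, x)) \<longlonglongrightarrow> a j (l, x)"
      by (intro bounded_linear.tendsto[OF a[OF j]] tendsto_Pair l(2) tendsto_const)
    show "\<exists>N. \<forall>n\<ge>N. a j (V n, x) \<le> c j" using V j by (auto simp: feas_def)
  qed
  with l show ?thesis by (auto simp: feas_def)
qed

lemma lag_expand: "lag l x (u + h) = lag l x u + lag' l x u h + B (h, 0) (h, 0) / 2"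
proof -
  have "B (u + h, x) (u + h, x) = B ((u, x) + (h, 0)) ((u, x) + (h, 0))" by simp
  also have "\<dots> = B (u, x) (u, x) + 2 * B (u, x) (h, 0) + B (h, 0) (h, 0)"
    by (simp only: B.add_left B.add_right B_sym[of "(h, 0)" "(u, x)"])
  finally show ?thesis by (simp add: lag_def lag'_def E.add inner_add_right)
qed

lemma lag'_scaleR: "lag' l x u (t *\<^sub>R h) = t * lag' l x u h"
  by (simp add: lag'_def B_fst_scaleR E.scaleR distrib_left)

lemma lag'_add: "lag' l x u (h + k) = lag' l x u h + lag' l x u k"
  by (simp add: lag'_def B_fst_add_right E.add inner_add_right)

lemma bounded_linear_lag': "bounded_linear (lag' l x u)"
  unfolding lag'_def
  by (intro bounded_linear_add bounded_linear_compose[OF B.bounded_linear_right]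
      bounded_linear_Pair bounded_linear_ident bounded_linear_zero
      bounded_linear_compose[OF bounded_linear_inner_right] E)

lemma sol_ex1:
  assumes "feas x \<noteq> {}"
  shows "\<exists>!u. is_sol l x u"
  unfolding is_sol_def
proof (rule strongly_convex_ex1_minimizer[where k = "m / 2"])
  fix u v assume "u \<in> feas x" "v \<in> feas x"
  from feas_convex_same[OF this, of "1/2"] show "(1 / 2) *\<^sub>R (u + v) \<in> feas x"
    by (simp add: midpoint_eq)
next
  fix p assume p: "p \<in> feas x"
  have "lag l x p + lag' l x p (v - p) + m / 2 * (norm (v - p))\<^sup>2 \<le> lag l x v" if "v \<in> feas x" for v
  proof -
    have "v - p \<in> U" using that p U by (simp add: feas_def subspace_diff)
    from coercive[OF this] show ?thesis using lag_expand[of l x p "v - p"] by simp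
  qed
  then show "\<exists>g. bounded_linear g \<and>
      (\<forall>v\<in>feas x. lag l x p + g (v - p) + m / 2 * (norm (v - p))\<^sup>2 \<le> lag l x v)"
    using bounded_linear_lag' by blast
qed (use assms m feas_complete in auto)

lemma sol_is_sol: "feas x \<noteq> {} \<Longrightarrow> is_sol l x (sol l x)"
  unfolding sol_def by (rule theI'[OF sol_ex1])

lemma sol_unique: "is_sol l x u \<Longrightarrow> sol l x = u"
  unfolding sol_def using sol_ex1[of x l] by (intro the1_equality) (auto simp: is_sol_def)

lemma sol_feas: "feas x \<noteq> {} \<Longrightarrow> sol l x \<in> feas x"
  and sol_le: "v \<in> feas x \<Longrightarrow> lag l x (sol l x) \<le> lag l x v"
  using sol_is_sol[of x l] by (auto simp: is_sol_def)

lemma sol_variational: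
  assumes v: "v \<in> feas x"
  shows "0 \<le> lag' l x (sol l x) (v - sol l x)"
proof (rule nonneg_if_quadratic_nonneg)
  fix t :: real assume t: "0 < t" "t \<le> 1"
  let ?u = "sol l x"
  have "?u + t *\<^sub>R (v - ?u) \<in> feas x"
    using t v by (intro feas_convex_same sol_feas) auto
  from sol_le[OF this, of l]
  show "0 \<le> t * lag' l x ?u (v - ?u) + t\<^sup>2 * (B (v - ?u, 0) (v - ?u, 0) / 2)"
    using B_fst_scaleR[of "(t *\<^sub>R (v - ?u), 0)" t "v - ?u"]
      B_fst_scaleR[of "(v - ?u, 0)" t "v - ?u"] B_sym[of "(t *\<^sub>R (v - ?u), 0)" "(v - ?u, 0)"]
    unfolding lag_expand lag'_scaleR by (simp add: power2_eq_square mult.assoc)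
qed

text \<open>Each solution is a test point in the variational inequality of the other. In the sum,
  coercivity bounds the squared distance by a cross term in \<open>E\<close>. The constant is
  independent of the parameter \<open>x\<close>.\<close>

lemma sol_lipschitz: "\<exists>C>0. \<forall>x l l'. feas x \<noteq> {} \<longrightarrow> norm (sol l x - sol l' x) \<le> C * norm (l - l')"
proof -
  obtain M where M: "M > 0" "\<And>u. norm (E u) \<le> norm u * M" using E.pos_bounded by blast
  have "norm (sol l x - sol l' x) \<le> M / m * norm (l - l')" if x: "feas x \<noteq> {}" for x l l'
  proof -
    define d where "d = sol l x - sol l' x"
    have dU: "d \<in> U"
      using sol_feas[OF x, of l] sol_feas[OF x, of l'] U by (simp add: d_def feas_def subspace_diff)
    have "0 \<le> lag' l x (sol l x) (- d)"
      using sol_variational[OF sol_feas[OF x, of l'], of l] by (simp add: d_def)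
    then have 1: "lag' l x (sol l x) d \<le> 0" using lag'_scaleR[of l x "sol l x" "-1" d] by simp
    have 2: "0 \<le> lag' l' x (sol l' x) d"
      using sol_variational[OF sol_feas[OF x, of l], of l'] by (simp add: d_def)
    have "B (d, 0) (d, 0) = B (sol l x, x) (d, 0) - B (sol l' x, x) (d, 0)"
      using B_pair_diff[of "sol l x" "sol l' x" x x "(d, 0)"] by (simp add: d_def)
    then have "m * (norm d)\<^sup>2 \<le> - inner (l - l') (E d)"
      using 1 2 coercive[OF dU] by (simp add: lag'_def inner_diff_left)
    also have "\<dots> \<le> norm (l - l') * norm (E d)"
      using norm_cauchy_schwarz[of "- (l - l')" "E d"] by (simp only: inner_minus_left norm_minus_cancel)
    also have "\<dots> \<le> norm (l - l') * (norm d * M)"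
      using M(2) by (intro mult_left_mono) auto
    finally have "norm d * (m * norm d) \<le> norm d * (M * norm (l - l'))"
      by (simp add: power2_eq_square algebra_simps)
    then have "m * norm d \<le> M * norm (l - l')"
      using M(1) by (cases "norm d = 0") (auto simp: mult_le_cancel_left)
    then show ?thesis using m by (simp add: d_def field_simps)
  qed
  moreover have "M / m > 0" using M m by simp
  ultimately show ?thesis by blast
qed

section \<open>The regularized dual problem and its solution\<close>

definition dual :: "'l \<Rightarrow> 'x \<Rightarrow> real" where
  "dual l x = - lag l x (sol l x) + \<epsilon> / 2 * (norm l)\<^sup>2"

definition dual_grad :: "'l \<Rightarrow> 'x \<Rightarrow> 'l" where
  "dual_grad l x = \<epsilon> *\<^sub>R l - E (sol l x)"

definition obj :: "'l \<Rightarrow> 'x \<Rightarrow> real" where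
  "obj l x = dual l x + inner l (b - F x)"

definition obj_grad :: "'l \<Rightarrow> 'x \<Rightarrow> 'l" where
  "obj_grad l x = dual_grad l x + (b - F x)"

definition is_dsol :: "'x \<Rightarrow> 'l \<Rightarrow> bool" where
  "is_dsol x l \<longleftrightarrow> l \<in> K \<and> (\<forall>v\<in>K. obj l x \<le> obj v x)"

definition dsol :: "'x \<Rightarrow> 'l" where
  "dsol x = (THE l. is_dsol x l)"

text \<open>For fixed \<open>u\<close> the Lagrangian is affine in the multiplier, and
  \<open>sol l x\<close> competes in the problem for \<open>v\<close>; the expansion of the
  regularizer is exact. Thus the gradient formula is available as a strong subgradient without any
  differentiation.\<close>

lemma dual_subgradient:
  assumes x: "feas x \<noteq> {}"
  shows "dual l x + inner (dual_grad l x) (v - l) + \<epsilon> / 2 * (norm (v - l))\<^sup>2 \<le> dual v x"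
proof -
  have "lag v x (sol v x) \<le> lag v x (sol l x)" by (rule sol_le[OF sol_feas[OF x]])
  also have "\<dots> = lag l x (sol l x) + inner (E (sol l x)) (v - l)"
    by (simp add: lag_def inner_diff_right inner_commute[of "E (sol l x)"])
  finally have 1: "lag v x (sol v x) \<le> lag l x (sol l x) + inner (E (sol l x)) (v - l)" .
  have "(norm v)\<^sup>2 = (norm l)\<^sup>2 + 2 * inner l (v - l) + (norm (v - l))\<^sup>2"
    unfolding power2_norm_eq_inner by (simp add: inner_simps inner_commute)
  then have "\<epsilon> / 2 * (norm v)\<^sup>2
      = \<epsilon> / 2 * (norm l)\<^sup>2 + \<epsilon> * inner l (v - l) + \<epsilon> / 2 * (norm (v - l))\<^sup>2"
    by (simp add: distrib_left)
  moreover have "inner (dual_grad l x) (v - l) = \<epsilon> * inner l (v - l) - inner (E (sol l x)) (v - l)"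
    by (simp add: dual_grad_def inner_diff_left)
  ultimately show ?thesis using 1 unfolding dual_def by linarith
qed

lemma obj_subgradient:
  assumes "feas x \<noteq> {}"
  shows "obj l x + inner (obj_grad l x) (v - l) + \<epsilon> / 2 * (norm (v - l))\<^sup>2 \<le> obj v x"
  using dual_subgradient[OF assms, of l v]
  by (simp add: obj_def obj_grad_def inner_add_left inner_diff_right inner_diff_left
      inner_commute[of "b"] inner_commute[of "F x"])

lemma dsol_ex1:
  assumes x: "feas x \<noteq> {}"
  shows "\<exists>!l. is_dsol x l"
  unfolding is_dsol_def
proof (rule strongly_convex_ex1_minimizer[where k = "\<epsilon> / 2"])
  fix u v assume "u \<in> K" "v \<in> K"
  from K_convex[OF this, of "1/2"] show "(1 / 2) *\<^sub>R (u + v) \<in> K"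
    by (simp add: midpoint_eq)
next
  fix l
  show "\<exists>g. bounded_linear g \<and>
      (\<forall>v\<in>K. obj l x + g (v - l) + \<epsilon> / 2 * (norm (v - l))\<^sup>2 \<le> obj v x)"
    using obj_subgradient[OF x] bounded_linear_inner_right by blast
qed (use K_0 K_complete \<epsilon> in auto)

lemma dsol_is_dsol: "feas x \<noteq> {} \<Longrightarrow> is_dsol x (dsol x)"
  unfolding dsol_def by (rule theI'[OF dsol_ex1])

lemma dsol_unique: "feas x \<noteq> {} \<Longrightarrow> is_dsol x l \<Longrightarrow> dsol x = l"
  unfolding dsol_def by (rule the1_equality[OF dsol_ex1])

lemma dsol_mem: "feas x \<noteq> {} \<Longrightarrow> dsol x \<in> K"
  and dsol_le: "feas x \<noteq> {} \<Longrightarrow> v \<in> K \<Longrightarrow> obj (dsol x) x \<le> obj v x"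
  using dsol_is_dsol[of x] by (auto simp: is_dsol_def)

text \<open>Minimality at \<open>dsol x\<close> cannot be combined with the subgradient inequality
  there. It is combined with the one at a nearby point \<open>w\<close> of the segment to
  \<open>v\<close>, and the gradient is carried back from \<open>w\<close> by Lipschitz continuity
  of \<open>sol\<close>.\<close>

lemma dsol_variational:
  assumes x: "feas x \<noteq> {}" and v: "v \<in> K"
  shows "0 \<le> inner (obj_grad (dsol x) x) (v - dsol x)"
proof -
  let ?l = "dsol x"
  obtain C where C: "\<And>l l'. norm (sol l x - sol l' x) \<le> C * norm (l - l')"
    using sol_lipschitz x by blast
  obtain M where M: "M > 0" "\<And>u. norm (E u) \<le> norm u * M" using E.pos_bounded by blast
  define d where "d = v - ?l"
  \<comment> \<open>The Lipschitz constant of the gradient, \<open>\<epsilon> + C * M\<close>, times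
    the square of \<open>norm d\<close>.\<close>
  define Q where "Q = norm d * (\<epsilon> * norm d + C * norm d * M)"
  show ?thesis unfolding d_def[symmetric]
  proof (rule nonneg_if_quadratic_nonneg[of _ Q])
    fix t :: real assume t: "0 < t" "t \<le> 1"
    define w where "w = ?l + t *\<^sub>R d"
    have "w \<in> K" unfolding w_def d_def using t v dsol_mem[OF x] by (intro K_convex) auto
    then have "obj ?l x \<le> obj w x" by (rule dsol_le[OF x])
    moreover have "obj w x + inner (obj_grad w x) (?l - w) \<le> obj ?l x"
    proof -
      have "0 \<le> \<epsilon> / 2 * (norm (?l - w))\<^sup>2" using \<epsilon> by simp
      then show ?thesis using obj_subgradient[OF x, of w ?l] by linarith
    qed
    ultimately have 1: "0 \<le> t * inner (obj_grad w x) d" by (simp add: w_def)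
    have "norm (obj_grad w x - obj_grad ?l x) = norm (\<epsilon> *\<^sub>R (t *\<^sub>R d) - E (sol w x - sol ?l x))"
      by (simp add: obj_grad_def dual_grad_def w_def E.diff algebra_simps)
    also have "\<dots> \<le> \<epsilon> * (t * norm d) + norm (E (sol w x - sol ?l x))"
      using norm_triangle_ineq4[of "\<epsilon> *\<^sub>R (t *\<^sub>R d)" "E (sol w x - sol ?l x)"] \<epsilon> t by simp
    also have "norm (E (sol w x - sol ?l x)) \<le> norm (sol w x - sol ?l x) * M" by (rule M)
    also have "\<dots> \<le> C * (t * norm d) * M"
      using C[of w ?l] M(1) t by (intro mult_right_mono) (auto simp: w_def)
    finally have "norm (obj_grad w x - obj_grad ?l x) \<le> t * (\<epsilon> * norm d + C * norm d * M)"
      by (simp add: algebra_simps)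
    then have "norm d * norm (obj_grad w x - obj_grad ?l x) \<le> norm d * (t * (\<epsilon> * norm d + C * norm d * M))"
      by (intro mult_left_mono) auto
    moreover have "inner (obj_grad w x - obj_grad ?l x) d \<le> norm (obj_grad w x - obj_grad ?l x) * norm d"
      by (rule norm_cauchy_schwarz)
    ultimately have "inner (obj_grad w x) d \<le> inner (obj_grad ?l x) d + t * Q"
      by (simp add: Q_def inner_diff_left algebra_simps)
    then have "t * inner (obj_grad w x) d \<le> t * (inner (obj_grad ?l x) d + t * Q)"
      using t by (intro mult_left_mono) auto
    with 1 show "0 \<le> t * inner (obj_grad ?l x) d + t\<^sup>2 * Q"
      by (simp add: power2_eq_square algebra_simps)
  qed
qed

lemma dsol_growth:
  assumes x: "feas x \<noteq> {}" and v: "v \<in> K"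
  shows "obj (dsol x) x + \<epsilon> / 2 * (norm (v - dsol x))\<^sup>2 \<le> obj v x"
  using obj_subgradient[OF x, of "dsol x" v] dsol_variational[OF assms] by linarith

subsection \<open>Dependence of the solution on the parameter\<close>

definition psol :: "'x \<Rightarrow> 'u" where
  "psol x = sol (dsol x) x"

definition active :: "'x \<Rightarrow> 'j set" where
  "active x = {j \<in> J. a j (psol x, x) = c j}"

definition gap :: "'x \<Rightarrow> 'x \<Rightarrow> real" where
  "gap x y = norm (psol x - psol y) + norm (dsol x - dsol y)"

lemma gap_nonneg: "gap x y \<ge> 0"
  by (simp add: gap_def)

lemma gap_triangle: "gap x z \<le> gap x y + gap y z"
  using norm_triangle_ineq[of "psol x - psol y" "psol y - psol z"]
    norm_triangle_ineq[of "dsol x - dsol y" "dsol y - dsol z"] by (simp add: gap_def)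

lemma psol_feas: "feas x \<noteq> {} \<Longrightarrow> psol x \<in> feas x"
  unfolding psol_def by (rule sol_feas)

lemma psol_variational: "v \<in> feas x \<Longrightarrow> 0 \<le> lag' (dsol x) x (psol x) (v - psol x)"
  unfolding psol_def by (rule sol_variational)

text \<open>Sum of the dual variational inequalities at \<open>x\<close> and \<open>y\<close>, each
  tested with the solution of the other.\<close>

lemma dsol_monotone:
  assumes x: "feas x \<noteq> {}" and y: "feas y \<noteq> {}"
  shows "\<epsilon> * (norm (dsol x - dsol y))\<^sup>2
    \<le> inner (dsol x - dsol y) (E (psol x - psol y)) + inner (dsol x - dsol y) (F (x - y))"
proof -
  let ?d = "dsol x - dsol y"
  have "inner (obj_grad (dsol x) x) ?d \<le> 0"
    using dsol_variational[OF x dsol_mem[OF y]] by (simp add: inner_diff_right)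
  moreover have "0 \<le> inner (obj_grad (dsol y) y) ?d"
    by (rule dsol_variational[OF y dsol_mem[OF x]])
  ultimately have "inner (obj_grad (dsol x) x - obj_grad (dsol y) y) ?d \<le> 0"
    by (simp add: inner_diff_left)
  also have "obj_grad (dsol x) x - obj_grad (dsol y) y
    = \<epsilon> *\<^sub>R ?d - E (psol x - psol y) - F (x - y)"
    by (simp add: obj_grad_def dual_grad_def psol_def E.diff F.diff algebra_simps)
  finally show ?thesis
    by (simp add: inner_diff_left power2_norm_eq_inner inner_commute[of "E (psol x - psol y)"]
        inner_commute[of "F (x - y)"])
qed

text \<open>The cross term in \<open>E\<close> has opposite signs in the primal hypothesis and in
  the dual monotonicity, so it cancels and both strong convexities remain. The factor 1/2 pays for
  squaring a sum.\<close>

lemma gap_square_le: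
  assumes x: "feas x \<noteq> {}" and y: "feas y \<noteq> {}"
    and R: "B (psol x - psol y, 0) (psol x - psol y, 0) + inner (dsol x - dsol y) (E (psol x - psol y)) \<le> R"
  shows "min m \<epsilon> / 2 * (gap x y)\<^sup>2 \<le> R + norm (dsol x - dsol y) * norm (F (x - y))"
proof -
  define p where "p = norm (psol x - psol y)"
  define q where "q = norm (dsol x - dsol y)"
  have "psol x - psol y \<in> U"
    using psol_feas[OF x] psol_feas[OF y] U by (simp add: feas_def subspace_diff)
  from coercive[OF this] dsol_monotone[OF x y] R
  have "m * p\<^sup>2 + \<epsilon> * q\<^sup>2 \<le> R + inner (dsol x - dsol y) (F (x - y))"
    by (simp add: p_def q_def)
  also have "\<dots> \<le> R + q * norm (F (x - y))"
    unfolding q_def using norm_cauchy_schwarz by simp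
  finally have 1: "m * p\<^sup>2 + \<epsilon> * q\<^sup>2 \<le> R + q * norm (F (x - y))" .
  have "(p + q)\<^sup>2 \<le> 2 * (p\<^sup>2 + q\<^sup>2)"
    using sum_squares_bound[of p q] by (simp add: power2_sum)
  then have "min m \<epsilon> / 2 * (p + q)\<^sup>2 \<le> min m \<epsilon> / 2 * (2 * (p\<^sup>2 + q\<^sup>2))"
    using m \<epsilon> by (intro mult_left_mono) auto
  also have "\<dots> = min m \<epsilon> * p\<^sup>2 + min m \<epsilon> * q\<^sup>2" by (simp add: distrib_left)
  also have "\<dots> \<le> m * p\<^sup>2 + \<epsilon> * q\<^sup>2"
    by (intro add_mono mult_right_mono) auto
  finally show ?thesis using 1 by (simp add: gap_def p_def q_def)
qed

text \<open>Inactive constraints are strict and finite in number, so a common small step along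
  \<open>p\<close> preserves them; the active ones do not change at all. The same applies to
  \<open>- p\<close>, which gives both signs.\<close>

lemma lag'_active_eq_0:
  assumes x: "feas x \<noteq> {}" and p: "p \<in> U" and ker: "\<And>j. j \<in> active x \<Longrightarrow> a j (p, 0) = 0"
  shows "lag' (dsol x) x (psol x) p = 0"
proof -
  have ge: "0 \<le> lag' (dsol x) x (psol x) p"
    if p: "p \<in> U" and ker: "\<And>j. j \<in> active x \<Longrightarrow> a j (p, 0) = 0" for p
  proof -
    let ?u = "psol x"
    have u: "?u \<in> U" "\<And>j. j \<in> J \<Longrightarrow> a j (?u, x) \<le> c j"
      using psol_feas[OF x] by (auto simp: feas_def)
    have expand: "a j (?u + t *\<^sub>R p, x) = a j (?u, x) + t * a j (p, 0)" if "j \<in> J" for j t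
    proof -
      interpret aj: bounded_linear "a j" by (rule a[OF that])
      have "(?u + t *\<^sub>R p, x) = (?u, x) + t *\<^sub>R (p, 0)" by simp
      then show ?thesis by (simp only: aj.add aj.scaleR) simp
    qed
    have "eventually (\<lambda>t. a j (?u + t *\<^sub>R p, x) \<le> c j) (at_right 0)" if j: "j \<in> J" for j
    proof (cases "j \<in> active x")
      case True
      then show ?thesis using u(2)[OF j] ker j by (simp add: expand)
    next
      case False
      then have "a j (?u, x) < c j" using u(2)[OF j] j by (auto simp: active_def less_le)
      moreover have "((\<lambda>t. a j (?u, x) + t * a j (p, 0)) \<longlongrightarrow> a j (?u, x) + 0 * a j (p, 0)) (at_right 0)"
        by (intro tendsto_intros)
      ultimately have "eventually (\<lambda>t. a j (?u, x) + t * a j (p, 0) < c j) (at_right 0)"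
        by (intro order_tendstoD) auto
      then show ?thesis by (rule eventually_mono) (simp add: expand[OF j])
    qed
    then have "eventually (\<lambda>t. \<forall>j\<in>J. a j (?u + t *\<^sub>R p, x) \<le> c j) (at_right 0)"
      using J by (simp add: eventually_ball_finite_distrib)
    moreover have "eventually (\<lambda>t::real. 0 < t) (at_right 0)" by (rule eventually_at_right_less)
    ultimately have "eventually (\<lambda>t. 0 < t \<and> (\<forall>j\<in>J. a j (?u + t *\<^sub>R p, x) \<le> c j)) (at_right 0)"
      by eventually_elim simp
    then obtain t where t: "0 < t" "\<And>j. j \<in> J \<Longrightarrow> a j (?u + t *\<^sub>R p, x) \<le> c j"
      using eventually_happens' trivial_limit_at_right_real by blast
    have "?u + t *\<^sub>R p \<in> feas x"
      using t(2) u(1) p U by (simp add: feas_def subspace_add subspace_scale)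
    from psol_variational[OF this] have "0 \<le> t * lag' (dsol x) x ?u p" by (simp add: lag'_scaleR)
    then show ?thesis using t(1) by (simp add: zero_le_mult_iff)
  qed
  have "a j (- p, 0) = 0" if "j \<in> active x" for j
  proof -
    interpret aj: bounded_linear "a j" by (rule a) (use that in \<open>simp add: active_def\<close>)
    show ?thesis using linear_neg[OF aj.linear_axioms, of "(p, 0)"] ker[OF that] by simp
  qed
  then have "0 \<le> lag' (dsol x) x (psol x) (- p)"
    using p U by (intro ge) (simp_all add: subspace_neg)
  then show ?thesis
    using ge[OF p ker] lag'_scaleR[of "dsol x" x "psol x" "-1" p] by simp
qed

text \<open>A direction that leaves all active constraints unchanged is feasible both ways, so the
  variational inequalities at both parameters become equations on such directions. The remaining
  part of the difference of the two solutions is controlled by the change of the parameter.\<close>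

lemma gap_lipschitz_same_active:
  assumes I: "I \<subseteq> J"
  shows "\<exists>C. \<forall>x y. feas x \<noteq> {} \<and> feas y \<noteq> {} \<and> active x = I \<and> active y = I
    \<longrightarrow> gap x y \<le> C * norm (x - y)"
proof -
  obtain KB where KB: "KB > 0" "\<And>z w. norm (B z w) \<le> norm z * norm w * KB"
    using B.pos_bounded by blast
  obtain KE where KE: "KE > 0" "\<And>u. norm (E u) \<le> norm u * KE" using E.pos_bounded by blast
  obtain KF where KF: "KF > 0" "\<And>u. norm (F u) \<le> norm u * KF" using F.pos_bounded by blast
  have fin: "finite I" using I J by (rule finite_subset)
  have "bounded_linear (\<lambda>u. a j (u, 0))" if "j \<in> I" for j
    using that I by (intro bounded_linear_compose[OF a] bounded_linear_Pair
        bounded_linear_ident bounded_linear_zero) auto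
  then have "\<exists>C\<ge>0. \<forall>u\<in>U. \<exists>w\<in>U. (\<forall>j\<in>I. a j (w, 0) = a j (u, 0))
      \<and> norm w \<le> C * (\<Sum>j\<in>I. \<bar>a j (u, 0)\<bar>)"
    by (intro bounded_linear_system_solution[of I "\<lambda>j u. a j (u, 0)"] fin U)
  then
  obtain C0 where C0: "C0 \<ge> 0" and sys: "\<forall>u\<in>U.
      \<exists>w\<in>U. (\<forall>j\<in>I. a j (w, 0) = a j (u, 0)) \<and> norm w \<le> C0 * (\<Sum>j\<in>I. \<bar>a j (u, 0)\<bar>)"
    by (elim exE conjE)
  have "\<exists>k. \<forall>z. norm (a j z) \<le> norm z * k" if "j \<in> I" for j
    using bounded_linear.bounded[OF a] that I by blast
  then obtain k where k: "\<And>j z. j \<in> I \<Longrightarrow> norm (a j z) \<le> norm z * k j" by metis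
  define W where "W = C0 * (\<Sum>j\<in>I. \<bar>k j\<bar>)"
  have W: "W \<ge> 0" using C0 by (simp add: W_def sum_nonneg)
  \<comment> \<open>\<open>Q\<close> and \<open>R\<close> collect the coefficients of
    \<open>d * gap x y\<close> and of \<open>d^2\<close> in the final estimate.\<close>
  define Q where "Q = KB * W + KE * W + KB + KF"
  define R where "R = KB * W"
  have QR: "Q \<ge> 0" "R \<ge> 0" using KB(1) KE(1) KF(1) W by (simp_all add: Q_def R_def)
  have "gap x y \<le> (1 + (Q + R) / (min m \<epsilon> / 2)) * norm (x - y)"
    if x: "feas x \<noteq> {}" "active x = I" and y: "feas y \<noteq> {}" "active y = I" for x y
  proof (rule le_of_square_le)
    define u where "u = psol x - psol y"
    define l where "l = dsol x - dsol y"
    define d where "d = norm (x - y)"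
    have uU: "u \<in> U"
      unfolding u_def using psol_feas[OF x(1)] psol_feas[OF y(1)] U
      by (simp add: feas_def subspace_diff)
    obtain w where w: "w \<in> U" "\<And>j. j \<in> I \<Longrightarrow> a j (w, 0) = a j (u, 0)"
      "norm w \<le> C0 * (\<Sum>j\<in>I. \<bar>a j (u, 0)\<bar>)"
      using bspec[OF sys uU] by (elim bexE conjE) simp
    \<comment> \<open>Both solutions satisfy the constraints in \<open>I\<close> with equality, so
      these functionals see on \<open>u\<close> only the change of the parameter.\<close>
    have au: "\<bar>a j (u, 0)\<bar> \<le> \<bar>k j\<bar> * d" if j: "j \<in> I" for j
    proof -
      interpret aj: bounded_linear "a j" using a j I by blast
      have "a j (psol x, x) = c j" "a j (psol y, y) = c j"
        using j x(2) y(2) by (auto simp: active_def)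
      moreover have "(u, 0) = ((psol x, x) - (psol y, y)) - (0, x - y)" by (simp add: u_def)
      ultimately have "a j (u, 0) = - a j (0, x - y)" by (simp only: aj.diff)
      then have "\<bar>a j (u, 0)\<bar> \<le> d * k j" using k[OF j, of "(0, x - y)"] by (simp add: d_def)
      also have "\<dots> \<le> \<bar>k j\<bar> * d" by (simp add: d_def mult.commute[of _ "k j"] mult_right_mono)
      finally show ?thesis .
    qed
    have "(\<Sum>j\<in>I. \<bar>a j (u, 0)\<bar>) \<le> (\<Sum>j\<in>I. \<bar>k j\<bar>) * d"
      unfolding sum_distrib_right by (rule sum_mono[OF au])
    then have "C0 * (\<Sum>j\<in>I. \<bar>a j (u, 0)\<bar>) \<le> W * d"
      unfolding W_def mult.assoc using C0 by (rule mult_left_mono)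
    with w(3) have wd: "norm w \<le> W * d" by simp
    \<comment> \<open>\<open>u\<close> splits into \<open>p\<close>, which the active constraints
      annihilate, and \<open>w\<close>, whose size is bounded by the change of the
      parameter.\<close>
    define p where "p = u - w"
    have p: "p \<in> U" unfolding p_def using uU w(1) U by (simp add: subspace_diff)
    have ap: "a j (p, 0) = 0" if j: "j \<in> I" for j
    proof -
      interpret aj: bounded_linear "a j" using a j I by blast
      have "(p, 0 :: 'x) = (u, 0) - (w, 0)" by (simp add: p_def)
      then show ?thesis using w(2)[OF j] by (simp only: aj.diff)
    qed
    have "lag' (dsol x) x (psol x) p = 0" "lag' (dsol y) y (psol y) p = 0"
      using x y ap by (auto intro!: lag'_active_eq_0 p)
    then have "B (u, x - y) (p, 0) + inner l (E p) = 0"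
      unfolding u_def l_def B_pair_diff lag'_def by (simp add: inner_diff_left)
    then have eq: "B (u, 0) (u, 0) + inner l (E u)
      = B (u, x - y) (w, 0) + inner l (E w) - B (0, x - y) (u, 0)"
      using B_pair_split[of u "x - y" "(u, 0)"]
      by (simp add: p_def B_fst_diff_right E.diff inner_diff_right)
    have "B (u, x - y) (w, 0) \<le> (norm u + d) * (W * d) * KB"
    proof -
      have "norm (B (u, x - y) (w, 0)) \<le> norm (u, x - y) * norm (w, 0 :: 'x) * KB" by (rule KB)
      also have "\<dots> \<le> (norm u + d) * (W * d) * KB"
        using wd KB(1) norm_Pair_le[of u "x - y"] unfolding d_def
        by (intro mult_right_mono mult_mono) auto
      finally show ?thesis by simp
    qed
    moreover have "inner l (E w) \<le> norm l * (W * d * KE)"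
    proof -
      have "norm (E w) \<le> W * d * KE"
        by (rule order_trans[OF KE(2) mult_right_mono[OF wd less_imp_le[OF KE(1)]]])
      then have "norm l * norm (E w) \<le> norm l * (W * d * KE)" by (rule mult_left_mono) simp
      then show ?thesis using norm_cauchy_schwarz[of l "E w"] by simp
    qed
    moreover have "- B (0, x - y) (u, 0) \<le> d * norm u * KB"
      using KB(2)[of "(0, x - y)" "(u, 0)"] by (simp add: d_def)
    ultimately have "B (u, 0) (u, 0) + inner l (E u)
      \<le> (norm u + d) * (W * d) * KB + norm l * (W * d * KE) + d * norm u * KB"
      unfolding eq by linarith
    then have "min m \<epsilon> / 2 * (gap x y)\<^sup>2
      \<le> (norm u + d) * (W * d) * KB + norm l * (W * d * KE) + d * norm u * KB + norm l * norm (F (x - y))"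
      unfolding u_def l_def by (intro gap_square_le x y)
    also have "\<dots> \<le> (norm u + d) * (W * d) * KB + norm l * (W * d * KE) + d * norm u * KB + norm l * (d * KF)"
      unfolding d_def by (intro add_left_mono mult_left_mono KF) auto
    also have "\<dots> \<le> Q * d * gap x y + R * d\<^sup>2"
    proof -
      have "0 \<le> KE * W * d * norm u" "0 \<le> KF * d * norm u" "0 \<le> KB * W * d * norm l" "0 \<le> KB * d * norm l"
        using KB(1) KE(1) KF(1) W by (simp_all add: d_def)
      then show ?thesis unfolding Q_def R_def gap_def u_def[symmetric] l_def[symmetric]
        by (simp add: power2_eq_square algebra_simps)
    qed
    finally show "min m \<epsilon> / 2 * (gap x y)\<^sup>2 \<le> Q * norm (x - y) * gap x y + R * (norm (x - y))\<^sup>2"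
      by (simp add: d_def)
  qed (use m \<epsilon> QR gap_nonneg in auto)
  then show ?thesis by blast
qed

lemma finite_active_sets: "finite (Pow J)" "active x \<in> Pow J"
  using J by (auto simp: active_def)

lemma gap_lipschitz_uniform:
  "\<exists>C\<ge>0. \<forall>x y. feas x \<noteq> {} \<and> feas y \<noteq> {} \<and> active x = active y \<longrightarrow> gap x y \<le> C * norm (x - y)"
proof -
  have "\<exists>C\<ge>0. \<forall>I\<in>Pow J. \<forall>z. feas (fst z) \<noteq> {} \<and> feas (snd z) \<noteq> {} \<and> active (fst z) = I \<and> active (snd z) = I
    \<longrightarrow> gap (fst z) (snd z) \<le> C * norm (fst z - snd z)"
    using gap_lipschitz_same_active by (intro finite_uniform_bound[OF finite_active_sets(1)]) auto
  then show ?thesis using finite_active_sets(2) by (metis fst_conv snd_conv)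
qed

text \<open>Compactness is avoided: for each active set that occurs in the ball one reference
  parameter is fixed, and the Lipschitz bound controls the distance to its solution. Finitely many
  references remain.\<close>

lemma solutions_bounded:
  "\<exists>M\<ge>0. \<forall>x. feas x \<noteq> {} \<and> norm x \<le> r \<longrightarrow> norm (psol x) + norm (dsol x) \<le> M"
proof -
  obtain C where C: "C \<ge> 0" and lip: "\<And>x y. feas x \<noteq> {} \<Longrightarrow> feas y \<noteq> {} \<Longrightarrow> active x = active y
      \<Longrightarrow> gap x y \<le> C * norm (x - y)"
    using gap_lipschitz_uniform by blast
  have "\<exists>M. \<forall>x. feas x \<noteq> {} \<and> norm x \<le> r \<and> active x = I \<longrightarrow> norm (psol x) + norm (dsol x) \<le> M * 1" for I
  proof (cases "\<exists>y. feas y \<noteq> {} \<and> norm y \<le> r \<and> active y = I")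
    case True
    then obtain y where y: "feas y \<noteq> {}" "norm y \<le> r" "active y = I" by blast
    have "norm (psol x) + norm (dsol x) \<le> (norm (psol y) + norm (dsol y) + C * (2 * r)) * 1"
      if x: "feas x \<noteq> {}" "norm x \<le> r" "active x = I" for x
    proof -
      have "norm (x - y) \<le> 2 * r" using norm_triangle_ineq4[of x y] x y by simp
      then have "gap x y \<le> C * (2 * r)"
        using lip[OF x(1) y(1)] x(3) y(3) mult_left_mono[OF _ C] by fastforce
      moreover have "norm (psol x) \<le> norm (psol y) + norm (psol x - psol y)"
        "norm (dsol x) \<le> norm (dsol y) + norm (dsol x - dsol y)"
        using norm_triangle_ineq[of "psol y" "psol x - psol y"]
          norm_triangle_ineq[of "dsol y" "dsol x - dsol y"] by simp_all
      ultimately show ?thesis by (simp add: gap_def)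
    qed
    then show ?thesis by blast
  qed blast
  then have "\<exists>M\<ge>0. \<forall>I\<in>Pow J. \<forall>x. feas x \<noteq> {} \<and> norm x \<le> r \<and> active x = I
      \<longrightarrow> norm (psol x) + norm (dsol x) \<le> M * 1"
    by (intro finite_uniform_bound[OF finite_active_sets(1)]) auto
  then show ?thesis using finite_active_sets(2) by (metis mult.right_neutral)
qed

text \<open>The solutions at \<open>0\<close> and \<open>x\<close> are perturbed into feasible points of each other's problem by
  convex combination with the solutions at the two multiples of \<open>x\<close> on the sphere of radius \<open>r\<close>.\<close>

lemma gap_hoelder_at_0:
  assumes r: "r > 0" and feas: "\<And>x. x \<in> X \<Longrightarrow> norm x \<le> r \<Longrightarrow> feas x \<noteq> {}"
  shows "\<exists>H\<ge>0. \<forall>x\<in>X. norm x \<le> r \<longrightarrow> (gap x 0)\<^sup>2 \<le> H * norm x"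
proof -
  obtain KB where KB: "KB > 0" "\<And>z w. norm (B z w) \<le> norm z * norm w * KB"
    using B.pos_bounded by blast
  obtain KE where KE: "KE > 0" "\<And>u. norm (E u) \<le> norm u * KE" using E.pos_bounded by blast
  obtain KF where KF: "KF > 0" "\<And>u. norm (F u) \<le> norm u * KF" using F.pos_bounded by blast
  obtain M where M: "M \<ge> 0" and
    bound: "\<And>x. feas x \<noteq> {} \<Longrightarrow> norm x \<le> r \<Longrightarrow> norm (psol x) + norm (dsol x) \<le> M"
    using solutions_bounded[of r] by blast
  have bounds: "norm (psol x) \<le> M" "norm (dsol x) \<le> M" if "x \<in> X" "norm x \<le> r" for x
    using bound[OF feas[OF that] that(2)] norm_ge_zero[of "psol x"] norm_ge_zero[of "dsol x"]
    by linarith+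
  have X0: "0 \<in> X" by (rule subspace_0[OF X])
  have z: "norm (0 :: 'x) \<le> r" using r by simp
  \<comment> \<open>Bounds the derivative of the Lagrangian at any solution over the ball, in
    directions of norm at most \<open>2 * M\<close>, that is, between two solutions.\<close>
  define T where "T = (M + r) * (2 * M) * KB + M * (2 * M * KE)"
  have T: "T \<ge> 0" using M r KB(1) KE(1) by (simp add: T_def)
  have lag'_bound: "lag' (dsol x) x (psol x) h \<le> T"
    if x: "x \<in> X" "norm x \<le> r" and h: "norm h \<le> 2 * M" for x h
  proof -
    have "norm (psol x, x) \<le> M + r"
      using norm_Pair_le[of "psol x" x] bounds[OF x] x(2) by linarith
    then have "norm (psol x, x) * norm (h, 0 :: 'x) * KB \<le> (M + r) * (2 * M) * KB"
      using h KB(1) M r by (intro mult_right_mono mult_mono) auto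
    then have "B (psol x, x) (h, 0) \<le> (M + r) * (2 * M) * KB"
      using KB(2)[of "(psol x, x)" "(h, 0)"] by simp
    moreover have "norm (E h) \<le> 2 * M * KE"
      by (rule order_trans[OF KE(2) mult_right_mono[OF h less_imp_le[OF KE(1)]]])
    then have "norm (dsol x) * norm (E h) \<le> M * (2 * M * KE)"
      using bounds[OF x] M by (intro mult_mono) auto
    then have "inner (dsol x) (E h) \<le> M * (2 * M * KE)"
      using norm_cauchy_schwarz[of "dsol x" "E h"] by linarith
    ultimately show ?thesis by (simp add: lag'_def T_def)
  qed
  define H0 where "H0 = 2 * T / r + 2 * M * KB + 2 * M * KF"
  have H0: "H0 \<ge> 0" using T r M KB(1) KF(1) by (simp add: H0_def)
  have main: "min m \<epsilon> / 2 * (gap x 0)\<^sup>2 \<le> H0 * norm x" if x: "x \<in> X" "norm x \<le> r" for x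
  proof (cases "x = 0")
    case True
    then show ?thesis by (simp add: gap_def)
  next
    case False
    define \<theta> where "\<theta> = norm x / r"
    have \<theta>: "0 < \<theta>" "\<theta> \<le> 1" using False x(2) r by (simp_all add: \<theta>_def)
    define y where "y = x /\<^sub>R \<theta>"
    have "norm y = r" using \<theta>(1) r False by (simp add: y_def \<theta>_def field_simps)
    then have y: "y \<in> X" "norm y \<le> r" "- y \<in> X" "norm (- y) \<le> r"
      using x(1) X by (simp_all add: y_def subspace_scale subspace_neg)
    have x_eq: "x = \<theta> *\<^sub>R y" using \<theta>(1) by (simp add: y_def)
    \<comment> \<open>As \<open>x\<close> is \<theta> times \<open>y\<close>, this is the fraction
      at which the segment from \<open>x\<close> to \<open>- y\<close> passes through 0.\<close>
    define \<tau> where "\<tau> = \<theta> / (1 + \<theta>)"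
    have \<tau>: "0 \<le> \<tau>" "\<tau> \<le> 1" "\<tau> \<le> \<theta>" using \<theta> by (simp_all add: \<tau>_def field_simps)
    let ?u = "psol x - psol 0"
    have "psol 0 + \<theta> *\<^sub>R (psol y - psol 0) \<in> feas (0 + \<theta> *\<^sub>R (y - 0))"
      using \<theta> by (intro feas_convex psol_feas feas X0 z y) auto
    then have "psol 0 + \<theta> *\<^sub>R (psol y - psol 0) \<in> feas x" by (simp add: x_eq)
    from psol_variational[OF this]
    have "0 \<le> lag' (dsol x) x (psol x) (- ?u + \<theta> *\<^sub>R (psol y - psol 0))"
      by (simp add: algebra_simps)
    also have "\<dots> = - lag' (dsol x) x (psol x) ?u + \<theta> * lag' (dsol x) x (psol x) (psol y - psol 0)"
      using lag'_scaleR[of "dsol x" x "psol x" "-1" ?u]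
      unfolding lag'_add lag'_scaleR scaleR_minus1_left mult_minus1 by (rule arg_cong2[where f = "(+)", OF _ refl])
    also have "\<dots> \<le> - lag' (dsol x) x (psol x) ?u + \<theta> * T"
      using \<theta> norm_triangle_ineq4[of "psol y" "psol 0"] bounds[OF y(1,2)] bounds[OF X0 z]
      by (intro add_left_mono mult_left_mono lag'_bound x) auto
    finally have 1: "lag' (dsol x) x (psol x) ?u \<le> \<theta> * T" by simp
    have "psol x + \<tau> *\<^sub>R (psol (- y) - psol x) \<in> feas (x + \<tau> *\<^sub>R (- y - x))"
      using \<tau> by (intro feas_convex psol_feas feas x y) auto
    moreover have "x + \<tau> *\<^sub>R (- y - x) = 0"
    proof -
      have "x + \<tau> *\<^sub>R (- y - x) = (\<theta> - \<tau> - \<tau> * \<theta>) *\<^sub>R y"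
        by (simp add: x_eq algebra_simps)
      also have "\<theta> - \<tau> - \<tau> * \<theta> = 0" using \<theta> by (simp add: \<tau>_def field_simps)
      finally show ?thesis by simp
    qed
    ultimately have "psol x + \<tau> *\<^sub>R (psol (- y) - psol x) \<in> feas 0" by simp
    from psol_variational[OF this]
    have "0 \<le> lag' (dsol 0) 0 (psol 0) (?u + \<tau> *\<^sub>R (psol (- y) - psol x))"
      by (simp add: algebra_simps)
    also have "\<dots> = lag' (dsol 0) 0 (psol 0) ?u + \<tau> * lag' (dsol 0) 0 (psol 0) (psol (- y) - psol x)"
      by (simp only: lag'_add lag'_scaleR)
    also have "\<dots> \<le> lag' (dsol 0) 0 (psol 0) ?u + \<tau> * T"
      using \<tau> norm_triangle_ineq4[of "psol (- y)" "psol x"] bounds[OF y(3,4)] bounds[OF x]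
      by (intro add_left_mono mult_left_mono lag'_bound X0 z) auto
    also have "\<tau> * T \<le> \<theta> * T" using \<tau> T by (intro mult_right_mono)
    finally have 2: "- lag' (dsol 0) 0 (psol 0) ?u \<le> \<theta> * T" by simp
    have "B (?u, x) (?u, 0) + inner (dsol x - dsol 0) (E ?u)
      = lag' (dsol x) x (psol x) ?u - lag' (dsol 0) 0 (psol 0) ?u"
      using B_pair_diff[of "psol x" "psol 0" x 0 "(?u, 0)"]
      by (simp add: lag'_def inner_diff_left)
    with 1 2 have "B (?u, 0) (?u, 0) + inner (dsol x - dsol 0) (E ?u) \<le> 2 * \<theta> * T - B (0, x) (?u, 0)"
      using B_pair_split[of ?u x "(?u, 0)"] by simp
    moreover have "- B (0, x) (?u, 0) \<le> norm x * (2 * M) * KB"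
    proof -
      have "norm ?u \<le> 2 * M"
        using norm_triangle_ineq4[of "psol x" "psol 0"] bounds[OF x] bounds[OF X0 z] by simp
      then have "norm x * norm ?u * KB \<le> norm x * (2 * M) * KB"
        using KB(1) by (intro mult_right_mono mult_left_mono) auto
      then show ?thesis using KB(2)[of "(0, x)" "(?u, 0)"] by simp
    qed
    ultimately have "B (?u, 0) (?u, 0) + inner (dsol x - dsol 0) (E ?u)
      \<le> 2 * \<theta> * T + norm x * (2 * M) * KB" by simp
    then have "min m \<epsilon> / 2 * (gap x 0)\<^sup>2
      \<le> 2 * \<theta> * T + norm x * (2 * M) * KB + norm (dsol x - dsol 0) * norm (F (x - 0))"
      by (intro gap_square_le feas x X0 z)
    also have "norm (dsol x - dsol 0) * norm (F (x - 0)) \<le> (2 * M) * (norm x * KF)"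
      using norm_triangle_ineq4[of "dsol x" "dsol 0"] bounds[OF x] bounds[OF X0 z] KF(2)[of x] M
      by (intro mult_mono) auto
    also have "2 * \<theta> * T + norm x * (2 * M) * KB + (2 * M) * (norm x * KF) = H0 * norm x"
      by (simp add: H0_def \<theta>_def algebra_simps)
    finally show ?thesis by simp
  qed
  have \<mu>: "min m \<epsilon> / 2 > 0" using m \<epsilon> by simp
  have "(gap x 0)\<^sup>2 \<le> H0 / (min m \<epsilon> / 2) * norm x" if "x \<in> X" "norm x \<le> r" for x
  proof -
    have "(gap x 0)\<^sup>2 \<le> H0 * norm x / (min m \<epsilon> / 2)"
      using main[OF that] by (subst pos_le_divide_eq[OF \<mu>]) (simp only: mult.commute)
    then show ?thesis by (simp only: times_divide_eq_left)
  qed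
  moreover have "H0 / (min m \<epsilon> / 2) \<ge> 0" using H0 \<mu> by simp
  ultimately show ?thesis by blast
qed

text \<open>Near \<open>0\<close> only active sets occur that also occur at parameters arbitrarily close to \<open>0\<close>; for
  those, the Lipschitz bound on a fixed active set passes to the limit.\<close>

lemma dsol_calm_at_0:
  assumes r: "r > 0" and feas: "\<And>x. x \<in> X \<Longrightarrow> norm x \<le> r \<Longrightarrow> feas x \<noteq> {}"
  shows "\<exists>s>0. \<exists>C\<ge>0. \<forall>x\<in>X. norm x \<le> s \<longrightarrow> norm (dsol x - dsol 0) \<le> C * norm x"
proof -
  obtain C where C: "C \<ge> 0" and lip: "\<And>x y. feas x \<noteq> {} \<Longrightarrow> feas y \<noteq> {} \<Longrightarrow> active x = active y
      \<Longrightarrow> gap x y \<le> C * norm (x - y)"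
    using gap_lipschitz_uniform by blast
  obtain H where H: "H \<ge> 0" "\<And>x. x \<in> X \<Longrightarrow> norm x \<le> r \<Longrightarrow> (gap x 0)\<^sup>2 \<le> H * norm x"
    using gap_hoelder_at_0[OF assms] by blast
  \<comment> \<open>The active sets that are absent from some ball about 0; a radius
    \<open>s\<close> below all these balls excludes them.\<close>
  define far where "far = {I \<in> Pow J. \<exists>\<delta>>0. \<forall>x\<in>X. norm x \<le> \<delta> \<longrightarrow> active x \<noteq> I}"
  have "finite far" unfolding far_def using J by simp
  moreover have "\<forall>I\<in>far. \<exists>\<delta>>0. \<forall>x\<in>X. norm x \<le> \<delta> \<longrightarrow> active x \<noteq> I"
    by (simp add: far_def)
  then obtain \<delta> where \<delta>: "\<And>I. I \<in> far \<Longrightarrow> \<delta> I > 0"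
    "\<And>I x. I \<in> far \<Longrightarrow> x \<in> X \<Longrightarrow> norm x \<le> \<delta> I \<Longrightarrow> active x \<noteq> I"
    by metis
  define s where "s = Min (insert r (\<delta> ` far))"
  have s: "s > 0" "s \<le> r" "\<And>I. I \<in> far \<Longrightarrow> s \<le> \<delta> I"
    using \<open>finite far\<close> r \<delta>(1) by (simp_all add: s_def)
  have "norm (dsol x - dsol 0) \<le> C * norm x" if x: "x \<in> X" "norm x \<le> s" for x
  proof -
    have xr: "norm x \<le> r" using x(2) s(2) by simp
    have "active x \<notin> far"
      using \<delta>(2)[of "active x" x] s(3)[of "active x"] x by fastforce
    then have near: "\<exists>y\<in>X. norm y \<le> e \<and> active y = active x" if "e > 0" for e
      using that finite_active_sets(2)[of x] by (auto simp: far_def)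
    \<comment> \<open>The detour leads through a parameter \<open>y\<close> near 0 with the active
      set of \<open>x\<close>: the Lipschitz bound covers the way from \<open>x\<close> to
      \<open>y\<close>, and the Hoelder bound makes the rest vanish with \<open>e\<close>.\<close>
    have approx: "gap x 0 \<le> C * (norm x + e) + sqrt (H * e)" if e: "e > 0" "e \<le> r" for e
    proof -
      obtain y where y: "y \<in> X" "norm y \<le> e" "active y = active x" using near[OF e(1)] by blast
      have "gap x y \<le> C * norm (x - y)"
        using y e x xr by (intro lip feas) auto
      also have "\<dots> \<le> C * (norm x + e)"
        using norm_triangle_ineq4[of x y] y(2) C by (intro mult_left_mono) auto
      finally have 1: "gap x y \<le> C * (norm x + e)" .
      have "(gap y 0)\<^sup>2 \<le> H * norm y" using y e by (intro H) auto
      also have "\<dots> \<le> H * e" using y(2) H(1) by (rule mult_left_mono)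
      finally have "gap y 0 \<le> sqrt (H * e)" by (rule real_le_rsqrt)
      with 1 gap_triangle[of x 0 y] show ?thesis by linarith
    qed
    have "gap x 0 \<le> C * (norm x + 0) + sqrt (H * 0)"
    proof (rule tendsto_lowerbound)
      show "((\<lambda>e. C * (norm x + e) + sqrt (H * e)) \<longlongrightarrow> C * (norm x + 0) + sqrt (H * 0)) (at_right 0)"
        by (intro tendsto_intros)
      have "eventually (\<lambda>e. e \<in> {0<..<r}) (at_right 0)"
        using r by (rule eventually_at_right_real)
      then show "eventually (\<lambda>e. gap x 0 \<le> C * (norm x + e) + sqrt (H * e)) (at_right 0)"
        by (rule eventually_mono) (auto intro: approx)
    qed simp
    then show ?thesis by (simp add: gap_def) (meson dual_order.trans le_add_same_cancel2 norm_ge_zero)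
  qed
  with s(1) C show ?thesis by blast
qed

end

section \<open>A local small-gain argument\<close>

lemma class_L_pos:
  assumes "class_L g" "s \<ge> 0"
  shows "g s > 0"
proof (rule ccontr)
  assume "\<not> g s > 0"
  moreover have "g (s + 1) < g s" using assms by (simp add: class_L_def)
  ultimately have neg: "g (s + 1) < 0" by simp
  have "eventually (\<lambda>t. g t \<le> g (s + 1)) at_top"
    using eventually_gt_at_top[of "s + 1"]
    by eventually_elim (use assms in \<open>auto simp: class_L_def intro: less_imp_le\<close>)
  moreover have "(g \<longlongrightarrow> 0) at_top" using assms by (simp add: class_L_def)
  ultimately have "0 \<le> g (s + 1)"
    by (intro tendsto_upperbound[of g 0 at_top]) auto
  with neg show False by simp
qed

text \<open>Each \<open>h k\<close> stays at a high plateau up to time \<open>T k\<close> and then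
  falls within one unit of time to the level \<open>1 / (k + 1)\<close>. Their infimum is a majorant
  that inherits the common Lipschitz constant and antitonicity and tends to 0; a decaying
  exponential is added to make it strictly decreasing.\<close>

lemma class_L_majorant:
  fixes A :: "(nat \<Rightarrow> real) set"
  assumes bdd: "\<And>z t. z \<in> A \<Longrightarrow> z t \<le> M"
    and lim: "\<And>e. e > 0 \<Longrightarrow> \<exists>T. \<forall>z\<in>A. \<forall>t\<ge>T. z t \<le> e"
  shows "\<exists>g. class_L g \<and> (\<forall>z\<in>A. \<forall>t. z t \<le> g (real t))"
proof -
  have "\<exists>T::nat. \<forall>z\<in>A. \<forall>t\<ge>T. z t \<le> 1 / (real k + 1)" for k :: nat
    by (rule lim) simp
  then obtain T :: "nat \<Rightarrow> nat" where T: "\<And>k z t. z \<in> A \<Longrightarrow> t \<ge> T k \<Longrightarrow> z t \<le> 1 / (real k + 1)"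
    by metis
  \<comment> \<open>\<open>M\<close> may be nonpositive, whereas the slope of the ramps has to be
    positive.\<close>
  define M' where "M' = max M 1"
  have M': "M' > 0" by (simp add: M'_def)
  define ramp where "ramp = (\<lambda>k t. max 0 (min 1 (real (T k) + 1 - t)))"
  have ramp: "0 \<le> ramp k t" "ramp k t \<le> ramp k s + \<bar>t - s\<bar>" "s \<le> t \<Longrightarrow> ramp k t \<le> ramp k s"
    "t \<le> real (T k) \<Longrightarrow> ramp k t = 1" "real (T k) + 1 \<le> t \<Longrightarrow> ramp k t = 0" for k s t
    by (auto simp: ramp_def)
  define h where "h = (\<lambda>k t. 1 / (real k + 1) + M' * ramp k t)"
  have h_nonneg: "0 \<le> h k t" for k t using ramp(1)[of k t] M' by (simp add: h_def)
  define g0 where "g0 = (\<lambda>t. INF k. h k t)"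
  have bb: "bdd_below (range (\<lambda>k. h k t))" for t by (rule bdd_belowI2) (rule h_nonneg)
  have g0_le: "g0 t \<le> h k t" for k t
    unfolding g0_def by (rule cINF_lower[OF bb]) simp
  have le_g0: "v \<le> g0 t" if "\<And>k. v \<le> h k t" for v t
    unfolding g0_def by (rule cINF_greatest) (use that in auto)
  have g0_lip: "g0 t \<le> g0 s + M' * \<bar>t - s\<bar>" for s t
  proof -
    have "g0 t - M' * \<bar>t - s\<bar> \<le> g0 s"
    proof (rule le_g0)
      fix k
      have "M' * ramp k t \<le> M' * (ramp k s + \<bar>t - s\<bar>)" using M' ramp(2) by (intro mult_left_mono) auto
      then show "g0 t - M' * \<bar>t - s\<bar> \<le> h k s"
        using g0_le[of t k] by (simp add: h_def distrib_left)
    qed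
    then show ?thesis by simp
  qed
  have g0_mono: "g0 t \<le> g0 s" if "s \<le> t" for s t
  proof (rule le_g0)
    fix k
    have "M' * ramp k t \<le> M' * ramp k s" using M' ramp(3)[OF that] by (intro mult_left_mono) auto
    then show "g0 t \<le> h k s" using g0_le[of t k] by (simp add: h_def)
  qed
  have g0_cont: "continuous_on {0..} g0"
    unfolding continuous_on_def
  proof (intro ballI tendstoI)
    fix s e :: real assume e: "0 < e"
    have "dist (g0 t) (g0 s) < e" if "dist t s < e / M'" for t
    proof -
      have "M' * \<bar>t - s\<bar> < e" using that M' by (simp add: dist_real_def field_simps)
      then show ?thesis
        using g0_lip[of t s] g0_lip[of s t] by (simp add: dist_real_def abs_minus_commute[of s t] abs_less_iff)
    qed
    then show "eventually (\<lambda>t. dist (g0 t) (g0 s) < e) (at s within {0..})"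
      unfolding eventually_at using e M' by (intro exI[of _ "e / M'"]) auto
  qed
  have g0_lim: "(g0 \<longlongrightarrow> 0) at_top"
  proof (rule tendstoI)
    fix e :: real assume "0 < e"
    then obtain k where k: "1 / real (Suc k) < e" by (rule nat_approx_posE)
    have "dist (g0 t) 0 < e" if "real (T k) + 1 \<le> t" for t
      using g0_le[of t k] k le_g0[of 0 t, OF h_nonneg] ramp(5)[OF that]
      by (simp add: h_def add.commute)
    then show "eventually (\<lambda>t. dist (g0 t) 0 < e) at_top"
      unfolding eventually_at_top_linorder by blast
  qed
  have z_le: "z t \<le> g0 (real t)" if z: "z \<in> A" for z t
  proof (rule le_g0)
    fix k
    show "z t \<le> h k (real t)"
    proof (cases "t \<ge> T k")
      case True
      have "0 \<le> M' * ramp k (real t)" using M' ramp(1) by simp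
      then show ?thesis using T[OF z True] by (simp add: h_def)
    next
      case False
      have "z t \<le> M'" using bdd[OF z, of t] by (simp add: M'_def)
      moreover have "0 \<le> 1 / (real k + 1)" by simp
      moreover have "ramp k (real t) = 1" using False by (intro ramp(4)) simp
      ultimately show ?thesis by (simp add: h_def add_increasing)
    qed
  qed
  have "class_L (\<lambda>t. g0 t + exp (- t))"
    unfolding class_L_def
  proof (intro conjI allI impI)
    show "continuous_on {0..} (\<lambda>t. g0 t + exp (- t))" by (intro continuous_intros g0_cont)
    fix s t :: real assume "s \<ge> 0" "s < t"
    then show "g0 t + exp (- t) < g0 s + exp (- s)"
      using g0_mono[of s t] by (intro add_le_less_mono) auto
  next
    have "((\<lambda>t::real. exp (- t)) \<longlongrightarrow> 0) at_top"
      by (rule filterlim_compose[OF exp_at_bot filterlim_uminus_at_bot_at_top])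
    from tendsto_add[OF g0_lim this] show "((\<lambda>t. g0 t + exp (- t)) \<longlongrightarrow> 0) at_top" by simp
  qed
  moreover have "z t \<le> g0 (real t) + exp (- real t)" if "z \<in> A" for z t
    using z_le[OF that, of t] exp_ge_zero[of "- real t"] by linarith
  ultimately show ?thesis by blast
qed

text \<open>Replaces the minimum of \<open>S r\<close> and \<open>T t\<close>, which is constant in
  one argument where the other function attains it; the geometric mean is strictly monotone in both
  arguments.\<close>

lemma class_KL_sqrt_mult:
  assumes S: "class_K S" and T: "class_L T"
  shows "class_KL (\<lambda>r t. sqrt (S r * T t))"
proof -
  have S_pos: "S r > 0" if "r > 0" for r
    using S that strict_mono_onD[of "{0..}" S 0 r] by (simp add: class_K_def)
  have "class_K (\<lambda>r. sqrt (S r * T t))" if "t \<ge> 0" for t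
    unfolding class_K_def
  proof (intro conjI)
    show "continuous_on {0..} (\<lambda>r. sqrt (S r * T t))"
      using S by (intro continuous_intros) (simp add: class_K_def)
    show "strict_mono_on {0..} (\<lambda>r. sqrt (S r * T t))"
      using S class_L_pos[OF T that] by (auto simp: class_K_def strict_mono_on_def)
    show "sqrt (S 0 * T t) = 0" using S by (simp add: class_K_def)
  qed
  moreover have "class_L (\<lambda>t. sqrt (S r * T t))" if "r > 0" for r
    unfolding class_L_def
  proof (intro conjI allI impI)
    show "continuous_on {0..} (\<lambda>t. sqrt (S r * T t))"
      using T by (intro continuous_intros) (simp add: class_L_def)
    show "sqrt (S r * T t) < sqrt (S r * T s)" if "s \<ge> 0" "s < t" for s t
      using T that S_pos[OF \<open>r > 0\<close>] by (simp add: class_L_def)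
    have "((\<lambda>t. sqrt (S r * T t)) \<longlongrightarrow> sqrt (S r * 0)) at_top"
      using T by (intro tendsto_intros) (simp add: class_L_def)
    then show "((\<lambda>t. sqrt (S r * T t)) \<longlongrightarrow> 0) at_top" by simp
  qed
  ultimately show ?thesis by (simp add: class_KL_def)
qed

text \<open>\<open>x\<close> and \<open>e\<close> stand for the norms of the state and of the optimizer error, and \<open>\<delta>\<close> for the
  size of the disturbance.\<close>

locale small_gain =
  fixes b :: "real \<Rightarrow> real \<Rightarrow> real" and g1 s1 c C r \<rho> w \<eta> :: real
  assumes b: "class_KL b" and pos: "g1 > 0" "s1 > 0" "c > 0" "C \<ge> 0" "r > 0" "\<rho> > 0" "\<eta> \<ge> 0"
    and r: "r \<le> \<rho>" and w: "w = 1 / (4 * g1 * c)"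
    and \<eta>: "\<eta> \<le> 1 / 2" "16 * (\<eta> * C) \<le> w"
begin

lemma w_pos: "w > 0"
  using pos by (simp add: w)

lemma b_K: "t \<ge> 0 \<Longrightarrow> class_K (\<lambda>r. b r t)"
  using b by (simp add: class_KL_def)

lemma b_mono: "0 \<le> p \<Longrightarrow> p \<le> q \<Longrightarrow> t \<ge> 0 \<Longrightarrow> b p t \<le> b q t"
  using b_K[of t] strict_mono_onD[of "{0..}" "\<lambda>r. b r t" p q] by (cases "p = q") (auto simp: class_K_def)

lemma b_nonneg: "0 \<le> p \<Longrightarrow> t \<ge> 0 \<Longrightarrow> 0 \<le> b p t"
  using b_mono[of 0 p t] b_K[of t] by (simp add: class_K_def)

text \<open>The implication over \<open>s\<close>, \<open>t\<close> and \<open>k\<close> is the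
  bound of property (P) restarted at time \<open>s\<close>. Its premise excludes the end
  \<open>s + t\<close> of the window when \<open>t > 0\<close>, so it can be used in an induction
  over time. The last clause is the warm-started optimizer step, available while the state is within
  \<open>r\<close>.\<close>

definition traj :: "(nat \<Rightarrow> real) \<Rightarrow> (nat \<Rightarrow> real) \<Rightarrow> real \<Rightarrow> bool" where
  "traj x e \<delta> \<longleftrightarrow> (\<forall>t. 0 \<le> x t) \<and> (\<forall>t. 0 \<le> e t) \<and> 0 \<le> \<delta>
    \<and> (\<forall>s t k. 0 \<le> k \<longrightarrow> c * k \<le> \<rho> \<longrightarrow> x s \<le> \<rho>
        \<longrightarrow> (\<forall>i. s \<le> i \<and> i < s + t \<longrightarrow> x i \<le> \<rho> \<and> e i \<le> k)
        \<longrightarrow> x (s + t) \<le> b (x s) (real t) + g1 * (c * k) + s1 * \<delta>)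
    \<and> (\<forall>t. x t \<le> r \<longrightarrow> x (Suc t) \<le> r \<longrightarrow> e (Suc t) \<le> \<eta> * (e t + C * (x t + x (Suc t))))"

lemma traj_nonneg: "traj x e \<delta> \<Longrightarrow> 0 \<le> x t" "traj x e \<delta> \<Longrightarrow> 0 \<le> e t" "traj x e \<delta> \<Longrightarrow> 0 \<le> \<delta>"
  by (simp_all add: traj_def)

lemma traj_iss:
  assumes "traj x e \<delta>" "0 \<le> k" "c * k \<le> \<rho>" "x s \<le> \<rho>"
    and "\<And>i. s \<le> i \<Longrightarrow> i < s + t \<Longrightarrow> x i \<le> \<rho> \<and> e i \<le> k"
  shows "x (s + t) \<le> b (x s) (real t) + g1 * (c * k) + s1 * \<delta>"
  using assms unfolding traj_def by blast

text \<open>The condition \<eta> <= 1/2 halves the old error, and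
  \<open>16 * (\<eta> * C) \<le> w\<close> reduces the effect of two states of size \<open>Y\<close>
  to \<open>w * Y / 8\<close>.\<close>

lemma error_step:
  assumes tr: "traj x e \<delta>" and x: "x t \<le> r" "x (Suc t) \<le> r" "x t \<le> Y" "x (Suc t) \<le> Y" and e: "e t \<le> k"
  shows "e (Suc t) \<le> k / 2 + w * Y / 8"
proof -
  have Y: "0 \<le> Y" using traj_nonneg(1)[OF tr, of t] x(3) by linarith
  have "C * (x t + x (Suc t)) \<le> C * (2 * Y)" using x pos by (intro mult_left_mono) auto
  then have "\<eta> * (C * (x t + x (Suc t))) \<le> \<eta> * (C * (2 * Y))"
    by (rule mult_left_mono) (use pos in simp)
  moreover have "\<eta> * C * (2 * Y) \<le> w / 16 * (2 * Y)" using \<eta>(2) Y by (intro mult_right_mono) auto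
  moreover have "\<eta> * e t \<le> 1 / 2 * k"
    using \<eta>(1) e traj_nonneg(2)[OF tr, of t] pos by (intro mult_mono) auto
  moreover have "e (Suc t) \<le> \<eta> * (e t + C * (x t + x (Suc t)))"
    using tr x unfolding traj_def by blast
  ultimately show ?thesis by (simp add: algebra_simps)
qed

text \<open>An invariant level \<open>Y\<close>: the loop returns at most \<open>Y / 4\<close> to
  the state, and the factor 4 leaves room for the initial state and the disturbance. The term
  \<open>q / w\<close> places the initial error below \<open>w * Y\<close>.\<close>

definition radius :: "real \<Rightarrow> real \<Rightarrow> real \<Rightarrow> real" where
  "radius p q \<delta> = 4 * (b p 0 + q / w + s1 * \<delta>)"

text \<open>Shows the purpose of \<open>w\<close>: an error of size \<open>w * Y\<close> is fed back
  into the state as \<open>Y / 4\<close>, so \<open>w\<close> converts state levels into error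
  levels.\<close>

lemma gain_w: "g1 * (c * (w * Y)) = Y / 4" "c * (w * Y) = Y / (4 * g1)"
  using pos by (simp_all add: w)

text \<open>In the induction the bound for \<open>x t\<close> uses errors before \<open>t\<close>
  only; once it is known, the error step from \<open>t - 1\<close> bounds \<open>e t\<close>. Upper
  bounds \<open>p\<close>, \<open>q\<close> in place of the initial values make the level
  adjustable.\<close>

lemma traj_bounded:
  assumes tr: "traj x e \<delta>" and x0: "x 0 \<le> \<rho>" and p: "x 0 \<le> p" "e 0 \<le> q"
    and Y: "Y = radius p q \<delta>" "Y \<le> r" "Y \<le> 4 * g1 * \<rho>"
  shows "x t \<le> Y \<and> e t \<le> w * Y"
proof (induction t rule: less_induct)
  case (less t)
  have nn: "0 \<le> x 0" "0 \<le> e 0" "0 \<le> \<delta>" using traj_nonneg[OF tr] by auto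
  have parts: "0 \<le> b p 0" "0 \<le> q / w" "0 \<le> s1 * \<delta>" "b (x 0) 0 \<le> b p 0"
    using nn p b_nonneg b_mono pos w_pos by simp_all
  then have Y0: "0 \<le> Y" by (simp add: Y(1) radius_def)
  have e0: "e 0 \<le> w * Y"
  proof -
    have "q \<le> w * (4 * (q / w))" using w_pos nn p by simp
    also have "\<dots> \<le> w * Y" unfolding Y(1) radius_def using parts w_pos by (intro mult_left_mono) auto
    finally show ?thesis using p by simp
  qed
  show ?case
  proof (cases t)
    case 0
    \<comment> \<open>A window of length 0 is used because it relates \<open>x 0\<close> itself to
      \<open>b (x 0) 0\<close>.\<close>
    have "x (0 + 0) \<le> b (x 0) (real 0) + g1 * (c * 0) + s1 * \<delta>"
      by (rule traj_iss[OF tr]) (use pos x0 in auto)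
    then have "x 0 \<le> Y" using parts by (simp add: Y(1) radius_def)
    with e0 show ?thesis by (simp add: 0)
  next
    case (Suc i)
    have "x (0 + t) \<le> b (x 0) (real t) + g1 * (c * (w * Y)) + s1 * \<delta>"
    proof (rule traj_iss[OF tr _ _ x0])
      show "0 \<le> w * Y" using w_pos Y0 by simp
      show "c * (w * Y) \<le> \<rho>" unfolding gain_w(2) using Y(3) pos by (simp add: field_simps)
      show "x j \<le> \<rho> \<and> e j \<le> w * Y" if "j < 0 + t" for j
        using less.IH[of j] that Y(2) r by simp
    qed
    also have "b (x 0) (real t) \<le> b (x 0) 0"
    \<comment> \<open>Decay of \<open>b\<close> in time is part of the class only for a positive
      first argument; at 0 both sides vanish.\<close>
    proof (cases "x 0 = 0")
      case True
      then show ?thesis using b_K[of "real t"] b_K[of 0] by (simp add: class_K_def)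
    next
      case False
      then have "class_L (b (x 0))" using b nn by (simp add: class_KL_def)
      then show ?thesis using Suc by (auto simp: class_L_def intro!: less_imp_le)
    qed
    finally have "x t \<le> b (x 0) 0 + Y / 4 + s1 * \<delta>" by (simp only: gain_w(1) add_0)
    moreover have "Y = 4 * (b p 0) + 4 * (q / w) + 4 * (s1 * \<delta>)" by (simp add: Y(1) radius_def)
    ultimately have xt: "x t \<le> Y" using parts by linarith
    have "e (Suc i) \<le> w * Y / 2 + w * Y / 8"
      using less.IH[of i] xt Y(2) Suc by (intro error_step[OF tr]) auto
    moreover have "0 \<le> w * Y" using w_pos Y0 by simp
    ultimately have "e (Suc i) \<le> w * Y" by linarith
    then have "e t \<le> w * Y" using Suc by simp
    with xt show ?thesis by simp
  qed
qed

text \<open>Each phase halves the part of the level that does not stem from the disturbance. The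
  waiting time is uniform: \<open>b m0\<close> is used in place of \<open>b (x s)\<close>, and the
  window of length \<open>n\<close> restarts after the previous phase.\<close>

lemma traj_attracted:
  assumes m0: "0 < m0" "m0 \<le> r" "m0 \<le> 4 * g1 * \<rho>"
  shows "\<exists>T. \<forall>x e \<delta>. traj x e \<delta> \<longrightarrow> (\<forall>t. x t \<le> m0 \<and> e t \<le> w * m0) \<longrightarrow>
    (\<forall>t\<ge>T. x t \<le> m0 / 2 ^ k + 4 * s1 * \<delta> \<and> e t \<le> w * (m0 / 2 ^ k + 4 * s1 * \<delta>))"
proof (induction k)
  case 0
  have "x t \<le> m0 / 2 ^ 0 + 4 * s1 * \<delta> \<and> e t \<le> w * (m0 / 2 ^ 0 + 4 * s1 * \<delta>)"
    if "traj x e \<delta>" "\<forall>t. x t \<le> m0 \<and> e t \<le> w * m0" for x e \<delta> t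
  proof -
    have "0 \<le> s1 * \<delta>" "0 \<le> w * (s1 * \<delta>)" using traj_nonneg(3)[OF that(1)] pos w_pos by simp_all
    moreover have "x t \<le> m0" "e t \<le> w * m0" using that(2) by auto
    ultimately show ?thesis by (simp add: distrib_left)
  qed
  then show ?case by blast
next
  case (Suc k)
  then obtain T where T: "\<And>x e \<delta> t. traj x e \<delta> \<Longrightarrow> (\<forall>t. x t \<le> m0 \<and> e t \<le> w * m0) \<Longrightarrow> t \<ge> T \<Longrightarrow>
      x t \<le> m0 / 2 ^ k + 4 * s1 * \<delta> \<and> e t \<le> w * (m0 / 2 ^ k + 4 * s1 * \<delta>)"
    by blast
  define m where "m = m0 / 2 ^ k"
  have m: "m > 0" using m0 by (simp add: m_def)
  have "class_L (b m0)" using b m0 by (simp add: class_KL_def)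
  then have "(b m0 \<longlongrightarrow> 0) at_top" by (simp add: class_L_def)
  then have "eventually (\<lambda>t. b m0 t < m / 4) at_top" using m by (intro order_tendstoD) auto
  then obtain T1 where T1: "\<And>t. t \<ge> T1 \<Longrightarrow> b m0 t < m / 4"
    by (auto simp: eventually_at_top_linorder)
  obtain n :: nat where n: "T1 \<le> real n" using real_arch_simple by blast
  have "x t \<le> m / 2 + 4 * s1 * \<delta> \<and> e t \<le> w * (m / 2 + 4 * s1 * \<delta>)"
    if tr: "traj x e \<delta>" and bd: "\<forall>t. x t \<le> m0 \<and> e t \<le> w * m0" and t: "t \<ge> T + n + 2" for x e \<delta> t
  proof
    define Y where "Y = m + 4 * s1 * \<delta>"
    have YT: "x i \<le> Y \<and> e i \<le> w * Y" if "i \<ge> T" for i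
      unfolding Y_def m_def by (rule T[OF tr bd that])
    have sd: "0 \<le> s1 * \<delta>" using traj_nonneg(3)[OF tr] pos by simp
    have Y0: "0 < Y" using m sd by (simp add: Y_def)
    define s where "s = t - n"
    have s: "s \<ge> T" "t = s + n" using t by (simp_all add: s_def)
    \<comment> \<open>For a large disturbance \<open>Y\<close> may exceed \<open>m0\<close>; the
      minimum keeps the perturbation within the radius that (P) requires.\<close>
    let ?k = "w * min Y m0"
    have "x (s + n) \<le> b (x s) (real n) + g1 * (c * ?k) + s1 * \<delta>"
    proof (rule traj_iss[OF tr])
      show "0 \<le> ?k" using w_pos Y0 m0 by simp
      have "min Y m0 / (4 * g1) \<le> m0 / (4 * g1)" using pos by (intro divide_right_mono) auto
      also have "\<dots> \<le> \<rho>" using m0(3) pos by (simp add: field_simps)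
      finally show "c * ?k \<le> \<rho>" unfolding gain_w(2) .
      have xr: "x i \<le> \<rho>" for i using bd m0(2) r by (meson order_trans)
      show "x s \<le> \<rho>" by (rule xr)
      show "x i \<le> \<rho> \<and> e i \<le> ?k" if "s \<le> i" for i
        using xr YT[of i] bd that s(1) w_pos by (auto simp: min_def)
    qed
    also have "b (x s) (real n) \<le> b m0 (real n)"
      using bd traj_nonneg(1)[OF tr] by (intro b_mono) auto
    also have "b m0 (real n) \<le> m / 4" using T1[OF n] by simp
    finally have "x t \<le> m / 4 + min Y m0 / 4 + s1 * \<delta>" unfolding gain_w(1) s(2) by simp
    then have "x t \<le> m / 4 + Y / 4 + s1 * \<delta>" by (simp add: min_def split: if_splits)
    then have "x t \<le> m / 2 + 2 * (s1 * \<delta>)" by (simp add: Y_def add_divide_distrib mult.commute[of s1])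
    with sd show "x t \<le> m / 2 + 4 * s1 * \<delta>" by simp
    \<comment> \<open>One error step from level \<open>w * Y\<close> gives only 5/8 of it, two give
      7/16, which is below one half.\<close>
    obtain i where i: "t = Suc (Suc i)" "i \<ge> T" using t that by (intro that[of "t - 2"]) auto
    have le_r: "x j \<le> r" for j using bd m0(2) by (meson order_trans)
    have "e (Suc i) \<le> w * Y / 2 + w * Y / 8"
      using YT[of i] YT[of "Suc i"] i(2) by (intro error_step[OF tr le_r le_r]) auto
    from error_step[OF tr le_r le_r _ _ this, of Y]
    have "e t \<le> (w * Y / 2 + w * Y / 8) / 2 + w * Y / 8"
      using YT[of "Suc i"] YT[of t] i by auto
    moreover have "(v / 2 + v / 8) / 2 + v / 8 \<le> v / 2" if "0 \<le> v" for v :: real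
      using that by simp
    moreover have "0 \<le> w * Y" using w_pos Y0 by simp
    ultimately have "e t \<le> w * Y / 2" by (blast intro: order_trans)
    also have "\<dots> = w * (Y / 2)" by simp
    also have "\<dots> \<le> w * (m / 2 + 4 * s1 * \<delta>)"
      using w_pos sd by (intro mult_left_mono) (auto simp: Y_def add_divide_distrib mult.commute[of s1])
    finally show "e t \<le> w * (m / 2 + 4 * s1 * \<delta>)" .
  qed
  then have "\<forall>x e \<delta>. traj x e \<delta> \<longrightarrow> (\<forall>t. x t \<le> m0 \<and> e t \<le> w * m0) \<longrightarrow>
    (\<forall>t\<ge>T + n + 2. x t \<le> m / 2 + 4 * s1 * \<delta> \<and> e t \<le> w * (m / 2 + 4 * s1 * \<delta>))"
    by blast
  then show ?case by (auto simp: m_def mult.commute)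
qed

text \<open>\<open>z\<close> is any common upper bound of the initial state and error, so the result
  applies to their joint norm. The level \<open>radius\<close> supplies the stability bound and the
  uniform attraction supplies the decay bound.\<close>

theorem local_iss:
  "\<exists>rb>0. \<exists>\<beta> \<gamma>. class_KL \<beta> \<and> class_K \<gamma> \<and>
    (\<forall>x e \<delta> z. traj x e \<delta> \<longrightarrow> x 0 \<le> rb \<longrightarrow> e 0 \<le> rb \<longrightarrow> \<delta> \<le> rb \<longrightarrow> x 0 \<le> z \<longrightarrow> e 0 \<le> z \<longrightarrow>
      (\<forall>t. x t \<le> r \<and> x t + e t \<le> \<beta> z (real t) + \<gamma> \<delta>))"
proof -
  define m0 where "m0 = min r (4 * g1 * \<rho>)"
  have m0: "0 < m0" "m0 \<le> r" "m0 \<le> 4 * g1 * \<rho>" using pos by (simp_all add: m0_def)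
  have K0: "continuous_on {0..} (\<lambda>p. b p 0)" "strict_mono_on {0..} (\<lambda>p. b p 0)" "b 0 0 = 0"
    using b_K[of 0] by (simp_all add: class_K_def)
  have "continuous_on {0..} (\<lambda>p. radius p p p)"
    unfolding radius_def using w_pos by (intro continuous_intros K0(1)) auto
  then have "((\<lambda>p. radius p p p) \<longlongrightarrow> radius 0 0 0) (at 0 within {0..})"
    by (simp add: continuous_on_def)
  then have "eventually (\<lambda>p. dist (radius p p p) (radius 0 0 0) < m0) (at 0 within {0..})"
    using m0(1) by (rule tendstoD)
  then obtain d where d: "d > 0"
    "\<And>p. p \<in> {0..} \<Longrightarrow> p \<noteq> 0 \<Longrightarrow> dist p 0 < d \<Longrightarrow> dist (radius p p p) (radius 0 0 0) < m0"
    unfolding eventually_at by blast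
  \<comment> \<open>Half of \<open>d\<close> lies strictly inside the neighbourhood where
    \<open>radius\<close> is below \<open>m0\<close>; continuity at 0 applies because
    \<open>radius 0 0 0\<close> vanishes.\<close>
  define rb where "rb = min (d / 2) \<rho>"
  have rb: "rb > 0" "rb \<le> \<rho>" using d(1) pos by (simp_all add: rb_def)
  have "dist (radius rb rb rb) (radius 0 0 0) < m0"
    using rb d(1) by (intro d(2)) (auto simp: rb_def)
  then have rad: "radius rb rb rb \<le> m0" by (simp add: radius_def K0(3) dist_real_def)
  have rad_mono: "radius p q \<delta> \<le> radius p' q' \<delta>'" if "0 \<le> p" "p \<le> p'" "q \<le> q'" "\<delta> \<le> \<delta>'" for p q \<delta> p' q' \<delta>'
    unfolding radius_def using that pos w_pos b_mono[of p p' 0]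
    by (intro mult_left_mono add_mono divide_right_mono) auto
  define adm where "adm = (\<lambda>x e \<delta>. traj x e \<delta> \<and> x 0 \<le> rb \<and> e 0 \<le> rb \<and> \<delta> \<le> rb)"
  \<comment> \<open>The disturbance gain of both the stability estimate and the attraction estimate.
    Being common to them, it can be subtracted before the two are combined.\<close>
  define G where "G = (1 + w) * (4 * s1)"
  have G: "G > 0" using w_pos pos by (simp add: G_def)
  have bounded: "x t \<le> radius p q \<delta> \<and> e t \<le> w * radius p q \<delta>"
    if "adm x e \<delta>" "x 0 \<le> p" "p \<le> rb" "e 0 \<le> q" "q \<le> rb" for x e \<delta> p q t
  proof -
    have "0 \<le> p" using traj_nonneg(1)[of x e \<delta> 0] that by (simp add: adm_def)
    then have "radius p q \<delta> \<le> radius rb rb rb" using that by (intro rad_mono) (auto simp: adm_def)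
    then have "radius p q \<delta> \<le> m0" using rad by simp
    then show ?thesis
      using that rb m0 by (intro traj_bounded[where p = p and q = q]) (auto simp: adm_def)
  qed
  have all: "x t \<le> m0 \<and> e t \<le> w * m0" if a: "adm x e \<delta>" for x e \<delta> t
  proof -
    have "radius rb rb \<delta> \<le> radius rb rb rb" using a rb by (intro rad_mono) (auto simp: adm_def)
    then have le: "radius rb rb \<delta> \<le> m0" using rad by simp
    have "x t \<le> radius rb rb \<delta> \<and> e t \<le> w * radius rb rb \<delta>"
      using a by (intro bounded) (auto simp: adm_def)
    moreover have "w * radius rb rb \<delta> \<le> w * m0" using le w_pos by (intro mult_left_mono) auto
    ultimately show ?thesis using le by linarith
  qed
  define A where "A = {\<lambda>t. x t + e t - G * \<delta> | x e \<delta>. adm x e \<delta>}"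
  have "\<exists>g. class_L g \<and> (\<forall>z\<in>A. \<forall>t. z t \<le> g (real t))"
  proof (rule class_L_majorant)
    fix z t assume "z \<in> A"
    then obtain x e \<delta> where z: "z = (\<lambda>t. x t + e t - G * \<delta>)" and a: "adm x e \<delta>" by (auto simp: A_def)
    have "0 \<le> G * \<delta>" using a traj_nonneg(3)[of x e \<delta>] G by (simp add: adm_def)
    then show "z t \<le> m0 + w * m0" using all[OF a, of t] by (simp add: z)
  next
    fix h :: real assume h: "h > 0"
    have "(\<lambda>k. (1 + w) * m0 * (1 / 2) ^ k) \<longlonglongrightarrow> (1 + w) * m0 * 0"
      by (intro tendsto_intros LIMSEQ_realpow_zero) auto
    then have "eventually (\<lambda>k. (1 + w) * m0 * (1 / 2) ^ k < h) sequentially"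
      using h by (intro order_tendstoD) auto
    then obtain k where k: "(1 + w) * m0 * (1 / 2) ^ k < h"
      by (auto simp: eventually_sequentially)
    obtain T where T: "\<And>x e \<delta> t. traj x e \<delta> \<Longrightarrow> (\<forall>t. x t \<le> m0 \<and> e t \<le> w * m0) \<Longrightarrow> t \<ge> T \<Longrightarrow>
        x t \<le> m0 / 2 ^ k + 4 * s1 * \<delta> \<and> e t \<le> w * (m0 / 2 ^ k + 4 * s1 * \<delta>)"
      using traj_attracted[OF m0, of k] by blast
    have "z t \<le> h" if "z \<in> A" "t \<ge> T" for z t
    proof -
      obtain x e \<delta> where z: "z = (\<lambda>t. x t + e t - G * \<delta>)" and a: "adm x e \<delta>"
        using \<open>z \<in> A\<close> by (auto simp: A_def)
      have "traj x e \<delta>" using a by (simp add: adm_def)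
      from T[OF this _ that(2)] all[OF a]
      have "x t + e t \<le> (m0 / 2 ^ k + 4 * s1 * \<delta>) + w * (m0 / 2 ^ k + 4 * s1 * \<delta>)"
        by (intro add_mono) auto
      also have "\<dots> = (1 + w) * (m0 / 2 ^ k + 4 * s1 * \<delta>)" by (simp only: distrib_right mult_1_left)
      also have "\<dots> = (1 + w) * m0 * (1 / 2) ^ k + G * \<delta>"
        by (simp add: G_def power_one_over algebra_simps)
      finally show ?thesis using k by (simp add: z)
    qed
    then show "\<exists>T. \<forall>z\<in>A. \<forall>t\<ge>T. z t \<le> h" by blast
  qed
  then obtain g where g: "class_L g" "\<And>z t. z \<in> A \<Longrightarrow> z t \<le> g (real t)" by blast
  define S where "S = (\<lambda>p. (1 + w) * radius p p 0)"
  have S: "class_K S"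
    unfolding class_K_def
  proof (intro conjI)
    show "continuous_on {0..} S"
      unfolding S_def radius_def using w_pos by (intro continuous_intros K0(1)) auto
    show "strict_mono_on {0..} S"
    proof (rule strict_mono_onI)
      fix p q :: real assume "p \<in> {0..}" "q \<in> {0..}" "p < q"
      then have "b p 0 < b q 0" "p / w < q / w"
        using K0(2) w_pos by (auto simp: strict_mono_on_def divide_strict_right_mono)
      then show "S p < S q" unfolding S_def radius_def using w_pos by simp
    qed
    show "S 0 = 0" by (simp add: S_def radius_def K0(3))
  qed
  have "x t \<le> r \<and> x t + e t \<le> sqrt (S z * g (real t)) + G * \<delta>"
    if tr: "traj x e \<delta>" and in_rb: "x 0 \<le> rb" "e 0 \<le> rb" "\<delta> \<le> rb" and z: "x 0 \<le> z" "e 0 \<le> z" for x e \<delta> z t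
  proof
    have a: "adm x e \<delta>" using tr in_rb by (simp add: adm_def)
    show "x t \<le> r" using all[OF a, of t] m0 by simp
    \<comment> \<open>\<open>z\<close> may exceed \<open>rb\<close>, whereas the invariant level is
      available only for bounds within \<open>rb\<close>.\<close>
    define q where "q = min z rb"
    have q: "x 0 \<le> q" "e 0 \<le> q" "q \<le> rb" "q \<le> z" using z in_rb by (simp_all add: q_def)
    have q0: "0 \<le> q" using traj_nonneg(1)[OF tr, of 0] q by linarith
    have "x t + e t \<le> (1 + w) * radius q q \<delta>"
      using bounded[OF a q(1,3) q(2,3), of t] by (simp add: distrib_right)
    also have "\<dots> = S q + G * \<delta>" by (simp add: S_def radius_def G_def algebra_simps)
    also have "S q \<le> S z"
      using S q(4) q0 strict_mono_onD[of "{0..}" S q z] by (cases "q = z") (auto simp: class_K_def)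
    finally have 1: "x t + e t - G * \<delta> \<le> S z" by simp
    have "(\<lambda>t. x t + e t - G * \<delta>) \<in> A" using a by (auto simp: A_def)
    from g(2)[OF this, of t] have 2: "x t + e t - G * \<delta> \<le> g (real t)" by simp
    have "x t + e t - G * \<delta> \<le> sqrt (S z * g (real t))"
    proof (cases "0 \<le> x t + e t - G * \<delta>")
      case True
      then have "(x t + e t - G * \<delta>)\<^sup>2 \<le> S z * g (real t)"
        unfolding power2_eq_square using 1 2 by (intro mult_mono) auto
      then show ?thesis by (rule real_le_rsqrt)
    next
      case False
      have "0 \<le> S z"
        using S q0 q(4) strict_mono_onD[of "{0..}" S 0 z] by (cases "z = 0") (auto simp: class_K_def)
      then have "0 \<le> sqrt (S z * g (real t))" using class_L_pos[OF g(1), of "real t"] by simp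
      with False show ?thesis by linarith
    qed
    then show "x t + e t \<le> sqrt (S z * g (real t)) + G * \<delta>" by simp
  qed
  moreover have "class_K (\<lambda>\<delta>. G * \<delta>)"
    using G by (auto simp: class_K_def strict_mono_on_def intro!: continuous_intros)
  ultimately show ?thesis
    using rb(1) class_KL_sqrt_mult[OF S g(1)] by blast
qed

end

section \<open>Encoding of matrix-level vectors\<close>

lemma scalar_prod_sum: "scalar_prod v w = (\<Sum>i<dim_vec w. v $ i * w $ i)"
  by (simp add: scalar_prod_def atLeast0LessThan)

text \<open>Neither eigenvalues nor compactness are used. For \<open>y\<close> the preimage of
  \<open>v\<close> under \<open>W\<close>, nonnegativity of the form at \<open>C v - y\<close> reads
  \<open>C^2 q - 2 C s + y.v >= 0\<close>, where \<open>q\<close> is the form at \<open>v\<close>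
  and \<open>s = v.v\<close>. With \<open>y.v <= C s\<close> this gives
  \<open>s <= C q\<close>.\<close>

lemma pos_def_coercive:
  assumes pd: "pos_def n W" and sym: "symmetric W"
  shows "\<exists>r>0. \<forall>v. dim_vec v = n \<longrightarrow> r * scalar_prod v v \<le> quad W v"
proof -
  have W: "W \<in> carrier_mat n n" using pd by (simp add: pos_def_def)
  have "det W \<noteq> 0"
  proof
    assume "det W = 0"
    then obtain v where v: "v \<in> carrier_vec n" "v \<noteq> 0\<^sub>v n" "W *\<^sub>v v = 0\<^sub>v n"
      using det_0_iff_vec_prod_zero_field[OF W] by blast
    then have "quad W v = 0" by (simp add: quad_def)
    moreover have "quad W v > 0" using pd v by (simp add: pos_def_def carrier_vecD)
    ultimately show False by simp
  qed
  from det_non_zero_imp_unit[OF W this] obtain V where V: "V \<in> carrier_mat n n" "W * V = 1\<^sub>m n"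
    by (auto simp: Units_def ring_mat_def)
  \<comment> \<open>The entries of the inverse bound \<open>y.v\<close> by their absolute sum times
    \<open>v.v\<close>; the summand 1 keeps \<open>C\<close> positive in dimension 0.\<close>
  define C where "C = 1 + (\<Sum>i<n. \<Sum>j<n. \<bar>V $$ (i, j)\<bar>)"
  have C: "C > 0" unfolding C_def by (simp add: sum_nonneg add_pos_nonneg)
  have "1 / C * scalar_prod v v \<le> quad W v" if n: "dim_vec v = n" for v
  proof -
    have v: "v \<in> carrier_vec n" by (rule carrier_vecI[OF n])
    define y where "y = V *\<^sub>v v"
    have y: "y \<in> carrier_vec n" unfolding y_def by (rule mult_mat_vec_carrier[OF V(1) v])
    have Wy: "W *\<^sub>v y = v"
      unfolding y_def using assoc_mult_mat_vec[OF W V(1) v, symmetric] V(2) v by simp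
    define s where "s = scalar_prod v v"
    have vv: "\<bar>v $ i * v $ j\<bar> \<le> s" if "i < n" "j < n" for i j
    proof -
      have sq: "v $ i * v $ i \<le> s" if "i < n" for i
        unfolding s_def scalar_prod_sum n
        by (rule member_le_sum[of i _ "\<lambda>i. v $ i * v $ i"]) (use that in auto)
      have "2 * \<bar>v $ i * v $ j\<bar> \<le> v $ i * v $ i + v $ j * v $ j"
        using sum_squares_bound[of "\<bar>v $ i\<bar>" "\<bar>v $ j\<bar>"] by (simp add: power2_eq_square abs_mult)
      then show ?thesis using sq[OF that(1)] sq[OF that(2)] by linarith
    qed
    have s0: "0 \<le> s" unfolding s_def scalar_prod_sum by (simp add: sum_nonneg)
    have "scalar_prod y v = (\<Sum>i<n. (\<Sum>j<n. V $$ (i, j) * v $ j) * v $ i)"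
      unfolding scalar_prod_sum n y_def using V(1) n
      by (intro sum.cong) (auto simp: scalar_prod_sum)
    also have "\<dots> = (\<Sum>i<n. \<Sum>j<n. V $$ (i, j) * (v $ i * v $ j))"
      unfolding sum_distrib_right by (intro sum.cong refl) simp
    also have "\<dots> \<le> (\<Sum>i<n. \<Sum>j<n. \<bar>V $$ (i, j)\<bar> * s)"
    proof (intro sum_mono)
      fix i j assume "i \<in> {..<n}" "j \<in> {..<n}"
      then have "\<bar>V $$ (i, j)\<bar> * \<bar>v $ i * v $ j\<bar> \<le> \<bar>V $$ (i, j)\<bar> * s"
        by (intro mult_left_mono vv) auto
      then show "V $$ (i, j) * (v $ i * v $ j) \<le> \<bar>V $$ (i, j)\<bar> * s"
        by (simp add: abs_mult[symmetric] abs_le_iff)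
    qed
    also have "\<dots> \<le> C * s" using s0 by (simp add: C_def distrib_right sum_distrib_right)
    finally have yv: "scalar_prod y v \<le> C * s" .
    have Wv: "W *\<^sub>v v \<in> carrier_vec n" by (rule mult_mat_vec_carrier[OF W v])
    have Byv: "scalar_prod y (W *\<^sub>v v) = s"
      using transpose_vec_mult_scalar[OF W v y] sym Wy by (simp add: symmetric_def s_def)
    define q where "q = quad W v"
    have q: "q = scalar_prod v (W *\<^sub>v v)" by (simp add: q_def quad_def)
    let ?z = "C \<cdot>\<^sub>v v - y"
    have "W *\<^sub>v ?z = C \<cdot>\<^sub>v (W *\<^sub>v v) - v"
      using W v y Wy by (simp add: mult_minus_distrib_mat_vec mult_mat_vec)
    then have "quad W ?z = scalar_prod ?z (C \<cdot>\<^sub>v (W *\<^sub>v v)) - scalar_prod ?z v"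
      unfolding quad_def using v y Wv
      by (simp add: scalar_prod_minus_distrib[where n = n])
    also have "\<dots> = C * (C * q - s) - (C * s - scalar_prod y v)"
      using v y Wv Byv by (simp add: minus_scalar_prod_distrib[where n = n] q s_def right_diff_distrib)
    finally have z: "quad W ?z = C * (C * q - s) - (C * s - scalar_prod y v)" .
    have "0 \<le> quad W ?z"
    proof (cases "?z = 0\<^sub>v n")
      case True
      then show ?thesis using W by (simp add: quad_def)
    next
      case False
      then show ?thesis using pd v y by (auto simp: pos_def_def intro!: less_imp_le)
    qed
    with z yv have "C * s \<le> C * (C * q)" by (simp add: algebra_simps)
    then have "s \<le> C * q" using C by simp
    then show ?thesis using C by (simp add: s_def q_def field_simps)
  qed
  then show ?thesis using C by (intro exI[of _ "1 / C"]) simp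
qed

lemma pos_def_quad_nonneg:
  assumes "pos_def n W" "dim_vec v = n"
  shows "0 \<le> quad W v"
proof (cases "v = 0\<^sub>v n")
  case True
  then show ?thesis using assms by (auto simp: quad_def pos_def_def scalar_prod_def)
next
  case False
  then show ?thesis using assms by (auto simp: pos_def_def intro!: less_imp_le)
qed

section \<open>Multipliers and the nonnegative cone as finitely supported vectors\<close>

definition enc_vec :: "real vec \<Rightarrow> nat fsv" where
  "enc_vec v = restrict_fsv {..<dim_vec v} (\<lambda>i. v $ i)"

definition dec_vec :: "nat \<Rightarrow> nat fsv \<Rightarrow> real vec" where
  "dec_vec n l = vec n (coord l)"

lemma dim_dec_vec [simp]: "dim_vec (dec_vec n l) = n"
  by (simp add: dec_vec_def)

lemma coord_enc_vec: "coord (enc_vec v) i = (if i < dim_vec v then v $ i else 0)"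
  by (simp add: enc_vec_def)

lemma enc_vec_mem: "dim_vec v = n \<Longrightarrow> enc_vec v \<in> fsv_on {..<n}"
  by (simp add: fsv_on_def coord_enc_vec)

lemma dec_enc_vec [simp]: "dim_vec v = n \<Longrightarrow> dec_vec n (enc_vec v) = v"
  by (intro eq_vecI) (simp_all add: dec_vec_def coord_enc_vec)

lemma enc_dec_vec [simp]: "l \<in> fsv_on {..<n} \<Longrightarrow> enc_vec (dec_vec n l) = l"
  by (rule fsv_eqI) (simp add: coord_enc_vec dec_vec_def fsv_on_def)

lemma enc_vec_add: "dim_vec v = dim_vec w \<Longrightarrow> enc_vec (v + w) = enc_vec v + enc_vec w"
  and enc_vec_diff: "dim_vec v = dim_vec w \<Longrightarrow> enc_vec (v - w) = enc_vec v - enc_vec w"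
  and enc_vec_smult: "enc_vec (a \<cdot>\<^sub>v v) = a *\<^sub>R enc_vec v"
  by (rule fsv_eqI; simp add: coord_enc_vec)+

lemma inner_enc_vec:
  assumes "dim_vec v = dim_vec w"
  shows "inner (enc_vec v) (enc_vec w) = scalar_prod v w"
proof -
  have "inner (enc_vec v) (enc_vec w) = (\<Sum>i<dim_vec w. coord (enc_vec v) i * coord (enc_vec w) i)"
    by (rule inner_fsv_sum) (auto simp: coord_enc_vec)
  then show ?thesis using assms by (simp add: coord_enc_vec scalar_prod_sum)
qed

lemma norm_enc_vec: "norm (enc_vec v) = vnorm v"
  by (simp add: norm_eq_sqrt_inner inner_enc_vec vnorm_def)

definition nonneg_cone :: "nat \<Rightarrow> nat fsv set" where
  "nonneg_cone n = {l \<in> fsv_on {..<n}. \<forall>i. 0 \<le> coord l i}"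

lemma nonneg_cone_convex:
  assumes "v \<in> nonneg_cone n" "w \<in> nonneg_cone n" "0 \<le> t" "t \<le> 1"
  shows "v + t *\<^sub>R (w - v) \<in> nonneg_cone n"
proof -
  have "coord (v + t *\<^sub>R (w - v)) i = (1 - t) * coord v i + t * coord w i" for i
    by (simp add: algebra_simps)
  moreover have "0 \<le> (1 - t) * coord v i + t * coord w i" for i
    using assms by (simp add: nonneg_cone_def)
  moreover have "v + t *\<^sub>R (w - v) \<in> fsv_on {..<n}"
    using assms by (simp add: nonneg_cone_def fsv_on_def)
  ultimately show ?thesis by (simp add: nonneg_cone_def)
qed

lemma nonneg_cone_complete:
  assumes V: "\<And>k::nat. V k \<in> nonneg_cone n" and "Cauchy V"
  shows "\<exists>l\<in>nonneg_cone n. V \<longlonglongrightarrow> l"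
proof -
  obtain l where l: "l \<in> fsv_on {..<n}" "V \<longlonglongrightarrow> l"
    using fsv_on_Cauchy_convergent[of "{..<n}" V] assms by (auto simp: nonneg_cone_def)
  have "0 \<le> coord l i" for i
  proof (rule LIMSEQ_le_const)
    show "(\<lambda>k. coord (V k) i) \<longlonglongrightarrow> coord l i"
      by (rule bounded_linear.tendsto[OF bounded_linear_coord l(2)])
    show "\<exists>N. \<forall>k\<ge>N. 0 \<le> coord (V k) i" using V by (auto simp: nonneg_cone_def)
  qed
  with l show ?thesis by (auto simp: nonneg_cone_def)
qed

lemma enc_vec_nonneg_iff: "enc_vec v \<in> nonneg_cone (dim_vec v) \<longleftrightarrow> 0\<^sub>v (dim_vec v) \<le> v"
  by (auto simp: nonneg_cone_def enc_vec_mem coord_enc_vec less_eq_vec_def)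

lemma proj_nn_mem: "dim_vec v = n \<Longrightarrow> enc_vec (proj_nn v) \<in> nonneg_cone n"
  by (auto simp: nonneg_cone_def fsv_on_def coord_enc_vec proj_nn_def)

text \<open>Holds coordinatewise: either the first factor is 0, or the projection is 0 and the
  product is a negative number times a nonnegative one.\<close>

lemma proj_nn_variational:
  assumes n: "dim_vec v = n" and z: "z \<in> nonneg_cone n"
  shows "inner (enc_vec v - enc_vec (proj_nn v)) (z - enc_vec (proj_nn v)) \<le> 0"
proof -
  let ?a = "enc_vec v - enc_vec (proj_nn v)" and ?b = "z - enc_vec (proj_nn v)"
  have "inner ?a ?b = (\<Sum>i<n. coord ?a i * coord ?b i)"
    by (rule inner_fsv_sum) (auto simp: coord_enc_vec proj_nn_def n)
  also have "\<dots> \<le> 0"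
  proof (rule sum_nonpos)
    fix i assume "i \<in> {..<n}"
    then have "coord ?a i * coord ?b i = (v $ i - max 0 (v $ i)) * (coord z i - max 0 (v $ i))"
      by (simp add: coord_enc_vec proj_nn_def n)
    also have "\<dots> \<le> 0"
      using z by (auto simp: nonneg_cone_def max_def mult_le_0_iff)
    finally show "coord ?a i * coord ?b i \<le> 0" .
  qed
  finally show ?thesis .
qed

section \<open>Bounded linear and bilinear maps\<close>

lemma bounded_linear_restrict_fsv:
  assumes S: "finite S" and f: "\<And>i. i \<in> S \<Longrightarrow> bounded_linear (f i)"
  shows "bounded_linear (\<lambda>z. restrict_fsv S (\<lambda>i. f i z))"
proof -
  have eq: "restrict_fsv S g = (\<Sum>j\<in>S. g j *\<^sub>R restrict_fsv {j} (\<lambda>_. 1))" for g :: "'a \<Rightarrow> real"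
  proof (rule fsv_eqI)
    fix i
    have "coord (\<Sum>j\<in>S. g j *\<^sub>R restrict_fsv {j} (\<lambda>_. 1)) i
      = (\<Sum>j\<in>S. coord (g j *\<^sub>R restrict_fsv {j} (\<lambda>_. 1)) i)"
      by (rule linear_sum[OF bounded_linear.linear[OF bounded_linear_coord]])
    also have "\<dots> = (\<Sum>j\<in>S. if j = i then g j else 0)"
      by (intro sum.cong) auto
    also have "\<dots> = coord (restrict_fsv S g) i" using S by simp
    finally show "coord (restrict_fsv S g) i = coord (\<Sum>j\<in>S. g j *\<^sub>R restrict_fsv {j} (\<lambda>_. 1)) i" ..
  qed
  show ?thesis
    unfolding eq[of "\<lambda>i. f i _"] by (intro bounded_linear_sum bounded_linear_scaleR_const f)
qed

lemma bounded_bilinear_zero: "bounded_bilinear (\<lambda>x y. 0)"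
  by (rule bounded_bilinear.intro) (auto intro: exI[of _ 0])

lemma bounded_bilinear_add:
  assumes "bounded_bilinear f" "bounded_bilinear g"
  shows "bounded_bilinear (\<lambda>x y. f x y + g x y)"
proof -
  interpret f: bounded_bilinear f by fact
  interpret g: bounded_bilinear g by fact
  obtain K L where K: "\<And>x y. norm (f x y) \<le> norm x * norm y * K"
    and L: "\<And>x y. norm (g x y) \<le> norm x * norm y * L"
    using f.bounded g.bounded by blast
  show ?thesis
  proof (rule bounded_bilinear.intro)
    have "norm (f x y + g x y) \<le> norm x * norm y * (K + L)" for x y
      using norm_triangle_ineq[of "f x y" "g x y"] K[of x y] L[of x y] by (simp add: distrib_left)
    then show "\<exists>K. \<forall>x y. norm (f x y + g x y) \<le> norm x * norm y * K" by blast
  qed (simp_all add: f.add_left f.add_right g.add_left g.add_right f.scaleR_left f.scaleR_right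
      g.scaleR_left g.scaleR_right scaleR_add_right)
qed

lemma bounded_bilinear_sum:
  "(\<And>i. i \<in> I \<Longrightarrow> bounded_bilinear (f i)) \<Longrightarrow> bounded_bilinear (\<lambda>x y. \<Sum>i\<in>I. f i x y)"
  by (induction I rule: infinite_finite_induct)
    (auto intro!: bounded_bilinear_add bounded_bilinear_zero)

text \<open>The bilinear form of \<open>W\<close> pulled back along coordinate functionals.
  Matrix-level vectors of all dimensions share a type without a vector space structure, so
  boundedness is expressed through their coordinates.\<close>

definition bilin :: "nat \<Rightarrow> real mat \<Rightarrow> (nat \<Rightarrow> 'z \<Rightarrow> real) \<Rightarrow> 'z \<Rightarrow> 'z \<Rightarrow> real" where
  "bilin n W f z w = (\<Sum>p<n. \<Sum>q<n. W $$ (p, q) * (f p z * f q w))"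

lemma bounded_bilinear_bilin:
  fixes f :: "nat \<Rightarrow> 'z::real_normed_vector \<Rightarrow> real"
  assumes "\<And>p. p < n \<Longrightarrow> bounded_linear (f p)"
  shows "bounded_bilinear (bilin n W f)"
proof -
  have "bounded_bilinear (\<lambda>z w. W $$ (p, q) * (f p z * f q w))" if "p < n" "q < n" for p q
  proof -
    have "bounded_bilinear (\<lambda>z w. (W $$ (p, q) * f p z) * f q w)"
      using assms that
      by (intro bounded_bilinear.comp[OF bounded_bilinear_mult] bounded_linear_const_mult) auto
    then show ?thesis by (simp add: mult.assoc)
  qed
  then show ?thesis
    unfolding bilin_def by (intro bounded_bilinear_sum) auto
qed

lemma bilin_sym:
  assumes "symmetric W" "W \<in> carrier_mat n n"
  shows "bilin n W f z w = bilin n W f w z"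
proof -
  have W: "W $$ (p, q) = W $$ (q, p)" if "p < n" "q < n" for p q
    using assms that by (metis carrier_matD index_transpose_mat(1) symmetric_def)
  have "bilin n W f z w = (\<Sum>q<n. \<Sum>p<n. W $$ (p, q) * (f p z * f q w))"
    unfolding bilin_def by (rule sum.swap)
  also have "\<dots> = bilin n W f w z"
    unfolding bilin_def by (intro sum.cong) (auto simp: W mult.commute)
  finally show ?thesis .
qed

lemma quad_eq_bilin:
  assumes "W \<in> carrier_mat n n" "dim_vec v = n" "\<And>p. p < n \<Longrightarrow> f p z = v $ p"
  shows "quad W v = bilin n W f z z"
proof -
  have "quad W v = (\<Sum>p<n. v $ p * (\<Sum>q<n. W $$ (p, q) * v $ q))"
    unfolding quad_def scalar_prod_sum using assms(1,2)
    by (intro sum.cong) (auto simp: scalar_prod_sum)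
  also have "\<dots> = bilin n W f z z"
    unfolding bilin_def by (intro sum.cong) (auto simp: assms(3) sum_distrib_left algebra_simps)
  finally show ?thesis .
qed

section \<open>The descent lemma from subgradients\<close>

text \<open>Telescoping the subgradient inequality along a subdivision of the segment avoids
  derivatives.\<close>

lemma descent_lemma:
  fixes f :: "'l::real_inner \<Rightarrow> real"
  assumes \<Lambda>: "subspace \<Lambda>" "v \<in> \<Lambda>" "w \<in> \<Lambda>"
    and lower: "\<And>v w. v \<in> \<Lambda> \<Longrightarrow> w \<in> \<Lambda> \<Longrightarrow> f v + inner (g v) (w - v) \<le> f w"
    and lip: "\<And>v w. v \<in> \<Lambda> \<Longrightarrow> w \<in> \<Lambda> \<Longrightarrow> norm (g v - g w) \<le> L * norm (v - w)"
  shows "f w \<le> f v + inner (g v) (w - v) + L / 2 * (norm (w - v))\<^sup>2"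
proof -
  define h where "h = w - v"
  define s where "s = inner (g v) h"
  have h: "h \<in> \<Lambda>" unfolding h_def using \<Lambda> by (simp add: subspace_diff)
  \<comment> \<open>The subgradient inequality is applied at the right end of the piece, because
    from there it bounds the value at that end from above.\<close>
  have step: "f (v + t *\<^sub>R h) \<le> f (v + r *\<^sub>R h) + (t - r) * s + (t - r) * t * (L * (norm h)\<^sup>2)"
    if t: "0 \<le> r" "r \<le> t" for r t
  proof -
    define p where "p = v + t *\<^sub>R h"
    have p: "p \<in> \<Lambda>" unfolding p_def using \<Lambda> h by (simp add: subspace_add subspace_scale)
    have p': "v + r *\<^sub>R h \<in> \<Lambda>" using \<Lambda> h by (simp add: subspace_add subspace_scale)
    have "(v + r *\<^sub>R h) - p = - ((t - r) *\<^sub>R h)" by (simp add: p_def algebra_simps)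
    then have "f p \<le> f (v + r *\<^sub>R h) + (t - r) * inner (g p) h"
      using lower[OF p p'] by simp
    moreover have "inner (g p - g v) h \<le> L * (t * norm h) * norm h"
    proof -
      have "inner (g p - g v) h \<le> norm (g p - g v) * norm h" by (rule norm_cauchy_schwarz)
      also have "\<dots> \<le> L * norm (p - v) * norm h" using lip[OF p \<Lambda>(2)] by (rule mult_right_mono) simp
      finally show ?thesis using t by (simp add: p_def)
    qed
    then have "inner (g p) h \<le> s + t * (L * (norm h)\<^sup>2)"
      by (simp add: s_def inner_diff_left power2_eq_square algebra_simps)
    then have "(t - r) * inner (g p) h \<le> (t - r) * (s + t * (L * (norm h)\<^sup>2))"
      using t by (intro mult_left_mono) auto
    ultimately show ?thesis unfolding p_def by (simp add: algebra_simps)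
  qed
  \<comment> \<open>The right end points sum to an upper Riemann sum of the identity, which explains
    \<open>k * (k + 1) / 2\<close>; refinement later brings the factor down to 1/2.\<close>
  have part: "f (v + (real k / real n) *\<^sub>R h)
      \<le> f v + real k / real n * s + real k * (real k + 1) / (2 * (real n)\<^sup>2) * (L * (norm h)\<^sup>2)"
    if n: "n > 0" for n k :: nat
  proof (induction k)
    case (Suc k)
    have "f (v + (real (Suc k) / real n) *\<^sub>R h) \<le> f (v + (real k / real n) *\<^sub>R h)
        + (real (Suc k) / real n - real k / real n) * s
        + (real (Suc k) / real n - real k / real n) * (real (Suc k) / real n) * (L * (norm h)\<^sup>2)"
      by (rule step) (auto simp: divide_right_mono)
    also have "real (Suc k) / real n - real k / real n = 1 / real n"
      by (simp add: diff_divide_distrib[symmetric])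
    finally have "f (v + (real (Suc k) / real n) *\<^sub>R h)
      \<le> f v + (real k / real n * s + 1 / real n * s)
        + (real k * (real k + 1) / (2 * (real n)\<^sup>2) + 1 / real n * (real (Suc k) / real n)) * (L * (norm h)\<^sup>2)"
      using Suc by (simp add: distrib_right)
    moreover have "real k / real n * s + 1 / real n * s = real (Suc k) / real n * s"
      by (simp add: add_divide_distrib distrib_right)
    moreover have "real k * (real k + 1) / (2 * (real n)\<^sup>2) + 1 / real n * (real (Suc k) / real n)
      = real (Suc k) * (real (Suc k) + 1) / (2 * (real n)\<^sup>2)"
      using n by (simp add: field_simps power2_eq_square)
    ultimately show ?case by simp
  qed simp
  have half: "x * (x + 1) / (2 * x\<^sup>2) = 1 / 2 + (1 / x) / 2" if "x > 0" for x :: real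
    using that by (simp add: field_simps power2_eq_square)
  have "f (v + h) \<le> f v + s + (1 / 2 + 0 / 2) * (L * (norm h)\<^sup>2)"
  proof (rule LIMSEQ_le_const)
    show "(\<lambda>n. f v + s + (1 / 2 + (1 / real (Suc n)) / 2) * (L * (norm h)\<^sup>2))
        \<longlonglongrightarrow> f v + s + (1 / 2 + 0 / 2) * (L * (norm h)\<^sup>2)"
      by (intro tendsto_intros LIMSEQ_Suc[OF lim_1_over_n]) simp
    have "f (v + h) \<le> f v + s + (1 / 2 + (1 / real (Suc n)) / 2) * (L * (norm h)\<^sup>2)" for n
    proof -
      have "real (Suc n) * (real (Suc n) + 1) / (2 * (real (Suc n))\<^sup>2) = 1 / 2 + (1 / real (Suc n)) / 2"
        using half[of "real (Suc n)"] by simp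
      then show ?thesis using part[of "Suc n" "Suc n"] by simp
    qed
    then show "\<exists>N. \<forall>n\<ge>N. f (v + h) \<le> f v + s + (1 / 2 + (1 / real (Suc n)) / 2) * (L * (norm h)\<^sup>2)"
      by blast
  qed
  then show ?thesis by (simp add: h_def s_def)
qed

section \<open>The optimal control problem as a parametric quadratic program\<close>

definition state_index :: "mpc_data \<Rightarrow> (nat \<times> nat) set" where
  "state_index D = (SIGMA i:{..<nag D}. {..<ndim D i})"

definition input_index :: "mpc_data \<Rightarrow> (nat \<times> nat \<times> nat) set" where
  "input_index D = (SIGMA i:{..<nag D}. SIGMA k:{..<hor D}. {..<mdim D i})"

definition enc_state :: "mpc_data \<Rightarrow> real vec list \<Rightarrow> (nat \<times> nat) fsv" where
  "enc_state D x = restrict_fsv (state_index D) (\<lambda>(i, j). x ! i $ j)"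

definition dec_state :: "mpc_data \<Rightarrow> (nat \<times> nat) fsv \<Rightarrow> real vec list" where
  "dec_state D y = map (\<lambda>i. vec (ndim D i) (\<lambda>j. coord y (i, j))) [0..<nag D]"

definition enc_inputs :: "mpc_data \<Rightarrow> real vec list list \<Rightarrow> (nat \<times> nat \<times> nat) fsv" where
  "enc_inputs D u = restrict_fsv (input_index D) (\<lambda>(i, k, j). u ! i ! k $ j)"

definition dec_inputs :: "mpc_data \<Rightarrow> (nat \<times> nat \<times> nat) fsv \<Rightarrow> real vec list list" where
  "dec_inputs D v = map (\<lambda>i. map (\<lambda>k. vec (mdim D i) (\<lambda>j. coord v (i, k, j))) [0..<hor D]) [0..<nag D]"

lemma finite_state_index [simp]: "finite (state_index D)"
  and finite_input_index [simp]: "finite (input_index D)"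
  by (auto simp: state_index_def input_index_def)

lemma length_dec_state [simp]: "length (dec_state D y) = nag D"
  and length_dec_inputs [simp]: "length (dec_inputs D v) = nag D"
  by (simp_all add: dec_state_def dec_inputs_def)

lemma dec_state_nth [simp]: "i < nag D \<Longrightarrow> dec_state D y ! i = vec (ndim D i) (\<lambda>j. coord y (i, j))"
  by (simp add: dec_state_def)

lemma length_dec_inputs_nth [simp]: "i < nag D \<Longrightarrow> length (dec_inputs D v ! i) = hor D"
  by (simp add: dec_inputs_def)

lemma dec_inputs_nth [simp]:
  "i < nag D \<Longrightarrow> k < hor D \<Longrightarrow> dec_inputs D v ! i ! k = vec (mdim D i) (\<lambda>j. coord v (i, k, j))"
  by (simp add: dec_inputs_def)

lemma valid_dec_state: "valid_state D (dec_state D y)"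
  by (simp add: valid_state_def)

lemma dec_enc_state [simp]: "valid_state D x \<Longrightarrow> dec_state D (enc_state D x) = x"
  by (intro nth_equalityI eq_vecI) (auto simp: valid_state_def enc_state_def state_index_def)

lemma enc_state_mem: "enc_state D x \<in> fsv_on (state_index D)"
  and enc_inputs_mem: "enc_inputs D u \<in> fsv_on (input_index D)"
  unfolding enc_state_def enc_inputs_def by (simp_all add: restrict_fsv_mem)

lemma dec_state_0: "dec_state D 0 = zero_state D"
  by (intro nth_equalityI eq_vecI) (auto simp: zero_state_def)

lemma dec_inputs_0: "dec_inputs D 0 = zero_inputs D"
  by (intro nth_equalityI eq_vecI) (auto simp: zero_inputs_def)

lemma dec_enc_inputs:
  assumes "length u = nag D" "\<And>i. i < nag D \<Longrightarrow> length (u ! i) = hor D"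
    "\<And>i k. i < nag D \<Longrightarrow> k < hor D \<Longrightarrow> dim_vec (u ! i ! k) = mdim D i"
  shows "dec_inputs D (enc_inputs D u) = u"
  using assms by (intro nth_equalityI eq_vecI) (auto simp: enc_inputs_def input_index_def)

lemma vnorm_sum: "(vnorm v)\<^sup>2 = (\<Sum>j<dim_vec v. (v $ j)\<^sup>2)"
  by (simp add: vnorm_def scalar_prod_sum power2_eq_square sum_nonneg)

lemma norm_enc_state:
  assumes x: "valid_state D x"
  shows "norm (enc_state D x) = lnorm x"
proof -
  have "norm (enc_state D x) = sqrt (\<Sum>p\<in>state_index D. (coord (enc_state D x) p)\<^sup>2)"
    by (rule norm_fsv_sum) (auto simp: enc_state_def)
  also have "(\<Sum>p\<in>state_index D. (coord (enc_state D x) p)\<^sup>2)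
    = (\<Sum>i<nag D. \<Sum>j<ndim D i. (coord (enc_state D x) (i, j))\<^sup>2)"
    unfolding state_index_def by (subst sum.Sigma) (auto simp: case_prod_unfold)
  also have "\<dots> = (\<Sum>i<length x. (vnorm (x ! i))\<^sup>2)"
    using x by (auto simp: vnorm_sum valid_state_def enc_state_def state_index_def intro!: sum.cong)
  finally show ?thesis by (simp add: lnorm_def)
qed

lemma norm_fsv_input_index:
  assumes "v \<in> fsv_on (input_index D)"
  shows "(norm v)\<^sup>2 = (\<Sum>i<nag D. \<Sum>k<hor D. \<Sum>j<mdim D i. (coord v (i, k, j))\<^sup>2)"
proof -
  have "norm v = sqrt (\<Sum>p\<in>input_index D. (coord v p)\<^sup>2)"
    using assms by (intro norm_fsv_sum) (auto simp: fsv_on_def)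
  then have "(norm v)\<^sup>2 = (\<Sum>p\<in>input_index D. (coord v p)\<^sup>2)" by (simp add: sum_nonneg)
  also have "\<dots> = (\<Sum>i<nag D. \<Sum>q\<in>(SIGMA k:{..<hor D}. {..<mdim D i}). (coord v (i, q))\<^sup>2)"
    unfolding input_index_def by (subst sum.Sigma) (auto simp: case_prod_unfold)
  also have "\<dots> = (\<Sum>i<nag D. \<Sum>k<hor D. \<Sum>j<mdim D i. (coord v (i, k, j))\<^sup>2)"
    by (intro sum.cong refl, subst sum.Sigma) (auto simp: case_prod_unfold)
  finally show ?thesis .
qed

definition inp :: "mpc_data \<Rightarrow> nat \<Rightarrow> nat \<Rightarrow> (nat \<times> nat \<times> nat) fsv \<times> (nat \<times> nat) fsv \<Rightarrow> real vec" where
  "inp D i k z = dec_inputs D (fst z) ! i ! k"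

definition st :: "mpc_data \<Rightarrow> nat \<Rightarrow> nat \<Rightarrow> (nat \<times> nat \<times> nat) fsv \<times> (nat \<times> nat) fsv \<Rightarrow> real vec" where
  "st D i k z = traj D i (dec_state D (snd z) ! i) (dec_inputs D (fst z) ! i) k"

text \<open>One pair of functional and bound per row of each polyhedron and time step. The
  constraint serves as its own index, so the abstract program is instantiated with
  \<open>fst\<close> and \<open>snd\<close> for \<open>a\<close> and \<open>c\<close>.\<close>

definition constraints ::
    "mpc_data \<Rightarrow> (((nat \<times> nat \<times> nat) fsv \<times> (nat \<times> nat) fsv \<Rightarrow> real) \<times> real) set" where
  "constraints D =
    (\<Union>i<nag D. \<Union>k<hor D. (\<lambda>r. (\<lambda>z. (Cu D i *\<^sub>v inp D i k z) $ r, cu D i $ r)) ` {..<dim_row (Cu D i)})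
    \<union> (\<Union>i<nag D. \<Union>k<hor D. (\<lambda>r. (\<lambda>z. (Cx D i *\<^sub>v st D i k z) $ r, cx D i $ r)) ` {..<dim_row (Cx D i)})
    \<union> (\<Union>i<nag D. (\<lambda>r. (\<lambda>z. (CN D i *\<^sub>v st D i (hor D) z) $ r, cN D i $ r)) ` {..<dim_row (CN D i)})"

definition cost_form ::
    "mpc_data \<Rightarrow> (nat \<times> nat \<times> nat) fsv \<times> (nat \<times> nat) fsv \<Rightarrow> (nat \<times> nat \<times> nat) fsv \<times> (nat \<times> nat) fsv \<Rightarrow> real" where
  "cost_form D z w = (\<Sum>i<nag D. bilin (ndim D i) (Pw D i) (\<lambda>p z. st D i (hor D) z $ p) z w
    + (\<Sum>k<hor D. bilin (ndim D i) (Qw D i) (\<lambda>p z. st D i k z $ p) z w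
        + bilin (mdim D i) (Rw D i) (\<lambda>p z. inp D i k z $ p) z w))"

definition coup :: "mpc_data \<Rightarrow> (nat \<times> nat \<times> nat) fsv \<times> (nat \<times> nat) fsv \<Rightarrow> nat fsv" where
  "coup D z = enc_vec (coupling D (dec_inputs D (fst z)) (dec_state D (snd z)))"

text \<open>A fixed witness is chosen because the instantiation below needs a term for the
  coercivity constant.\<close>

definition coercivity :: "mpc_data \<Rightarrow> real" where
  "coercivity D = (SOME m. m > 0 \<and>
    (\<forall>v\<in>fsv_on (input_index D). m * (norm v)\<^sup>2 \<le> cost_form D (v, 0) (v, 0)))"

lemma bounded_linear_mult_mat_vec:
  fixes w :: "'z::real_normed_vector \<Rightarrow> real vec"
  assumes "r < dim_row M" "\<And>z. dim_vec (w z) = dim_col M"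
    "\<And>j. j < dim_col M \<Longrightarrow> bounded_linear (\<lambda>z. w z $ j)"
  shows "bounded_linear (\<lambda>z. (M *\<^sub>v w z) $ r)"
proof -
  have eq: "(\<lambda>z. (M *\<^sub>v w z) $ r) = (\<lambda>z. \<Sum>j<dim_col M. M $$ (r, j) * w z $ j)"
    using assms(1,2) by (simp add: scalar_prod_sum)
  show ?thesis
    unfolding eq using assms(3) by (intro bounded_linear_sum bounded_linear_const_mult) auto
qed

lemma nonneg_cone_0: "0 \<in> nonneg_cone n"
  by (simp add: nonneg_cone_def fsv_on_def)

locale mpc =
  fixes D :: mpc_data and \<epsilon> :: real
  assumes wf: "wf_data D" and A: "standing_A D" and \<epsilon>_pos: "\<epsilon> > 0"
begin

abbreviation "nl \<equiv> hor D * pdim D"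

lemma dims:
  assumes "i < nag D"
  shows "Am D i \<in> carrier_mat (ndim D i) (ndim D i)" "Bm D i \<in> carrier_mat (ndim D i) (mdim D i)"
    "dim_col (Cu D i) = mdim D i" "dim_vec (cu D i) = dim_row (Cu D i)"
    "dim_col (Cx D i) = ndim D i" "dim_vec (cx D i) = dim_row (Cx D i)"
    "dim_col (CN D i) = ndim D i" "dim_vec (cN D i) = dim_row (CN D i)"
    "Eu D i \<in> carrier_mat (pdim D) (mdim D i)" "Ex D i \<in> carrier_mat (pdim D) (ndim D i)"
    "Qw D i \<in> carrier_mat (ndim D i) (ndim D i)" "symmetric (Qw D i)"
    "Rw D i \<in> carrier_mat (mdim D i) (mdim D i)" "symmetric (Rw D i)"
    "Pw D i \<in> carrier_mat (ndim D i) (ndim D i)" "symmetric (Pw D i)"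
  using wf assms unfolding wf_data_def by blast+

lemma pos_defs:
  assumes "i < nag D"
  shows "pos_def (ndim D i) (Qw D i)" "pos_def (mdim D i) (Rw D i)" "pos_def (ndim D i) (Pw D i)"
  using A assms unfolding standing_A_def by blast+

lemma hor_pos: "hor D > 0"
  using wf by (simp add: wf_data_def)

lemma dim_inp [simp]: "i < nag D \<Longrightarrow> k < hor D \<Longrightarrow> dim_vec (inp D i k z) = mdim D i"
  by (simp add: inp_def)

lemma dim_traj:
  assumes "i < nag D" "dim_vec x = ndim D i"
  shows "dim_vec (traj D i x us k) = ndim D i"
  using dims(2)[OF assms(1)] assms(2) by (cases k) auto

lemma dim_st [simp]: "i < nag D \<Longrightarrow> dim_vec (st D i k z) = ndim D i"
  by (simp add: st_def dim_traj)

lemma bounded_linear_inp: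
  assumes "i < nag D" "k < hor D" "j < mdim D i"
  shows "bounded_linear (\<lambda>z. inp D i k z $ j)"
  using assms bounded_linear_compose[OF bounded_linear_coord bounded_linear_fst, of "(i, k, j)"]
  by (simp add: inp_def)

lemma bounded_linear_st:
  assumes i: "i < nag D"
  shows "k \<le> hor D \<Longrightarrow> j < ndim D i \<Longrightarrow> bounded_linear (\<lambda>z. st D i k z $ j)"
proof (induction k arbitrary: j)
  case 0
  then show ?case
    using i bounded_linear_compose[OF bounded_linear_coord bounded_linear_snd, of "(i, j)"]
    by (simp add: st_def)
next
  case (Suc k)
  have "st D i (Suc k) z $ j = (Am D i *\<^sub>v st D i k z) $ j + (Bm D i *\<^sub>v inp D i k z) $ j" for z
    using dims(2)[OF i] Suc.prems by (simp add: st_def inp_def)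
  moreover have "bounded_linear (\<lambda>z. (Am D i *\<^sub>v st D i k z) $ j)"
    using dims(1)[OF i] Suc i by (intro bounded_linear_mult_mat_vec) auto
  moreover have "bounded_linear (\<lambda>z. (Bm D i *\<^sub>v inp D i k z) $ j)"
    using dims(2)[OF i] Suc i by (intro bounded_linear_mult_mat_vec) (auto intro: bounded_linear_inp)
  ultimately show ?case by (simp add: bounded_linear_add)
qed

lemma finite_constraints: "finite (constraints D)"
  unfolding constraints_def by simp

lemma bounded_linear_constraint:
  assumes "g \<in> constraints D"
  shows "bounded_linear (fst g)"
  using assms unfolding constraints_def
  by (auto simp: dims simp del: index_mult_mat_vec
      intro!: bounded_linear_mult_mat_vec bounded_linear_inp bounded_linear_st)

lemma polyh_iff:
  assumes "dim_vec w = n" "dim_vec c = dim_row C"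
  shows "w \<in> polyh n C c \<longleftrightarrow> (\<forall>r<dim_row C. (C *\<^sub>v w) $ r \<le> c $ r)"
  using assms by (simp add: polyh_def less_eq_vec_def)

lemma Zset_iff: "dec_inputs D v \<in> Zset D (dec_state D y) \<longleftrightarrow> (\<forall>g\<in>constraints D. fst g (v, y) \<le> snd g)"
proof -
  have "dec_inputs D v \<in> Zset D (dec_state D y) \<longleftrightarrow>
    (\<forall>i<nag D. (\<forall>k<hor D. inp D i k (v, y) \<in> Uset D i \<and> st D i k (v, y) \<in> Xset D i)
      \<and> st D i (hor D) (v, y) \<in> Xfset D i)"
    by (auto simp: Zset_def Zset_i_def inp_def st_def)
  also have "\<dots> \<longleftrightarrow> (\<forall>i<nag D. (\<forall>k<hor D.
      (\<forall>r<dim_row (Cu D i). (Cu D i *\<^sub>v inp D i k (v, y)) $ r \<le> cu D i $ r)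
      \<and> (\<forall>r<dim_row (Cx D i). (Cx D i *\<^sub>v st D i k (v, y)) $ r \<le> cx D i $ r))
      \<and> (\<forall>r<dim_row (CN D i). (CN D i *\<^sub>v st D i (hor D) (v, y)) $ r \<le> cN D i $ r))"
    by (simp add: polyh_iff dims)
  also have "\<dots> \<longleftrightarrow> (\<forall>g\<in>constraints D. fst g (v, y) \<le> snd g)"
    unfolding constraints_def by (simp add: ball_Un) blast
  finally show ?thesis .
qed

lemma bounded_bilinear_cost_form: "bounded_bilinear (cost_form D)"
  unfolding cost_form_def
  by (intro bounded_bilinear_sum bounded_bilinear_add bounded_bilinear_bilin)
    (auto intro: bounded_linear_inp bounded_linear_st)

lemma cost_form_sym: "cost_form D z w = cost_form D w z"
  unfolding cost_form_def
  by (intro sum.cong refl arg_cong2[where f = "(+)"] bilin_sym) (auto simp: dims)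

lemma cost_eq: "cost D (dec_inputs D v) (dec_state D y) = cost_form D (v, y) (v, y) / 2"
proof -
  have "cost_i D i (dec_inputs D v ! i) (dec_state D y ! i)
    = (bilin (ndim D i) (Pw D i) (\<lambda>p z. st D i (hor D) z $ p) (v, y) (v, y)
    + (\<Sum>k<hor D. bilin (ndim D i) (Qw D i) (\<lambda>p z. st D i k z $ p) (v, y) (v, y)
        + bilin (mdim D i) (Rw D i) (\<lambda>p z. inp D i k z $ p) (v, y) (v, y))) / 2" if i: "i < nag D" for i
  proof -
    have P: "quad (Pw D i) (st D i (hor D) (v, y))
      = bilin (ndim D i) (Pw D i) (\<lambda>p z. st D i (hor D) z $ p) (v, y) (v, y)"
      using i by (intro quad_eq_bilin) (auto simp: dims)
    have Q: "quad (Qw D i) (st D i k (v, y))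
      = bilin (ndim D i) (Qw D i) (\<lambda>p z. st D i k z $ p) (v, y) (v, y)" for k
      using i by (intro quad_eq_bilin) (auto simp: dims)
    have R: "quad (Rw D i) (inp D i k (v, y))
      = bilin (mdim D i) (Rw D i) (\<lambda>p z. inp D i k z $ p) (v, y) (v, y)" if "k < hor D" for k
      using i that by (intro quad_eq_bilin) (auto simp: dims)
    have "cost_i D i (dec_inputs D v ! i) (dec_state D y ! i)
      = (quad (Pw D i) (st D i (hor D) (v, y))
        + (\<Sum>k<hor D. quad (Qw D i) (st D i k (v, y)) + quad (Rw D i) (inp D i k (v, y)))) / 2"
      by (simp add: cost_i_def st_def inp_def)
    also have "(\<Sum>k<hor D. quad (Qw D i) (st D i k (v, y)) + quad (Rw D i) (inp D i k (v, y)))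
      = (\<Sum>k<hor D. bilin (ndim D i) (Qw D i) (\<lambda>p z. st D i k z $ p) (v, y) (v, y)
        + bilin (mdim D i) (Rw D i) (\<lambda>p z. inp D i k z $ p) (v, y) (v, y))"
      by (intro sum.cong refl arg_cong2[where f = "(+)"] Q R) auto
    finally show ?thesis unfolding P .
  qed
  then show ?thesis
    unfolding cost_def cost_form_def sum_divide_distrib by (intro sum.cong refl) auto
qed

text \<open>The input weights alone give the growth; the stage and terminal state terms contribute
  something nonnegative.\<close>

lemma cost_form_coercive:
  "\<exists>m>0. \<forall>v\<in>fsv_on (input_index D). m * (norm v)\<^sup>2 \<le> cost_form D (v, 0) (v, 0)"
proof -
  have "\<exists>r>0. \<forall>w. dim_vec w = mdim D i \<longrightarrow> r * scalar_prod w w \<le> quad (Rw D i) w" if "i < nag D" for i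
    using that by (intro pos_def_coercive pos_defs dims)
  then obtain r where r: "\<And>i. i < nag D \<Longrightarrow> r i > 0"
    "\<And>i w. i < nag D \<Longrightarrow> dim_vec w = mdim D i \<Longrightarrow> r i * scalar_prod w w \<le> quad (Rw D i) w"
    by metis
  \<comment> \<open>The inserted 1 covers the case of no agents.\<close>
  define m where "m = Min (insert 1 (r ` {..<nag D}))"
  have m: "m > 0" "\<And>i. i < nag D \<Longrightarrow> m \<le> r i"
    using r(1) by (auto simp: m_def)
  have "m * (norm v)\<^sup>2 \<le> cost_form D (v, 0) (v, 0)" if v: "v \<in> fsv_on (input_index D)" for v
  proof -
    let ?z = "(v, 0 :: (nat \<times> nat) fsv)"
    have "m * (\<Sum>j<mdim D i. (coord v (i, k, j))\<^sup>2)
        \<le> bilin (ndim D i) (Qw D i) (\<lambda>p z. st D i k z $ p) ?z ?z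
          + bilin (mdim D i) (Rw D i) (\<lambda>p z. inp D i k z $ p) ?z ?z"
      if i: "i < nag D" and k: "k < hor D" for i k
    proof -
      have "m * (\<Sum>j<mdim D i. (coord v (i, k, j))\<^sup>2) \<le> r i * (\<Sum>j<mdim D i. (coord v (i, k, j))\<^sup>2)"
        using m(2)[OF i] by (intro mult_right_mono) (auto simp: sum_nonneg)
      also have S: "(\<Sum>j<mdim D i. (coord v (i, k, j))\<^sup>2) = scalar_prod (inp D i k ?z) (inp D i k ?z)"
        using i k by (simp add: scalar_prod_sum inp_def power2_eq_square)
      also have "r i * \<dots> \<le> quad (Rw D i) (inp D i k ?z)" using i k by (intro r) auto
      also have "\<dots> = bilin (mdim D i) (Rw D i) (\<lambda>p z. inp D i k z $ p) ?z ?z"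
        using i k by (intro quad_eq_bilin) (auto simp: dims)
      finally have 1: "m * (\<Sum>j<mdim D i. (coord v (i, k, j))\<^sup>2)
        \<le> bilin (mdim D i) (Rw D i) (\<lambda>p z. inp D i k z $ p) ?z ?z"
        by (simp only: S)
      have "0 \<le> quad (Qw D i) (st D i k ?z)" using i by (intro pos_def_quad_nonneg[OF pos_defs(1)]) auto
      also have "\<dots> = bilin (ndim D i) (Qw D i) (\<lambda>p z. st D i k z $ p) ?z ?z"
        using i by (intro quad_eq_bilin) (auto simp: dims)
      finally show ?thesis using 1 by simp
    qed
    then have "(\<Sum>k<hor D. m * (\<Sum>j<mdim D i. (coord v (i, k, j))\<^sup>2))
        \<le> (\<Sum>k<hor D. bilin (ndim D i) (Qw D i) (\<lambda>p z. st D i k z $ p) ?z ?z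
          + bilin (mdim D i) (Rw D i) (\<lambda>p z. inp D i k z $ p) ?z ?z)" if "i < nag D" for i
      using that by (intro sum_mono) auto
    moreover have "0 \<le> bilin (ndim D i) (Pw D i) (\<lambda>p z. st D i (hor D) z $ p) ?z ?z" if i: "i < nag D" for i
    proof -
      have "0 \<le> quad (Pw D i) (st D i (hor D) ?z)" using i by (intro pos_def_quad_nonneg[OF pos_defs(3)]) auto
      also have "\<dots> = bilin (ndim D i) (Pw D i) (\<lambda>p z. st D i (hor D) z $ p) ?z ?z"
        using i by (intro quad_eq_bilin) (auto simp: dims)
      finally show ?thesis .
    qed
    ultimately have "(\<Sum>i<nag D. \<Sum>k<hor D. m * (\<Sum>j<mdim D i. (coord v (i, k, j))\<^sup>2)) \<le> cost_form D ?z ?z"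
      unfolding cost_form_def by (intro sum_mono) (simp add: add_increasing)
    then show ?thesis
      unfolding norm_fsv_input_index[OF v] by (simp add: sum_distrib_left)
  qed
  with m(1) show ?thesis by blast
qed

lemma coercivity:
  "coercivity D > 0"
  "v \<in> fsv_on (input_index D) \<Longrightarrow> coercivity D * (norm v)\<^sup>2 \<le> cost_form D (v, 0) (v, 0)"
  using someI_ex[OF cost_form_coercive[unfolded Bex_def]] unfolding coercivity_def by auto

lemma bounded_linear_coup: "bounded_linear (coup D)"
proof -
  have "bounded_linear (\<lambda>z. coupling D (dec_inputs D (fst z)) (dec_state D (snd z)) $ j)" if j: "j < nl" for j
  proof -
    have p: "pdim D > 0" using j by (cases "pdim D = 0") auto
    then have jm: "j mod pdim D < pdim D" and jd: "j div pdim D < hor D"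
      using j by (auto simp: less_mult_imp_div_less)
    have "coupling D (dec_inputs D (fst z)) (dec_state D (snd z)) $ j
      = (\<Sum>i<nag D. (Eu D i *\<^sub>v inp D i (j div pdim D) z) $ (j mod pdim D)
          + (Ex D i *\<^sub>v st D i (j div pdim D) z) $ (j mod pdim D))" for z
      using j jm carrier_matD(1)[OF dims(10)]
      by (auto simp: coupling_def inp_def st_def simp del: index_mult_mat_vec dec_state_nth dec_inputs_nth
          intro!: sum.cong)
    moreover have "bounded_linear (\<lambda>z. (Eu D i *\<^sub>v inp D i (j div pdim D) z) $ (j mod pdim D))"
      if "i < nag D" for i
      using dims(9)[OF that] jm jd that by (intro bounded_linear_mult_mat_vec bounded_linear_inp) auto
    moreover have "bounded_linear (\<lambda>z. (Ex D i *\<^sub>v st D i (j div pdim D) z) $ (j mod pdim D))"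
      if "i < nag D" for i
      using dims(10)[OF that] jm jd that by (intro bounded_linear_mult_mat_vec bounded_linear_st) auto
    ultimately show ?thesis by (simp only:) (intro bounded_linear_sum bounded_linear_add, auto)
  qed
  then have "bounded_linear (\<lambda>z. restrict_fsv {..<nl} (\<lambda>j. coupling D (dec_inputs D (fst z)) (dec_state D (snd z)) $ j))"
    by (intro bounded_linear_restrict_fsv) auto
  moreover have "dim_vec (coupling D u x) = nl" for u x by (simp add: coupling_def)
  ultimately show ?thesis
    unfolding coup_def enc_vec_def by simp
qed

lemma bounded_linear_coup_parts:
  "bounded_linear (\<lambda>v. coup D (v, 0))" "bounded_linear (\<lambda>y. coup D (0, y))"
  by (intro bounded_linear_compose[OF bounded_linear_coup] bounded_linear_Pair
        bounded_linear_ident bounded_linear_zero)+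

sublocale qp: parametric_qp "fsv_on (input_index D)" "fsv_on (state_index D)" "constraints D" fst snd
  "cost_form D" "coercivity D" \<epsilon> "\<lambda>v. coup D (v, 0)" "\<lambda>y. coup D (0, y)" "enc_vec (bvec D)" "nonneg_cone nl"
  by (rule parametric_qp.intro)
    (fact fsv_on_subspace finite_constraints bounded_linear_constraint bounded_bilinear_cost_form
    cost_form_sym coercivity \<epsilon>_pos nonneg_cone_convex nonneg_cone_complete bounded_linear_coup_parts
    nonneg_cone_0 fsv_on_Cauchy_convergent[OF finite_input_index])+

section \<open>Identification of the primal and dual solutions with those of the abstract
  program\<close>

lemma GammaN_D:
  assumes "x \<in> GammaN D"
  shows "valid_state D x" "Zset D x \<noteq> {}"
  using assms by (auto simp: GammaN_def)

lemma feas_iff: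
  "valid_state D x \<Longrightarrow> v \<in> qp.feas (enc_state D x) \<longleftrightarrow>
    v \<in> fsv_on (input_index D) \<and> dec_inputs D v \<in> Zset D x"
  using Zset_iff[of v "enc_state D x"] by (auto simp: qp.feas_def)

lemma dec_enc_Zset:
  assumes "u \<in> Zset D x"
  shows "dec_inputs D (enc_inputs D u) = u"
  using assms by (intro dec_enc_inputs) (auto simp: Zset_def Zset_i_def polyh_def)

lemma enc_Zset_feas:
  "valid_state D x \<Longrightarrow> u \<in> Zset D x \<Longrightarrow> enc_inputs D u \<in> qp.feas (enc_state D x)"
  by (simp add: feas_iff enc_inputs_mem dec_enc_Zset)

lemma GammaN_feas: "x \<in> GammaN D \<Longrightarrow> qp.feas (enc_state D x) \<noteq> {}"
  using enc_Zset_feas GammaN_D by blast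

lemma dim_Emap [simp]: "dim_vec (Emap D u) = nl"
  and dim_Fmap [simp]: "dim_vec (Fmap D x) = nl"
  and dim_bvec [simp]: "dim_vec (bvec D) = nl"
  by (simp_all add: Emap_def Fmap_def coupling_def bvec_def)

lemma coup_Emap: "coup D (v, 0) = enc_vec (Emap D (dec_inputs D v))"
  by (simp add: coup_def Emap_def dec_state_0)

lemma coup_Fmap: "valid_state D x \<Longrightarrow> coup D (0, enc_state D x) = enc_vec (Fmap D x)"
  by (simp add: coup_def Fmap_def dec_inputs_0)

lemma Lagr_eq:
  assumes "valid_state D x" "dim_vec lam = nl"
  shows "Lagr D lam x (dec_inputs D v) = qp.lag (enc_vec lam) (enc_state D x) v"
proof -
  have lag: "qp.lag (enc_vec lam) (enc_state D x) v
    = cost_form D (v, enc_state D x) (v, enc_state D x) / 2 + inner (enc_vec lam) (coup D (v, 0))"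
    by (rule qp.lag_def)
  show ?thesis
    unfolding lag unfolding coup_Emap Lagr_def using cost_eq[of v "enc_state D x"] assms
    by (simp add: inner_enc_vec)
qed

lemma alg_step_eqs:
  assumes "alg_step D \<epsilon> \<alpha> x (lam, mu, th) = (lam', mu', th')"
  shows "mu' = proj_nn (lam + \<alpha> \<cdot>\<^sub>v (Emap D (uopt D lam x) + Fmap D x - bvec D - \<epsilon> \<cdot>\<^sub>v lam))"
    "th' = (1 + sqrt (1 + 4 * th\<^sup>2)) / 2"
    "lam' = mu' + ((th - 1) / th') \<cdot>\<^sub>v (mu' - mu)"
  using assms unfolding alg_step_def Let_def prod.case prod.inject
  by - (elim conjE, hypsubst, rule refl)+

lemma dim_alg_step:
  assumes "dim_vec lam = nl" "dim_vec mu = nl" "alg_step D \<epsilon> \<alpha> y (lam, mu, th) = (lam', mu', th')"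
  shows "dim_vec lam' = nl" "dim_vec mu' = nl"
  using assms by (auto simp: alg_step_def Let_def proj_nn_def)

context
  fixes x assumes x: "x \<in> GammaN D"
begin

lemma uopt_eq:
  assumes lam: "dim_vec lam = nl"
  shows "uopt D lam x = dec_inputs D (qp.sol (enc_vec lam) (enc_state D x))"
  unfolding uopt_def
proof (rule the_equality)
  note v = GammaN_D(1)[OF x]
  let ?s = "qp.sol (enc_vec lam) (enc_state D x)"
  have "Lagr D lam x (dec_inputs D ?s) \<le> Lagr D lam x u" if "u \<in> Zset D x" for u
    using qp.sol_le[OF enc_Zset_feas[OF v that], of "enc_vec lam"]
    by (metis Lagr_eq[OF v lam] dec_enc_Zset[OF that])
  moreover have "dec_inputs D ?s \<in> Zset D x"
    using qp.sol_feas[OF GammaN_feas[OF x]] feas_iff[OF v] by blast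
  ultimately show "dec_inputs D ?s \<in> Zset D x \<and>
      (\<forall>u\<in>Zset D x. Lagr D lam x (dec_inputs D ?s) \<le> Lagr D lam x u)"
    by blast
  fix u assume u: "u \<in> Zset D x \<and> (\<forall>w\<in>Zset D x. Lagr D lam x u \<le> Lagr D lam x w)"
  have "qp.is_sol (enc_vec lam) (enc_state D x) (enc_inputs D u)"
    unfolding qp.is_sol_def
  proof (intro conjI ballI)
    show "enc_inputs D u \<in> qp.feas (enc_state D x)" using u by (intro enc_Zset_feas v) simp
    fix w assume "w \<in> qp.feas (enc_state D x)"
    then have "Lagr D lam x u \<le> Lagr D lam x (dec_inputs D w)"
      using u by (simp add: feas_iff[OF v])
    then show "qp.lag (enc_vec lam) (enc_state D x) (enc_inputs D u) \<le> qp.lag (enc_vec lam) (enc_state D x) w"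
      using u by (simp add: Lagr_eq[OF v lam, symmetric] dec_enc_Zset[of u x])
  qed
  then show "u = dec_inputs D ?s"
    using u by (simp add: qp.sol_unique dec_enc_Zset[of u x])
qed

lemma phi_eq:
  assumes lam: "dim_vec lam = nl"
  shows "phi D \<epsilon> lam x = qp.dual (enc_vec lam) (enc_state D x)"
proof -
  note v = GammaN_D(1)[OF x]
  let ?s = "qp.sol (enc_vec lam) (enc_state D x)"
  have "(INF u\<in>Zset D x. Lagr D lam x u) = Lagr D lam x (dec_inputs D ?s)"
  proof (rule cInf_eq_minimum)
    show "Lagr D lam x (dec_inputs D ?s) \<in> Lagr D lam x ` Zset D x"
      using qp.sol_feas[OF GammaN_feas[OF x]] feas_iff[OF v] by blast
    fix y assume "y \<in> Lagr D lam x ` Zset D x"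
    then obtain u where u: "u \<in> Zset D x" "y = Lagr D lam x u" by blast
    then show "Lagr D lam x (dec_inputs D ?s) \<le> y"
      using qp.sol_le[OF enc_Zset_feas[OF v u(1)], of "enc_vec lam"]
      by (metis Lagr_eq[OF v lam] dec_enc_Zset[OF u(1)])
  qed
  then show ?thesis
    by (simp add: phi_def qp.dual_def Lagr_eq[OF v lam] norm_enc_vec)
qed

lemma psi_eq:
  assumes lam: "dim_vec lam = nl"
  shows "psi D \<epsilon> lam x = (if enc_vec lam \<in> nonneg_cone nl
    then ereal (qp.obj (enc_vec lam) (enc_state D x)) else \<infinity>)"
proof -
  have "scalar_prod lam (bvec D - Fmap D x) = inner (enc_vec lam) (enc_vec (bvec D - Fmap D x))"
    using lam by (simp add: inner_enc_vec)
  then show ?thesis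
    using enc_vec_nonneg_iff[of lam] lam
    by (simp add: psi_def phi_eq qp.obj_def enc_vec_diff coup_Fmap GammaN_D(1)[OF x])
qed

lemma Sd_eq: "Sd D \<epsilon> x = dec_vec nl (qp.dsol (enc_state D x))"
  unfolding Sd_def
proof (rule the_equality)
  let ?l = "qp.dsol (enc_state D x)"
  note ne = GammaN_feas[OF x]
  have l: "?l \<in> nonneg_cone nl" by (rule qp.dsol_mem[OF ne])
  have "?l \<in> fsv_on {..<nl}" using l by (simp add: nonneg_cone_def)
  then have enc: "enc_vec (dec_vec nl ?l) = ?l" by simp
  have psi_l: "psi D \<epsilon> (dec_vec nl ?l) x = ereal (qp.obj ?l (enc_state D x))"
    using l by (simp add: psi_eq enc)
  show "dim_vec (dec_vec nl ?l) = nl \<and>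
      (\<forall>mu. dim_vec mu = nl \<longrightarrow> psi D \<epsilon> (dec_vec nl ?l) x \<le> psi D \<epsilon> mu x)"
    unfolding psi_l using qp.dsol_le[OF ne] by (auto simp: psi_eq)
  fix lam
  assume lam: "dim_vec lam = nl \<and> (\<forall>mu. dim_vec mu = nl \<longrightarrow> psi D \<epsilon> lam x \<le> psi D \<epsilon> mu x)"
  \<comment> \<open>Comparison with a finite value shows that \<open>psi\<close> is finite at
    \<open>lam\<close>, which forces \<open>lam\<close> into the cone.\<close>
  have "psi D \<epsilon> lam x \<le> ereal (qp.obj ?l (enc_state D x))"
    using lam unfolding psi_l[symmetric] by simp
  then have K: "enc_vec lam \<in> nonneg_cone nl"
    using lam by (auto simp: psi_eq split: if_splits)
  have "qp.is_dsol (enc_state D x) (enc_vec lam)"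
    unfolding qp.is_dsol_def
  proof (intro conjI ballI K)
    fix v assume v: "v \<in> nonneg_cone nl"
    then have "enc_vec (dec_vec nl v) = v" by (simp add: nonneg_cone_def)
    moreover have "psi D \<epsilon> lam x \<le> psi D \<epsilon> (dec_vec nl v) x" using lam by simp
    ultimately show "qp.obj (enc_vec lam) (enc_state D x) \<le> qp.obj v (enc_state D x)"
      using lam K v by (simp add: psi_eq)
  qed
  then have "?l = enc_vec lam" by (rule qp.dsol_unique[OF ne])
  then show "lam = dec_vec nl ?l" using lam by simp
qed

lemma dim_Sd [simp]: "dim_vec (Sd D \<epsilon> x) = nl"
  by (simp add: Sd_eq)

lemma enc_Sd: "enc_vec (Sd D \<epsilon> x) = qp.dsol (enc_state D x)"
  using qp.dsol_mem[OF GammaN_feas[OF x]] by (simp add: Sd_eq nonneg_cone_def)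

lemma coup_mem: "coup D z \<in> fsv_on {..<nl}"
  unfolding coup_def by (rule enc_vec_mem) (simp add: coupling_def)

lemma dual_grad_mem: "l \<in> fsv_on {..<nl} \<Longrightarrow> qp.dual_grad l y \<in> fsv_on {..<nl}"
  unfolding qp.dual_grad_def
  by (intro subspace_diff subspace_scale fsv_on_subspace coup_mem)

lemma obj_grad_mem: "l \<in> fsv_on {..<nl} \<Longrightarrow> qp.obj_grad l y \<in> fsv_on {..<nl}"
  unfolding qp.obj_grad_def
  by (intro subspace_diff subspace_add fsv_on_subspace coup_mem dual_grad_mem enc_vec_mem) simp_all

text \<open>The Lipschitz hypothesis provides some gradient without a formula. If it differed from
  \<open>dual_grad\<close> by \<open>w\<close>, then along \<open>w\<close> the subgradient
  inequality would exceed the first-order expansion by \<open>t * (norm w)^2\<close>, twice what the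
  error term allows.\<close>

lemma has_grad_imp_eq:
  assumes lam: "dim_vec lam = nl" and g: "has_grad nl (\<lambda>l. phi D \<epsilon> l x) g lam"
  shows "enc_vec g = qp.dual_grad (enc_vec lam) (enc_state D x)"
proof (rule ccontr)
  let ?X = "enc_state D x" and ?l = "enc_vec lam"
  have dim_g: "dim_vec g = nl" using g by (simp add: has_grad_def)
  define w where "w = qp.dual_grad ?l ?X - enc_vec g"
  assume "enc_vec g \<noteq> qp.dual_grad ?l ?X"
  then have w0: "norm w > 0" by (simp add: w_def)
  have w: "w \<in> fsv_on {..<nl}"
    unfolding w_def using lam dim_g
    by (intro subspace_diff fsv_on_subspace dual_grad_mem enc_vec_mem)
  obtain d where d: "d > 0" and small: "\<And>h. dim_vec h = nl \<Longrightarrow> vnorm h < d \<Longrightarrow>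
      \<bar>phi D \<epsilon> (lam + h) x - phi D \<epsilon> lam x - scalar_prod g h\<bar> \<le> norm w / 2 * vnorm h"
    using g w0 unfolding has_grad_def by (meson half_gt_zero)
  define t where "t = d / (2 * norm w)"
  have t: "t > 0" "t * norm w < d" using d w0 by (simp_all add: t_def)
  define h where "h = dec_vec nl (t *\<^sub>R w)"
  have tw: "t *\<^sub>R w \<in> fsv_on {..<nl}" by (intro subspace_scale fsv_on_subspace w)
  have h: "dim_vec h = nl" "enc_vec h = t *\<^sub>R w" using tw by (simp_all add: h_def)
  have vh: "vnorm h = t * norm w" using t(1) by (simp add: norm_enc_vec[symmetric] h)
  have "enc_vec (lam + h) = ?l + t *\<^sub>R w" using h lam by (simp add: enc_vec_add)
  then have "\<bar>qp.dual (?l + t *\<^sub>R w) ?X - qp.dual ?l ?X - inner (enc_vec g) (t *\<^sub>R w)\<bar>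
      \<le> norm w / 2 * (t * norm w)"
    using small[OF h(1)] t h lam dim_g vh inner_enc_vec[of g h] by (simp add: phi_eq)
  moreover have "qp.dual ?l ?X + inner (qp.dual_grad ?l ?X) (t *\<^sub>R w) \<le> qp.dual (?l + t *\<^sub>R w) ?X"
  proof -
    have "0 \<le> \<epsilon> / 2 * (norm (t *\<^sub>R w))\<^sup>2" using \<epsilon>_pos by simp
    then show ?thesis
      using qp.dual_subgradient[OF GammaN_feas[OF x], of ?l "?l + t *\<^sub>R w"] by simp
  qed
  ultimately have "inner w (t *\<^sub>R w) \<le> norm w / 2 * (t * norm w)"
    unfolding w_def inner_diff_left by linarith
  then have "t * (norm w)\<^sup>2 \<le> t * (norm w)\<^sup>2 / 2"
    by (simp add: power2_norm_eq_inner[symmetric] power2_eq_square algebra_simps)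
  moreover have "0 < t * (norm w)\<^sup>2" using t w0 by simp
  ultimately show False by simp
qed

lemma dual_grad_lipschitz_enc:
  assumes L: "dual_grad_lipschitz D \<epsilon> L" and l: "l \<in> fsv_on {..<nl}" "l' \<in> fsv_on {..<nl}"
  shows "norm (qp.dual_grad l (enc_state D x) - qp.dual_grad l' (enc_state D x)) \<le> L * norm (l - l')"
proof -
  obtain G where G: "\<And>lam. dim_vec lam = nl \<Longrightarrow> has_grad nl (\<lambda>l. phi D \<epsilon> l x) (G lam) lam"
    and lip: "\<And>l1 l2. dim_vec l1 = nl \<Longrightarrow> dim_vec l2 = nl \<Longrightarrow> vnorm (G l1 - G l2) \<le> L * vnorm (l1 - l2)"
    using L x unfolding dual_grad_lipschitz_def by blast
  have grad: "enc_vec (G (dec_vec nl l)) = qp.dual_grad l (enc_state D x)" "dim_vec (G (dec_vec nl l)) = nl"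
    if "l \<in> fsv_on {..<nl}" for l
    using has_grad_imp_eq[OF _ G, of "dec_vec nl l"] G[of "dec_vec nl l"] that
    by (simp_all add: has_grad_def)
  have "norm (enc_vec (G (dec_vec nl l) - G (dec_vec nl l'))) \<le> L * norm (enc_vec (dec_vec nl l - dec_vec nl l'))"
    unfolding norm_enc_vec by (rule lip) simp_all
  then show ?thesis
    using l grad by (simp add: enc_vec_diff)
qed

text \<open>In the abstract scheme the multipliers \<lambda> are the extrapolated points and \<mu>
  the projected ones. The linear term of the objective leaves the Lipschitz constant
  \<open>L\<close> unchanged, and \<alpha> < 1/L turns the descent lemma into the required upper
  bound.\<close>

lemma Talg_error:
  assumes L: "L > 0" "dual_grad_lipschitz D \<epsilon> L" and \<alpha>: "0 < \<alpha>" "\<alpha> < 1 / L"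
    and lam: "dim_vec lam = nl" and l: "l \<ge> 2"
  shows "vnorm (Talg D \<epsilon> \<alpha> l lam x - Sd D \<epsilon> x)
    \<le> 6 / (sqrt (\<alpha> * \<epsilon>) * real l) * vnorm (lam - Sd D \<epsilon> x)"
proof -
  let ?X = "enc_state D x" and ?\<Lambda> = "fsv_on {..<nl}"
  note ne = GammaN_feas[OF x]
  define S where "S = (\<lambda>j. (alg_step D \<epsilon> \<alpha> x ^^ j) (lam, lam, 1))"
  define Y where "Y = (\<lambda>j. fst (S j))"
  define M where "M = (\<lambda>j. fst (snd (S j)))"
  define th where "th = (\<lambda>j. snd (snd (S j)))"
  have S_eq: "S j = (Y j, M j, th j)" for j by (simp add: Y_def M_def th_def)
  have S_Suc: "(Y (Suc j), M (Suc j), th (Suc j)) = alg_step D \<epsilon> \<alpha> x (Y j, M j, th j)" for j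
    using S_eq[of j] S_eq[of "Suc j"] by (simp add: S_def)
  have S_0: "Y 0 = lam" "M 0 = lam" "th 0 = 1" by (simp_all add: Y_def M_def th_def S_def)
  have dim: "dim_vec (Y j) = nl \<and> dim_vec (M j) = nl" for j
  proof (induction j)
    case (Suc j)
    then show ?case using dim_alg_step[OF _ _ S_Suc[symmetric]] by blast
  qed (simp add: S_0 lam)
  let ?proj = "\<lambda>v. enc_vec (proj_nn (dec_vec nl v))"
  interpret fista "\<lambda>l. qp.obj l ?X" "\<lambda>l. qp.obj_grad l ?X" ?proj ?\<Lambda> "nonneg_cone nl" \<alpha> \<epsilon>
    "qp.dsol ?X" "\<lambda>j. enc_vec (M j)" "\<lambda>j. enc_vec (Y j)" th
  proof
    show "subspace ?\<Lambda>" by (rule fsv_on_subspace)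
    show "nonneg_cone nl \<subseteq> ?\<Lambda>" by (auto simp: nonneg_cone_def)
    show "qp.dsol ?X \<in> nonneg_cone nl" by (rule qp.dsol_mem[OF ne])
    show "\<alpha> > 0" "\<epsilon> > 0" by (fact \<alpha> \<epsilon>_pos)+
    show "qp.obj_grad v ?X \<in> ?\<Lambda>" if "v \<in> ?\<Lambda>" for v by (rule obj_grad_mem[OF that])
    have lower: "qp.obj v ?X + inner (qp.obj_grad v ?X) (w - v) \<le> qp.obj w ?X" for v w
    proof -
      have "0 \<le> \<epsilon> / 2 * (norm (w - v))\<^sup>2" using \<epsilon>_pos by simp
      then show ?thesis using qp.obj_subgradient[OF ne, of v w] by linarith
    qed
    then show "qp.obj v ?X + inner (qp.obj_grad v ?X) (w - v) \<le> qp.obj w ?X" for v w .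
    show "qp.obj w ?X \<le> qp.obj v ?X + inner (qp.obj_grad v ?X) (w - v) + 1 / (2 * \<alpha>) * (norm (w - v))\<^sup>2"
      if "v \<in> ?\<Lambda>" "w \<in> ?\<Lambda>" for v w
    proof -
      have "qp.obj w ?X \<le> qp.obj v ?X + inner (qp.obj_grad v ?X) (w - v) + L / 2 * (norm (w - v))\<^sup>2"
        using fsv_on_subspace that lower
      proof (rule descent_lemma[where \<Lambda> = ?\<Lambda>])
        show "norm (qp.obj_grad v ?X - qp.obj_grad w ?X) \<le> L * norm (v - w)"
          if "v \<in> ?\<Lambda>" "w \<in> ?\<Lambda>" for v w
          using dual_grad_lipschitz_enc[OF L(2) that] by (simp add: qp.obj_grad_def)
      qed
      also have "L / 2 * (norm (w - v))\<^sup>2 \<le> 1 / (2 * \<alpha>) * (norm (w - v))\<^sup>2"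
        using L(1) \<alpha> by (intro mult_right_mono) (auto simp: field_simps)
      finally show ?thesis by simp
    qed
    show "qp.obj (qp.dsol ?X) ?X + \<epsilon> / 2 * (norm (w - qp.dsol ?X))\<^sup>2 \<le> qp.obj w ?X"
      if "w \<in> nonneg_cone nl" for w by (rule qp.dsol_growth[OF ne that])
    show "?proj v \<in> nonneg_cone nl" for v by (rule proj_nn_mem) simp
    show "inner (v - ?proj v) (z - ?proj v) \<le> 0" if "v \<in> ?\<Lambda>" "z \<in> nonneg_cone nl" for v z
      using proj_nn_variational[OF dim_dec_vec that(2), of v] that(1) by simp
    show "enc_vec (M 0) = enc_vec (Y 0)" "enc_vec (Y 0) \<in> ?\<Lambda>" "th 0 = 1"
      using lam by (simp_all add: S_0 enc_vec_mem)
    fix j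
    show "th (Suc j) = (1 + sqrt (1 + 4 * (th j)\<^sup>2)) / 2"
      by (rule alg_step_eqs(2)[OF S_Suc[symmetric]])
    have "Y (Suc j) = M (Suc j) + ((th j - 1) / th (Suc j)) \<cdot>\<^sub>v (M (Suc j) - M j)"
      by (rule alg_step_eqs(3)[OF S_Suc[symmetric]])
    then show "enc_vec (Y (Suc j)) = enc_vec (M (Suc j))
        + ((th j - 1) / th (Suc j)) *\<^sub>R (enc_vec (M (Suc j)) - enc_vec (M j))"
      using dim by (simp add: enc_vec_add enc_vec_smult enc_vec_diff)
    let ?u = "qp.sol (enc_vec (Y j)) ?X"
    define v where "v = Y j + \<alpha> \<cdot>\<^sub>v (Emap D (uopt D (Y j) x) + Fmap D x - bvec D - \<epsilon> \<cdot>\<^sub>v Y j)"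
    have "M (Suc j) = proj_nn v"
      unfolding v_def by (rule alg_step_eqs(1)[OF S_Suc[symmetric]])
    moreover have "dim_vec v = nl" using dim by (simp add: v_def)
    moreover have "enc_vec v = enc_vec (Y j) - \<alpha> *\<^sub>R qp.obj_grad (enc_vec (Y j)) ?X"
    proof -
      have "enc_vec (Emap D (uopt D (Y j) x)) = coup D (?u, 0)"
        using dim by (simp add: uopt_eq coup_Emap)
      then have "enc_vec v = enc_vec (Y j) + \<alpha> *\<^sub>R (coup D (?u, 0) + coup D (0, ?X) - enc_vec (bvec D) - \<epsilon> *\<^sub>R enc_vec (Y j))"
        unfolding v_def using dim
        by (simp add: enc_vec_add enc_vec_smult enc_vec_diff coup_Fmap GammaN_D(1)[OF x])
      then show ?thesis
        by (simp add: qp.obj_grad_def qp.dual_grad_def algebra_simps)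
    qed
    ultimately show "enc_vec (M (Suc j)) = ?proj (enc_vec (Y j) - \<alpha> *\<^sub>R qp.obj_grad (enc_vec (Y j)) ?X)"
      by (metis dec_enc_vec)
  qed
  have "Talg D \<epsilon> \<alpha> l lam x = Y l" by (simp add: Talg_def Y_def S_def)
  then show ?thesis
    using momentum_error[OF l] dim lam
    by (simp add: norm_enc_vec[symmetric] enc_vec_diff enc_Sd S_0)
qed

lemma valid_input_qfb:
  assumes "dim_vec lam = nl"
  shows "valid_input D (qfb D lam x)"
  using assms hor_pos by (simp add: valid_input_def qfb_def Xi_def uopt_eq)

end

lemma dim_Talg:
  assumes "dim_vec lam = nl"
  shows "dim_vec (Talg D \<epsilon> \<alpha> l lam x) = nl"
proof -
  have "\<exists>a b c. (alg_step D \<epsilon> \<alpha> x ^^ j) (lam, lam, 1) = (a, b, c) \<and> dim_vec a = nl \<and> dim_vec b = nl" for j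
  proof (induction j)
    case 0
    then show ?case using assms by simp
  next
    case (Suc j)
    then obtain a b c where s: "(alg_step D \<epsilon> \<alpha> x ^^ j) (lam, lam, 1) = (a, b, c)"
      "dim_vec a = nl" "dim_vec b = nl" by blast
    obtain a' b' c' where s': "alg_step D \<epsilon> \<alpha> x (a, b, c) = (a', b', c')" by (rule prod_cases3)
    show ?case using dim_alg_step[OF s(2,3) s'] s s' by simp
  qed
  from this[of l] show ?thesis by (auto simp: Talg_def)
qed

lemma lnorm_Xi_diff_le:
  assumes "v \<in> fsv_on (input_index D)" "w \<in> fsv_on (input_index D)"
  shows "lnorm (map2 (-) (Xi (dec_inputs D v)) (Xi (dec_inputs D w))) \<le> norm (v - w)"
proof -
  let ?q = "map2 (-) (Xi (dec_inputs D v)) (Xi (dec_inputs D w))"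
  have vw: "v - w \<in> fsv_on (input_index D)" using assms by (intro subspace_diff fsv_on_subspace)
  have "(vnorm (?q ! i))\<^sup>2 = (\<Sum>j<mdim D i. (coord (v - w) (i, 0, j))\<^sup>2)" if "i < nag D" for i
    using that hor_pos by (simp add: Xi_def vnorm_sum)
  then have "(\<Sum>i<length ?q. (vnorm (?q ! i))\<^sup>2) = (\<Sum>i<nag D. \<Sum>j<mdim D i. (coord (v - w) (i, 0, j))\<^sup>2)"
    by (intro sum.cong) (auto simp: Xi_def)
  also have "\<dots> \<le> (\<Sum>i<nag D. \<Sum>k<hor D. \<Sum>j<mdim D i. (coord (v - w) (i, k, j))\<^sup>2)"
    using hor_pos
    by (intro sum_mono member_le_sum[of 0 _ "\<lambda>k. \<Sum>j<mdim D i. (coord (v - w) (i, k, j))\<^sup>2" for i])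
      (auto simp: sum_nonneg)
  also have "\<dots> = (norm (v - w))\<^sup>2" by (rule norm_fsv_input_index[OF vw, symmetric])
  finally show ?thesis unfolding lnorm_def by (intro real_le_lsqrt) auto
qed

lemma qfb_lipschitz:
  "\<exists>c>0. \<forall>x\<in>GammaN D. \<forall>lam lam'. dim_vec lam = nl \<longrightarrow> dim_vec lam' = nl \<longrightarrow>
    lnorm (map2 (-) (qfb D lam x) (qfb D lam' x)) \<le> c * vnorm (lam - lam')"
proof -
  obtain c where c: "c > 0" and lip: "\<And>x l l'. qp.feas x \<noteq> {} \<Longrightarrow>
      norm (qp.sol l x - qp.sol l' x) \<le> c * norm (l - l')"
    using qp.sol_lipschitz by blast
  have "lnorm (map2 (-) (qfb D lam x) (qfb D lam' x)) \<le> c * vnorm (lam - lam')"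
    if x: "x \<in> GammaN D" and d: "dim_vec lam = nl" "dim_vec lam' = nl" for x lam lam'
  proof -
    let ?v = "\<lambda>l. qp.sol (enc_vec l) (enc_state D x)"
    have U: "?v l \<in> fsv_on (input_index D)" for l
      using qp.sol_feas[OF GammaN_feas[OF x]] by (simp add: qp.feas_def)
    have "lnorm (map2 (-) (qfb D lam x) (qfb D lam' x)) \<le> norm (?v lam - ?v lam')"
      unfolding qfb_def uopt_eq[OF x d(1)] uopt_eq[OF x d(2)] by (intro lnorm_Xi_diff_le U)
    also have "\<dots> \<le> c * norm (enc_vec lam - enc_vec lam')" by (rule lip[OF GammaN_feas[OF x]])
    finally show ?thesis using d by (simp add: norm_enc_vec[symmetric] enc_vec_diff)
  qed
  with c show ?thesis by blast
qed

end

section \<open>The closed loop\<close>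

lemma lnorm_nonneg: "0 \<le> lnorm x"
  by (simp add: lnorm_def sum_nonneg)

lemma lnorm_map_zero_vec: "lnorm (map (\<lambda>i. 0\<^sub>v (n i)) is) = 0"
  by (simp add: lnorm_def vnorm_def scalar_prod_def)

lemma vnorm_nonneg: "0 \<le> vnorm v"
  by (simp add: norm_enc_vec[symmetric])

lemma valid_sys_step:
  "valid_state D w \<Longrightarrow> valid_state D (sys_step D x v w)"
  by (simp add: valid_state_def sys_step_def)

lemma supnorm_le: "(\<And>t. lnorm (s t) \<le> k) \<Longrightarrow> supnorm s \<le> k"
  unfolding supnorm_def by (rule cSUP_least) auto

lemma lnorm_le_supnorm: "(\<And>t. lnorm (s t) \<le> k) \<Longrightarrow> lnorm (s t) \<le> supnorm s"
  unfolding supnorm_def by (rule cSUP_upper[OF UNIV_I bdd_aboveI2])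

lemma map2_add_diff_cancel:
  assumes "valid_input D p" "valid_input D q"
  shows "map2 (+) p (map2 (-) q p) = q"
  using assms by (intro nth_equalityI eq_vecI) (auto simp: valid_input_def)

lemma valid_input_diff:
  assumes "valid_input D p" "valid_input D q"
  shows "valid_input D (map2 (-) q p)"
  using assms by (simp add: valid_input_def)

locale iss_mpc = mpc D \<epsilon> for D \<epsilon> +
  fixes et g1 s1 \<rho> :: real and b1 :: "real \<Rightarrow> real \<Rightarrow> real"
  assumes P: "property_P D et g1 s1 \<rho> b1" and \<epsilon>_le: "\<epsilon> \<le> et"
    and pos: "g1 > 0" "s1 > 0" "\<rho> > 0" and b1: "class_KL b1"
begin

definition zero_input :: "real vec list" where
  "zero_input = map (\<lambda>i. 0\<^sub>v (mdim D i)) [0..<nag D]"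

lemma zero_input: "valid_input D zero_input" "lnorm zero_input = 0"
  by (simp_all add: zero_input_def valid_input_def lnorm_map_zero_vec)

lemma zero_state: "valid_state D (zero_state D)" "lnorm (zero_state D) = 0"
  by (simp_all add: zero_state_def valid_state_def lnorm_map_zero_vec)

lemma ideal_iss:
  assumes "valid_state D x0" "lnorm x0 \<le> \<rho>"
    "\<And>t. valid_input D (du t)" "\<And>t. lnorm (du t) \<le> \<rho>"
    "\<And>t. valid_state D (d t)" "\<And>t. lnorm (d t) \<le> \<rho>"
  shows "ideal_cl D \<epsilon> x0 du d t \<in> GammaN D"
    and "lnorm (ideal_cl D \<epsilon> x0 du d t)
      \<le> b1 (lnorm x0) (real t) + g1 * supnorm du + s1 * supnorm d"
  using P \<epsilon>_pos \<epsilon>_le assms unfolding property_P_def by blast+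

text \<open>Property (P) at time 0 with zero perturbations. It reduces feasibility along the closed
  loop to a bound on the state.\<close>

lemma ball_subset_GammaN:
  assumes "valid_state D x" "lnorm x \<le> \<rho>"
  shows "x \<in> GammaN D"
  using ideal_iss(1)[OF assms, of "\<lambda>_. zero_input" "\<lambda>_. zero_state D" 0]
    zero_input zero_state pos by simp

text \<open>The triangle inequality runs through the dual solution at the origin, whence the sum of
  the two norms.\<close>

lemma Sd_calm:
  "\<exists>r>0. \<exists>C\<ge>0. r \<le> \<rho> \<and> (\<forall>x y. valid_state D x \<longrightarrow> lnorm x \<le> r \<longrightarrow> valid_state D y \<longrightarrow> lnorm y \<le> r \<longrightarrow>
    vnorm (Sd D \<epsilon> x - Sd D \<epsilon> y) \<le> C * (lnorm x + lnorm y))"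
proof -
  have "qp.feas y \<noteq> {}" if "y \<in> fsv_on (state_index D)" "norm y \<le> \<rho>" for y
  proof -
    have y: "enc_state D (dec_state D y) = y"
      using that(1) by (intro fsv_eqI) (auto simp: enc_state_def state_index_def fsv_on_def)
    have "dec_state D y \<in> GammaN D"
      using norm_enc_state[OF valid_dec_state, of D y] that(2)
      by (intro ball_subset_GammaN valid_dec_state) (simp add: y)
    from GammaN_feas[OF this] show ?thesis by (simp add: y)
  qed
  then obtain s C where s: "s > 0" and C: "C \<ge> 0" and calm: "\<And>y. y \<in> fsv_on (state_index D) \<Longrightarrow> norm y \<le> s \<Longrightarrow>
      norm (qp.dsol y - qp.dsol 0) \<le> C * norm y"
    using qp.dsol_calm_at_0[OF pos(3)] by blast
  have "vnorm (Sd D \<epsilon> x - Sd D \<epsilon> y) \<le> C * (lnorm x + lnorm y)"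
    if x: "valid_state D x" "lnorm x \<le> min s \<rho>" and y: "valid_state D y" "lnorm y \<le> min s \<rho>" for x y
  proof -
    have G: "x \<in> GammaN D" "y \<in> GammaN D" using x y by (auto intro: ball_subset_GammaN)
    have "norm (qp.dsol (enc_state D x) - qp.dsol 0) \<le> C * lnorm x"
      using calm[OF enc_state_mem, of x] x by (simp add: norm_enc_state)
    moreover have "norm (qp.dsol (enc_state D y) - qp.dsol 0) \<le> C * lnorm y"
      using calm[OF enc_state_mem, of y] y by (simp add: norm_enc_state)
    moreover have "norm (qp.dsol (enc_state D x) - qp.dsol (enc_state D y))
      \<le> norm (qp.dsol (enc_state D x) - qp.dsol 0) + norm (qp.dsol (enc_state D y) - qp.dsol 0)"
      using norm_triangle_ineq4[of "qp.dsol (enc_state D x) - qp.dsol 0" "qp.dsol (enc_state D y) - qp.dsol 0"]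
      by simp
    ultimately show ?thesis
      using G by (simp add: norm_enc_vec[symmetric] enc_vec_diff enc_Sd distrib_left)
  qed
  then show ?thesis using s C pos(3) by (intro exI[of _ "min s \<rho>"] conjI exI[of _ C]) auto
qed

end

locale closed_loop = iss_mpc D \<epsilon> et g1 s1 \<rho> b1 for D \<epsilon> et g1 s1 \<rho> b1 +
  fixes \<alpha> L :: real and l :: nat and x0 :: "real vec list" and lam0 :: "real vec"
    and d :: "nat \<Rightarrow> real vec list" and c C r :: real
  assumes L: "L > 0" "dual_grad_lipschitz D \<epsilon> L" and \<alpha>: "0 < \<alpha>" "\<alpha> < 1 / L" and l: "l \<ge> 2"
    and x0: "valid_state D x0" and lam0: "dim_vec lam0 = nl"
    and d: "\<And>t. valid_state D (d t)" "\<And>t. lnorm (d t) \<le> \<rho>"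
    and c: "c > 0" "\<And>x lam lam'. x \<in> GammaN D \<Longrightarrow> dim_vec lam = nl \<Longrightarrow> dim_vec lam' = nl \<Longrightarrow>
      lnorm (map2 (-) (qfb D lam x) (qfb D lam' x)) \<le> c * vnorm (lam - lam')"
    and r: "r \<le> \<rho>" and calm: "\<And>x y. valid_state D x \<Longrightarrow> lnorm x \<le> r \<Longrightarrow> valid_state D y \<Longrightarrow> lnorm y \<le> r \<Longrightarrow>
      vnorm (Sd D \<epsilon> x - Sd D \<epsilon> y) \<le> C * (lnorm x + lnorm y)"
begin

definition loop_state :: "nat \<Rightarrow> real vec list" where
  "loop_state t = fst (alg_cl D \<epsilon> \<alpha> l x0 lam0 d t)"

definition loop_mult :: "nat \<Rightarrow> real vec" where
  "loop_mult t = snd (alg_cl D \<epsilon> \<alpha> l x0 lam0 d t)"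

definition loop_err :: "nat \<Rightarrow> real" where
  "loop_err t = vnorm (loop_mult t - Sd D \<epsilon> (loop_state t))"

lemma loop_0: "loop_state 0 = x0" "loop_mult 0 = lam0"
  by (simp_all add: loop_state_def loop_mult_def)

lemma loop_Suc:
  "loop_state (Suc t) = sys_step D (loop_state t) (qfb D (loop_mult t) (loop_state t)) (d t)"
  "loop_mult (Suc t) = Talg D \<epsilon> \<alpha> l (loop_mult t) (loop_state (Suc t))"
  by (simp_all add: loop_state_def loop_mult_def case_prod_unfold Let_def)

lemma valid_loop: "valid_state D (loop_state t)"
  using x0 d(1) by (cases t) (simp_all add: loop_0 loop_Suc valid_sys_step)

lemma dim_loop_mult: "dim_vec (loop_mult t) = nl"
  using lam0 by (induction t) (simp_all add: loop_0 loop_Suc dim_Talg)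

text \<open>The segment from time \<open>s\<close> is a run of the ideal loop whose perturbation is
  the deviation of the applied input from \<open>kappa\<close>. Outside the window nothing is known
  about the error, so the perturbation is continued by zero to satisfy the global bound in (P); the
  runs agree up to time \<open>t\<close>.\<close>

lemma loop_iss:
  assumes k: "0 \<le> k" "c * k \<le> \<rho>" and s: "lnorm (loop_state s) \<le> \<rho>"
    and before: "\<And>i. s \<le> i \<Longrightarrow> i < s + t \<Longrightarrow> lnorm (loop_state i) \<le> \<rho> \<and> loop_err i \<le> k"
  shows "lnorm (loop_state (s + t)) \<le> b1 (lnorm (loop_state s)) (real t) + g1 * (c * k) + s1 * supnorm d"
proof -
  define du where "du = (\<lambda>j. if j < t then map2 (-) (qfb D (loop_mult (s + j)) (loop_state (s + j)))
    (kappa D \<epsilon> (loop_state (s + j))) else zero_input)"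
  have G: "loop_state (s + j) \<in> GammaN D" if "j < t" for j
    using before[of "s + j"] that by (intro ball_subset_GammaN valid_loop) auto
  have valid_q: "valid_input D (qfb D (loop_mult (s + j)) (loop_state (s + j)))"
    "valid_input D (kappa D \<epsilon> (loop_state (s + j)))" if "j < t" for j
    unfolding kappa_def by (intro valid_input_qfb[OF G[OF that]] dim_loop_mult dim_Sd[OF G[OF that]])+
  have valid_du: "valid_input D (du j)" for j
    using valid_q zero_input by (auto simp: du_def intro: valid_input_diff)
  have du_le: "lnorm (du j) \<le> c * k" for j
  proof (cases "j < t")
    case True
    then have "lnorm (du j) \<le> c * loop_err (s + j)"
      unfolding loop_err_def du_def kappa_def
      using c(2)[OF G[OF True] dim_loop_mult dim_Sd[OF G[OF True]]] by simp
    also have "\<dots> \<le> c * k" using before[of "s + j"] True c(1) by (intro mult_left_mono) auto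
    finally show ?thesis .
  next
    case False
    then show ?thesis using k c(1) by (simp add: du_def zero_input)
  qed
  have eq: "ideal_cl D \<epsilon> (loop_state s) du (\<lambda>j. d (s + j)) j = loop_state (s + j)" if "j \<le> t" for j
    using that
  proof (induction j)
    case (Suc j)
    then have j: "j < t" by simp
    have "map2 (+) (kappa D \<epsilon> (loop_state (s + j))) (du j) = qfb D (loop_mult (s + j)) (loop_state (s + j))"
      using j map2_add_diff_cancel[OF valid_q(2,1)[OF j]] by (simp add: du_def)
    then show ?case using Suc j by (simp add: loop_Suc Let_def)
  qed simp
  have "lnorm (loop_state (s + t)) \<le> b1 (lnorm (loop_state s)) (real t) + g1 * supnorm du + s1 * supnorm (\<lambda>j. d (s + j))"
    unfolding eq[OF order_refl, symmetric]
    using du_le k by (intro ideal_iss(2) valid_loop s valid_du d) (meson order_trans)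
  also have "\<dots> \<le> b1 (lnorm (loop_state s)) (real t) + g1 * (c * k) + s1 * supnorm d"
    using pos d(2) by (intro add_mono mult_left_mono supnorm_le du_le lnorm_le_supnorm) auto
  finally show ?thesis .
qed

text \<open>The warm start \<open>loop_mult t\<close> is away from the new dual solution by at most
  the old error plus the shift of the solution, which calmness bounds.\<close>

lemma loop_err_Suc:
  assumes "lnorm (loop_state t) \<le> r" "lnorm (loop_state (Suc t)) \<le> r"
  shows "loop_err (Suc t) \<le> 6 / (sqrt (\<alpha> * \<epsilon>) * real l)
    * (loop_err t + C * (lnorm (loop_state t) + lnorm (loop_state (Suc t))))"
proof -
  have G: "loop_state t \<in> GammaN D" "loop_state (Suc t) \<in> GammaN D"
    using assms r by (auto intro!: ball_subset_GammaN valid_loop)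
  have "loop_err (Suc t) \<le> 6 / (sqrt (\<alpha> * \<epsilon>) * real l) * vnorm (loop_mult t - Sd D \<epsilon> (loop_state (Suc t)))"
    unfolding loop_err_def loop_Suc(2) by (rule Talg_error[OF G(2) L \<alpha> dim_loop_mult l])
  moreover have "vnorm (loop_mult t - Sd D \<epsilon> (loop_state (Suc t)))
    \<le> loop_err t + vnorm (Sd D \<epsilon> (loop_state t) - Sd D \<epsilon> (loop_state (Suc t)))"
    using norm_triangle_ineq[of "enc_vec (loop_mult t) - enc_vec (Sd D \<epsilon> (loop_state t))"
        "enc_vec (Sd D \<epsilon> (loop_state t)) - enc_vec (Sd D \<epsilon> (loop_state (Suc t)))"] G
    by (simp add: loop_err_def norm_enc_vec[symmetric] enc_vec_diff dim_loop_mult)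
  moreover have "vnorm (Sd D \<epsilon> (loop_state t) - Sd D \<epsilon> (loop_state (Suc t)))
    \<le> C * (lnorm (loop_state t) + lnorm (loop_state (Suc t)))"
    by (rule calm[OF valid_loop assms(1) valid_loop assms(2)])
  ultimately show ?thesis
    using \<alpha> \<epsilon>_pos by (elim order_trans) (intro mult_left_mono, auto)
qed

end

context iss_mpc
begin

theorem closed_loop_LISS:
  assumes L: "L > 0" "dual_grad_lipschitz D \<epsilon> L" and \<alpha>: "0 < \<alpha>" "\<alpha> < 1 / L"
  shows "\<exists>lstar>0. \<forall>l::nat. real l \<ge> lstar \<longrightarrow> LISS D \<epsilon> \<alpha> l"
proof -
  note rho = pos(3)
  obtain c where c: "c > 0" "\<And>x lam lam'. x \<in> GammaN D \<Longrightarrow> dim_vec lam = nl \<Longrightarrow> dim_vec lam' = nl \<Longrightarrow>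
      lnorm (map2 (-) (qfb D lam x) (qfb D lam' x)) \<le> c * vnorm (lam - lam')"
    using qfb_lipschitz by blast
  obtain r C where rr: "r > 0" "r \<le> \<rho>" and C: "C \<ge> 0" and
    calm: "\<And>x y. valid_state D x \<Longrightarrow> lnorm x \<le> r \<Longrightarrow> valid_state D y \<Longrightarrow> lnorm y \<le> r \<Longrightarrow>
      vnorm (Sd D \<epsilon> x - Sd D \<epsilon> y) \<le> C * (lnorm x + lnorm y)"
    using Sd_calm by blast
  define w where "w = 1 / (4 * g1 * c)"
  have w: "w > 0" using pos c(1) by (simp add: w_def)
  \<comment> \<open>These are the two conditions of the small-gain argument; \<open>C + 1\<close>
    avoids division by zero.\<close>
  define \<eta>0 where "\<eta>0 = min (1 / 2) (w / (16 * (C + 1)))"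
  have \<eta>0: "\<eta>0 > 0" using w C by (simp add: \<eta>0_def)
  have \<eta>0_C: "16 * (\<eta>0 * C) \<le> w"
  proof -
    have "\<eta>0 * C \<le> w / (16 * (C + 1)) * (C + 1)"
      using C w \<eta>0 by (intro mult_mono) (auto simp: \<eta>0_def)
    also have "w / (16 * (C + 1)) * (C + 1) = w / 16" using C by (simp add: field_simps)
    finally show ?thesis by simp
  qed
  \<comment> \<open>The bound 2 admits the error estimate of the algorithm, the other term pushes
    the contraction factor below \<open>\<eta>0\<close>.\<close>
  define lstar where "lstar = max 2 (6 / (sqrt (\<alpha> * \<epsilon>) * \<eta>0))"
  have "LISS D \<epsilon> \<alpha> l" if l: "real l \<ge> lstar" for l
  proof -
    define \<eta> where "\<eta> = 6 / (sqrt (\<alpha> * \<epsilon>) * real l)"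
    have sq: "sqrt (\<alpha> * \<epsilon>) > 0" using \<alpha> \<epsilon>_pos by simp
    have l2: "l \<ge> 2" "real l > 0" and "6 / (sqrt (\<alpha> * \<epsilon>) * \<eta>0) \<le> real l"
      using l by (auto simp: lstar_def)
    then have \<eta>_le: "\<eta> \<le> \<eta>0" using sq \<eta>0 by (simp add: \<eta>_def field_simps)
    interpret small_gain b1 g1 s1 c C r \<rho> w \<eta>
    proof
      show "\<eta> \<le> 1 / 2" using \<eta>_le by (simp add: \<eta>0_def)
      have "\<eta> * C \<le> \<eta>0 * C" using \<eta>_le C by (rule mult_right_mono)
      then show "16 * (\<eta> * C) \<le> w" using \<eta>0_C by simp
      show "0 \<le> \<eta>" using sq by (simp add: \<eta>_def)
    qed (fact b1 pos c(1) C rr w_def)+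
    obtain rb \<beta> \<gamma> where rb: "rb > 0" and KL: "class_KL \<beta>" "class_K \<gamma>" and
      iss: "\<And>x e \<delta> z t. traj x e \<delta> \<Longrightarrow> x 0 \<le> rb \<Longrightarrow> e 0 \<le> rb \<Longrightarrow> \<delta> \<le> rb \<Longrightarrow> x 0 \<le> z \<Longrightarrow> e 0 \<le> z \<Longrightarrow>
        x t \<le> r \<and> x t + e t \<le> \<beta> z (real t) + \<gamma> \<delta>"
      using local_iss by blast
    \<comment> \<open>The radius is cut at \<rho> so that the disturbances are admissible in
      (P).\<close>
    have "let (x, lam) = alg_cl D \<epsilon> \<alpha> l x0 lam0 d t in x \<in> GammaN D \<and>
        pnorm x (lam - Sd D \<epsilon> x) \<le> \<beta> (pnorm x0 (lam0 - Sd D \<epsilon> x0)) (real t) + \<gamma> (supnorm d)"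
      if x0: "valid_state D x0" and lam0: "dim_vec lam0 = nl" and d: "\<forall>t. valid_state D (d t)"
        and small: "lnorm x0 \<le> min rb \<rho>" "vnorm (lam0 - Sd D \<epsilon> x0) \<le> min rb \<rho>" "\<forall>t. lnorm (d t) \<le> min rb \<rho>"
      for x0 lam0 d t
    proof -
      have d_le: "\<And>t. lnorm (d t) \<le> \<rho>" "\<And>t. lnorm (d t) \<le> rb" and dv: "\<And>t. valid_state D (d t)"
        using small(3) d by auto
      interpret cl: closed_loop D \<epsilon> et g1 s1 \<rho> b1 \<alpha> L l x0 lam0 d c C r
        by unfold_locales (fact L \<alpha> l2(1) x0 lam0 dv d_le(1) c rr(2) calm)+
      let ?x = "\<lambda>t. fst (alg_cl D \<epsilon> \<alpha> l x0 lam0 d t)" and ?lam = "\<lambda>t. snd (alg_cl D \<epsilon> \<alpha> l x0 lam0 d t)"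
      let ?e = "\<lambda>t. vnorm (?lam t - Sd D \<epsilon> (?x t))"
      note defs = cl.loop_state_def cl.loop_mult_def cl.loop_err_def
      have tr: "traj (\<lambda>t. lnorm (?x t)) ?e (supnorm d)"
        unfolding traj_def
      proof (intro conjI allI impI)
        show "0 \<le> supnorm d"
          using lnorm_le_supnorm[of d, OF d_le(1), of 0] lnorm_nonneg[of "d 0"] by linarith
        show "lnorm (?x (s + t)) \<le> b1 (lnorm (?x s)) (real t) + g1 * (c * k) + s1 * supnorm d"
          if "0 \<le> k" "c * k \<le> \<rho>" "lnorm (?x s) \<le> \<rho>"
            "\<forall>i. s \<le> i \<and> i < s + t \<longrightarrow> lnorm (?x i) \<le> \<rho> \<and> ?e i \<le> k" for s t k
          using that unfolding defs[symmetric] by (intro cl.loop_iss) auto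
        show "?e (Suc t) \<le> \<eta> * (?e t + C * (lnorm (?x t) + lnorm (?x (Suc t))))"
          if "lnorm (?x t) \<le> r" "lnorm (?x (Suc t)) \<le> r" for t
          using that unfolding defs[symmetric] \<eta>_def by (intro cl.loop_err_Suc)
      qed (simp_all add: lnorm_nonneg vnorm_nonneg)
      define z where "z = pnorm x0 (lam0 - Sd D \<epsilon> x0)"
      have z: "lnorm x0 \<le> z" "vnorm (lam0 - Sd D \<epsilon> x0) \<le> z"
        unfolding z_def pnorm_def by (rule real_le_rsqrt, simp)+
      have res: "lnorm (?x t) \<le> r \<and> lnorm (?x t) + ?e t \<le> \<beta> z (real t) + \<gamma> (supnorm d)"
        using small z by (intro iss[OF tr]) (auto intro!: supnorm_le d_le(2))
      have "?x t \<in> GammaN D"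
        using res rr cl.valid_loop[of t] by (intro ball_subset_GammaN) (simp_all add: defs)
      moreover have "pnorm (?x t) (?lam t - Sd D \<epsilon> (?x t)) \<le> lnorm (?x t) + ?e t"
        unfolding pnorm_def by (rule sqrt_sum_squares_le_sum) (simp_all add: lnorm_nonneg vnorm_nonneg)
      ultimately show ?thesis
        using res by (simp add: case_prod_unfold Let_def z_def)
    qed
    then show ?thesis
      unfolding LISS_def using rb rho KL by (intro exI[of _ "min rb \<rho>"] conjI exI[of _ \<beta>] exI[of _ \<gamma>]) auto
  qed
  moreover have "lstar > 0" by (simp add: lstar_def)
  ultimately show ?thesis by blast
qed

end

theorem theorem4:
  fixes D :: mpc_data
    and et g1 s1 rho eps L alpha :: real
    and b1 :: "real \<Rightarrow> real \<Rightarrow> real"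
  assumes "wf_data D" and "standing_A D"
    and "et > 0" and "g1 > 0" and "s1 > 0" and "rho > 0" and "class_KL b1"
    and "property_P D et g1 s1 rho b1"
    and "0 < eps" and "eps \<le> et"
    and "L > 0" and "dual_grad_lipschitz D eps L"
    and "0 < alpha" and "alpha < 1 / L"
  shows "\<exists>lstar::real. lstar > 0 \<and>
           (\<forall>l::nat. real l > 2 / sqrt (alpha * eps) - 1 \<and> real l \<ge> lstar
              \<longrightarrow> LISS D eps alpha l)"
proof -
  interpret iss_mpc D eps et g1 s1 rho b1
    using assms by unfold_locales auto
  show ?thesis
    using closed_loop_LISS[OF assms(11-14)] by blast
qed

end
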